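(* There is an absolute constant $C>0$ such that the operator $(\mathbf{T}G)(x)=\int_{\mathbb{S}^2}G(x\cdot\omega,\omega)\,d\omega$ satisfies the following. (a) Let $b>a>0$ with $b/a\le 2$. If $G\in L^2(\mathbb{R}\times\mathbb{S}^2)$ is supported in $([-b,-a]\cup[a,b])\times\mathbb{S}^2$, then $$\int_{|x|>R}|\mathbf{T}G(x)|^6\,dx\le C\,\frac{(a/R)^2(1-a/b)^3}{1-a/R}\,\|G\|_{L^2(\mathbb{R}\times\mathbb{S}^2)}^6\qquad\text{for all } R\ge b,$$ and $$\int_{\mathbb{R}^3}|\mathbf{T}G(x)|^6\,dx\le C\,(1-a/b)^2\,\|G\|_{L^2(\mathbb{R}\times\mathbb{S}^2)}^6.$$ (b) Let $R\ge b>0$. If $G\in L^2(\mathbb{R}\times\mathbb{S}^2)$ is supported in $[-b,b]\times\mathbb{S}^2$, then $$\int_{|x|>R}|\mathbf{T}G(x)|^6\,dx\le C\,(b/R)^2\,\|G\|_{L^2(\mathbb{R}\times\mathbb{S}^2)}^6.$$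
   Context: $\mathbb{S}^2$ is the unit sphere in $\mathbb{R}^3$ with surface measure $d\omega$, and $L^2(\mathbb{R}\times\mathbb{S}^2)$ is taken with respect to $ds\,d\omega$. For $G\in L^2(\mathbb{R}\times\mathbb{S}^2)$, $(\mathbf{T}G)(x)=\int_{\mathbb{S}^2}G(x\cdot\omega,\omega)\,d\omega$ for (almost every) $x\in\mathbb{R}^3$; $\mathbf{T}$ is a bounded linear operator from $L^2(\mathbb{R}\times\mathbb{S}^2)$ to $\dot H^1(\mathbb{R}^3)$ and hence to $L^6(\mathbb{R}^3)$. It is the adjoint of the Radon transform on $\mathbb{R}^3$. *)

theory Defs
  imports "HOL-Analysis.Analysis"
begin

(* Surface measure on the unit sphere of R^3, via polar coordinates:
   sigma(A) = 3 * vol {t w | 0 < t < 1, w : A}.  The factor 3 is the dimension, because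
   the integral of t^2 over (0,1) is 1/3. *)
definition sphere_measure :: "(real^3) measure" where
  "sphere_measure =
     scale_measure 3
       (distr (restrict_space lborel (ball 0 1 - {0})) (restrict_space borel (sphere 0 1))
          (\<lambda>x. x /\<^sub>R norm x))"

lemma space_sphere_measure: "space sphere_measure = sphere 0 1"
  by (simp add: sphere_measure_def space_scale_measure space_restrict_space)

lemma sets_sphere_measure: "sets sphere_measure = sets (restrict_space borel (sphere 0 1))"
  by (simp add: sphere_measure_def)

lemma emeasure_sphere_measure:
  assumes "A \<in> sets borel" "A \<subseteq> sphere 0 1"
  shows "emeasure sphere_measure A
           = 3 * emeasure lborel {x. 0 < norm x \<and> norm x < 1 \<and> x /\<^sub>R norm x \<in> A}"
proof -
  let ?B = "ball 0 1 - {0} :: (real^3) set"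
  let ?N = "restrict_space lborel ?B"
  have m: "(\<lambda>x. x /\<^sub>R norm x) \<in> measurable ?N (restrict_space borel (sphere 0 1))"
    by (rule measurable_restrict_space2) (auto simp: space_restrict_space intro: measurable_restrict_space1)
  have A: "A \<in> sets (restrict_space borel (sphere 0 1))"
    using assms by (auto simp: sets_restrict_space)
  have eq: "(\<lambda>x. x /\<^sub>R norm x) -` A \<inter> space ?N
      = {x. 0 < norm x \<and> norm x < 1 \<and> x /\<^sub>R norm x \<in> A}"
    by (auto simp: space_restrict_space)
  have "?B \<inter> space lborel \<in> sets lborel" by simp
  then show ?thesis
    unfolding sphere_measure_def emeasure_scale_measure emeasure_distr[OF m A] eq
    by (subst emeasure_restrict_space) auto
qed

lemma emeasure_sphere_measure_total: "emeasure sphere_measure (sphere 0 1) = ennreal (4 * pi)"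
proof -
  have "{x::real^3. 0 < norm x \<and> norm x < 1 \<and> x /\<^sub>R norm x \<in> sphere 0 1} = ball 0 1 - {0}"
    by auto
  moreover have "emeasure lborel (ball 0 1 - {0} :: (real^3) set) = emeasure lborel (ball 0 1 :: (real^3) set)"
    by (subst emeasure_Diff) auto
  moreover have "emeasure lborel (ball 0 1 :: (real^3) set) = ennreal (4 / 3 * pi)"
    by (simp add: emeasure_ball eval_unit_ball_vol)
  moreover have "(3::ennreal) * ennreal (4 / 3 * pi) = ennreal (4 * pi)"
    by (simp flip: ennreal_numeral ennreal_mult)
  ultimately show ?thesis
    by (simp add: emeasure_sphere_measure)
qed

(* The measure ds dw on R x S^2.  Its space is UNIV \<times> sphere 0 1, so the values of
   G :: real \<times> real^3 => complex off the sphere play no role below. *)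
definition cyl_measure :: "(real \<times> (real^3)) measure" where
  "cyl_measure = lborel \<Otimes>\<^sub>M sphere_measure"

(* Elements of L^2(R x S^2) are given by (Borel) representatives. *)
definition in_L2 :: "(real \<times> (real^3) \<Rightarrow> complex) \<Rightarrow> bool" where
  "in_L2 G \<longleftrightarrow>
     G \<in> borel_measurable cyl_measure \<and> integrable cyl_measure (\<lambda>p. (norm (G p))\<^sup>2)"

definition L2_norm :: "(real \<times> (real^3) \<Rightarrow> complex) \<Rightarrow> real" where
  "L2_norm G = sqrt (LINT p|cyl_measure. (norm (G p))\<^sup>2)"

(* Support in the sense of L^2 classes: G vanishes almost everywhere on (R - K) x S^2. *)
definition supported_in :: "(real \<times> (real^3) \<Rightarrow> complex) \<Rightarrow> real set \<Rightarrow> bool" where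
  "supported_in G K \<longleftrightarrow> (AE p in cyl_measure. fst p \<notin> K \<longrightarrow> G p = 0)"

(* For G in L^2 the integrand is integrable for almost every x; on the exceptional null set
   the Bochner integral is 0 by convention. *)
definition T_op :: "(real \<times> (real^3) \<Rightarrow> complex) \<Rightarrow> real^3 \<Rightarrow> complex" where
  "T_op G x = (LINT w|sphere_measure. G (x \<bullet> w, w))"

end

theory Submission
  imports Defs
begin

text \<open>
  Everything rests on the absolute value of the determinant, \<open>vol3 u v w = |det(u,v,w)|\<close>, of
  three directions.  For fixed directions the linear map \<open>x \<mapsto> (x \<bullet> u, x \<bullet> v, x \<bullet> w)\<close> has Jacobian
  \<open>vol3 u v w\<close>, so integrating \<open>H(x \<bullet> u,u)\<^sup>2 H(x \<bullet> v,v)\<^sup>2 H(x \<bullet> w,w)\<^sup>2 vol3 u v w\<close> over \<open>x\<close> and over the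
  three directions gives at most the sixth power of the \<open>L\<^sup>2\<close> norm of \<open>H\<close>.  It is therefore enough
  to bound, for each single \<open>x\<close> and \<open>g(w) = |G(x \<bullet> w,w)|\<close>,
  \<open>(\<integral> g)\<^sup>6 \<le> C A(x) \<integral>\<integral>\<integral> g(u)\<^sup>2 g(v)\<^sup>2 g(w)\<^sup>2 vol3 u v w du dv dw\<close>,
  where the integral of \<open>g\<close> is restricted to the band of directions \<open>w\<close> for which \<open>x \<bullet> w\<close> lies in the
  support; the supremum of \<open>A(x)\<close> is then the constant of the theorem.

  This pointwise inequality (\<open>band_integral_pow6_le_axis\<close>) follows from an abstract one
  (\<open>integral_pow6_le_triple_integral\<close>).  Write \<open>(\<integral>g)\<^sup>6\<close> as an integral over three pairs
  \<open>(x\<^sub>i,y\<^sub>i)\<close> and weight each of the eight ways of choosing one point from every pair so that the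
  weights multiply to one; the arithmetic-geometric mean inequality bounds the product of the six
  values of \<open>g\<close> by the mean of eight terms.  In each of them three variables carry \<open>g\<^sup>2\<close> and the
  other three can be integrated out one by one, provided that
  \<open>\<integral> (vol3 u y z)\<^sup>-\<^sup>1\<^sup>/\<^sup>3 P(u,y)\<^sup>-\<^sup>1 P(u,z)\<^sup>-\<^sup>1 du \<le> K P(y,z)\<^sup>-\<^sup>2\<close>
  for a suitable symmetric weight \<open>P\<close>; then \<open>A = K\<^sup>3\<close>.

  After a rotation the band is \<open>{w. w\<^sub>3 \<in> J}\<close>.  In the central projection \<open>w \<mapsto> (w\<^sub>1/w\<^sub>3, w\<^sub>2/w\<^sub>3)\<close> the
  determinant is the product of the heights \<open>w\<^sub>3\<close> with twice a planar triangle area, the circles of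
  constant height are circles around the origin, and \<open>P(y,z)\<close> is the quarter power of the distance of
  the projections times \<open>|y\<^sub>3 z\<^sub>3|\<^sup>1\<^sup>/\<^sup>3\<close>.  On every single circle the kernel condition holds with a
  universal constant after scaling (\<open>circle_kernel\<close>), because the distance to a line, restricted to
  a circle, is bounded below by a multiple of the product of the distances to at most two points of the circle.
  Summing over the heights gives \<open>K = C \<integral>\<^sub>J |s|\<^sup>-\<^sup>1\<^sup>/\<^sup>3 (1 - s\<^sup>2)\<^sup>-\<^sup>1\<^sup>/\<^sup>3 ds\<close>.  Estimating this one-dimensional
  integral for the set \<open>J\<close> of all \<open>s\<close> with \<open>|x| s\<close> in the support of \<open>G\<close> yields all three estimates at once.
\<close>

section \<open>An inequality for the sixth power of an integral\<close>

definition pair_kernel :: "('a \<Rightarrow> 'a \<Rightarrow> 'a \<Rightarrow> real) \<Rightarrow> ('a \<Rightarrow> 'a \<Rightarrow> real) \<Rightarrow> 'a \<Rightarrow> 'a \<Rightarrow> 'a \<Rightarrow> real" where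
  "pair_kernel D P u y z = D u y z powr (-1/3) / (P u y * P u z)"

text \<open>
  One of the eight terms of the arithmetic-geometric mean inequality: the chosen points \<open>x\<^sub>1, x\<^sub>2, x\<^sub>3\<close>
  carry \<open>g\<^sup>2\<close> and \<open>D\<close>, and each factor \<open>pair_kernel \<dots> * P\<^sup>2\<close> contains just one of the points
  \<open>y\<^sub>1, y\<^sub>2, y\<^sub>3\<close> that were left out.
\<close>

definition triple_term where
  "triple_term g D P x1 x2 x3 y1 y2 y3 =
     (g x1 * g x2 * g x3)\<^sup>2 * D x1 x2 x3 *
     ((pair_kernel D P y1 x2 x3 * (P x2 x3)\<^sup>2) * (pair_kernel D P y2 x1 x3 * (P x1 x3)\<^sup>2) *
      (pair_kernel D P y3 x1 x2 * (P x1 x2)\<^sup>2))"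

text \<open>
  The convexity bound \<open>exp z \<ge> 1 + z\<close>, applied to the logarithm \<open>z\<close> of the quotient of the term by
  the product of the six values of \<open>g\<close>.  The point of this form is that \<open>z\<close> is linear in the
  logarithms of the values of \<open>g\<close>, \<open>D\<close> and \<open>P\<close>, each with its arguments in index order.
\<close>

lemma triple_term_ge:
  fixes g :: "'a \<Rightarrow> real"
  assumes D: "\<And>x y z. D x y z = D y x z" "\<And>x y z. D x y z = D x z y" and P: "\<And>x y. P x y = P y x"
  assumes pos: "0 < D x1 x2 x3" "0 < D y1 x2 x3" "0 < D x1 y2 x3" "0 < D x1 x2 y3"
    "0 < P x1 x2" "0 < P x1 x3" "0 < P x2 x3"
    "0 < P y1 x2" "0 < P y1 x3" "0 < P x1 y2" "0 < P y2 x3" "0 < P x1 y3" "0 < P x2 y3"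
    "0 < g x1" "0 < g x2" "0 < g x3" "0 < g y1" "0 < g y2" "0 < g y3"
  shows "g x1 * g y1 * (g x2 * g y2) * (g x3 * g y3) *
     (1 + (ln (g x1) + ln (g x2) + ln (g x3) - ln (g y1) - ln (g y2) - ln (g y3)
        + ln (D x1 x2 x3) - (ln (D y1 x2 x3) + ln (D x1 y2 x3) + ln (D x1 x2 y3)) / 3
        + 2 * (ln (P x1 x2) + ln (P x1 x3) + ln (P x2 x3))
        - (ln (P y1 x2) + ln (P y1 x3) + ln (P x1 y2) + ln (P y2 x3) + ln (P x1 y3) + ln (P x2 y3))))
     \<le> triple_term g D P x1 x2 x3 y1 y2 y3"
    (is "?G * (1 + ?Z) \<le> _")
proof -
  have third: "d powr (-1/3) = exp (- (ln d / 3))" if "0 < d" for d :: real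
    using that by (simp add: powr_def)
  have split: "?Z = (ln (g x1) + ln (g x2) + ln (g x3)) - (ln (g y1) + ln (g y2) + ln (g y3)) + ln (D x1 x2 x3)
      + (- (ln (D y1 x2 x3) / 3) + - (ln (D x1 y2 x3) / 3) + - (ln (D x1 x2 y3) / 3))
      + 2 * (ln (P x1 x2) + ln (P x1 x3) + ln (P x2 x3))
      - (ln (P y1 x2) + ln (P y1 x3) + ln (P x1 y2) + ln (P y2 x3) + ln (P x1 y3) + ln (P x2 y3))"
    by (simp add: add_divide_distrib)
  have e: "exp ?Z = g x1 * g x2 * g x3 / (g y1 * g y2 * g y3) * D x1 x2 x3 
      * (D y1 x2 x3 powr (-1/3) * D x1 y2 x3 powr (-1/3) * D x1 x2 y3 powr (-1/3)) * (P x1 x2 * P x1 x3 * P x2 x3)\<^sup>2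
      / (P y1 x2 * P y1 x3 * P x1 y2 * P y2 x3 * P x1 y3 * P x2 y3)"
    unfolding split third[OF pos(2)] third[OF pos(3)] third[OF pos(4)]
    using pos by (simp only: exp_add exp_diff exp_double exp_ln)
  have s: "D y2 x1 x3 = D x1 y2 x3" "D y3 x1 x2 = D x1 x2 y3" "P y2 x1 = P x1 y2" "P y3 x1 = P x1 y3" "P y3 x2 = P x2 y3"
    by (metis D P)+
  have "?G * (1 + ?Z) \<le> ?G * exp ?Z"
    using pos by (intro mult_left_mono exp_ge_add_one_self) auto
  also have "\<dots> = triple_term g D P x1 x2 x3 y1 y2 y3"
    unfolding e triple_term_def pair_kernel_def s using pos
    by (simp add: divide_simps) (simp add: power2_eq_square mult_ac)
  finally show ?thesis .
qed

text \<open>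
  The arithmetic-geometric mean inequality for the eight terms.  Exchanging \<open>x\<^sub>i\<close> and \<open>y\<^sub>i\<close> for the
  indices \<open>i\<close> in a subset permutes them, and their eight logarithms cancel: every value of \<open>D\<close> occurs
  once with exponent \<open>1\<close> and three times with exponent \<open>-1/3\<close>, every value of \<open>P\<close> twice with exponent
  \<open>2\<close> and four times with exponent \<open>-1\<close>.
\<close>

lemma mean_triple_terms_ge:
  fixes g :: "'a \<Rightarrow> real"
  assumes D: "\<And>x y z. D x y z = D y x z" "\<And>x y z. D x y z = D x z y" and P: "\<And>x y. P x y = P y x"
  assumes g: "\<And>x. 0 \<le> g x" and D0: "\<And>x y z. 0 \<le> D x y z" and P0: "\<And>x y. 0 \<le> P x y" 
  assumes pos: "\<And>a b. a \<in> {x1,y1} \<Longrightarrow> b \<in> {x2,y2} \<Longrightarrow> 0 < P a b" "\<And>a b. a \<in> {x1,y1} \<Longrightarrow> b \<in> {x3,y3} \<Longrightarrow> 0 < P a b"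
     "\<And>a b. a \<in> {x2,y2} \<Longrightarrow> b \<in> {x3,y3} \<Longrightarrow> 0 < P a b"
     "\<And>a b c. a \<in> {x1,y1} \<Longrightarrow> b \<in> {x2,y2} \<Longrightarrow> c \<in> {x3,y3} \<Longrightarrow> 0 < D a b c"
  shows "8 * (g x1 * g y1 * (g x2 * g y2) * (g x3 * g y3)) \<le>
     (triple_term g D P x1 x2 x3 y1 y2 y3 + triple_term g D P y1 x2 x3 x1 y2 y3
     + (triple_term g D P x1 y2 x3 y1 x2 y3 + triple_term g D P y1 y2 x3 x1 x2 y3)
     + (triple_term g D P x1 x2 y3 y1 y2 x3 + triple_term g D P y1 x2 y3 x1 y2 x3
     + (triple_term g D P x1 y2 y3 y1 x2 x3 + triple_term g D P y1 y2 y3 x1 x2 x3)))"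
proof (cases "0 < g x1 \<and> 0 < g x2 \<and> 0 < g x3 \<and> 0 < g y1 \<and> 0 < g y2 \<and> 0 < g y3")
  case True
  have sum: "G * (1 + z1) \<le> t1 \<Longrightarrow> G * (1 + z2) \<le> t2 \<Longrightarrow> G * (1 + z3) \<le> t3 \<Longrightarrow> G * (1 + z4) \<le> t4 \<Longrightarrow>
      G * (1 + z5) \<le> t5 \<Longrightarrow> G * (1 + z6) \<le> t6 \<Longrightarrow> G * (1 + z7) \<le> t7 \<Longrightarrow> G * (1 + z8) \<le> t8 \<Longrightarrow>
      z1 + z2 + z3 + z4 + z5 + z6 + z7 + z8 = 0 \<Longrightarrow>
      8 * G \<le> t1 + t2 + (t3 + t4) + (t5 + t6 + (t7 + t8))" for G z1 z2 z3 z4 z5 z6 z7 z8 t1 t2 t3 t4 t5 t6 t7 t8 :: real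
  proof -
    assume a: "G * (1 + z1) \<le> t1" "G * (1 + z2) \<le> t2" "G * (1 + z3) \<le> t3" "G * (1 + z4) \<le> t4"
      "G * (1 + z5) \<le> t5" "G * (1 + z6) \<le> t6" "G * (1 + z7) \<le> t7" "G * (1 + z8) \<le> t8"
      and z: "z1 + z2 + z3 + z4 + z5 + z6 + z7 + z8 = 0"
    have "8 * G = G * (8 + (z1 + z2 + z3 + z4 + z5 + z6 + z7 + z8))" using z by simp
    also have "\<dots> = G * (1 + z1) + G * (1 + z2) + G * (1 + z3) + G * (1 + z4)
        + G * (1 + z5) + G * (1 + z6) + G * (1 + z7) + G * (1 + z8)" by algebra
    finally show ?thesis using a by linarith
  qed
  note ge = triple_term_ge[where g = g and D = D and P = P, OF D P]
  have c: "g y1 * g x1 = g x1 * g y1" "g y2 * g x2 = g x2 * g y2" "g y3 * g x3 = g x3 * g y3"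
    by simp_all
  show ?thesis
    apply (rule sum)
            apply (rule ge, (simp add: pos True)+)
           apply (subst c(1)[symmetric], rule ge, (simp add: pos True)+)
          apply (subst c(2)[symmetric], rule ge, (simp add: pos True)+)
         apply (subst c(1)[symmetric], subst c(2)[symmetric], rule ge, (simp add: pos True)+)
        apply (subst c(3)[symmetric], rule ge, (simp add: pos True)+)
       apply (subst c(1)[symmetric], subst c(3)[symmetric], rule ge, (simp add: pos True)+)
      apply (subst c(2)[symmetric], subst c(3)[symmetric], rule ge, (simp add: pos True)+)
     apply (subst c(1)[symmetric], subst c(2)[symmetric], subst c(3)[symmetric], rule ge, (simp add: pos True)+)
    apply (simp add: field_simps)
    done
next
  case False
  have "0 \<le> triple_term g D P a1 a2 a3 b1 b2 b3" for a1 a2 a3 b1 b2 b3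
    unfolding triple_term_def pair_kernel_def by (intro mult_nonneg_nonneg divide_nonneg_nonneg) (auto simp: D0 P0)
  moreover have "g x1 * g y1 * (g x2 * g y2) * (g x3 * g y3) = 0"
    using False g by (auto simp: less_le)
  ultimately show ?thesis
    by (simp only: mult_zero_right) (intro add_nonneg_nonneg; blast)
qed

text \<open>
  The order of integration keeps the two members of a pair next to each other.  Exchanging them then
  is one application of Fubini's theorem, and the almost everywhere positivity of \<open>P\<close> and \<open>D\<close> can be
  established one variable at a time.
\<close>

definition pair_nested :: "'a measure \<Rightarrow> ('a \<Rightarrow> 'a \<Rightarrow> 'a \<Rightarrow> 'a \<Rightarrow> 'a \<Rightarrow> 'a \<Rightarrow> ennreal) \<Rightarrow> ennreal" where
  "pair_nested M F = (\<integral>\<^sup>+x1. \<integral>\<^sup>+y1. \<integral>\<^sup>+x2. \<integral>\<^sup>+y2. \<integral>\<^sup>+x3. \<integral>\<^sup>+y3. F x1 x2 x3 y1 y2 y3 \<partial>M \<partial>M \<partial>M \<partial>M \<partial>M \<partial>M)"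

lemma nn_integral_swap:
  fixes f :: "'a \<Rightarrow> 'b \<Rightarrow> ennreal"
  assumes "sigma_finite_measure M" "sigma_finite_measure N" "(\<lambda>p. f (fst p) (snd p)) \<in> borel_measurable (M \<Otimes>\<^sub>M N)"
  shows "(\<integral>\<^sup>+x. \<integral>\<^sup>+y. f x y \<partial>N \<partial>M) = (\<integral>\<^sup>+y. \<integral>\<^sup>+x. f x y \<partial>M \<partial>N)"
proof -
  interpret pair_sigma_finite M N using assms by (simp add: pair_sigma_finite_def)
  show ?thesis using Fubini'[of f] assms(3) by (simp add: case_prod_beta')
qed

lemma measurable_curry6:
  assumes F: "(\<lambda>(x1,x2,x3,y1,y2,y3). F x1 x2 x3 y1 y2 y3) \<in> borel_measurable (M \<Otimes>\<^sub>M M \<Otimes>\<^sub>M M \<Otimes>\<^sub>M M \<Otimes>\<^sub>M M \<Otimes>\<^sub>M M)"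
    and [measurable]: "a \<in> measurable N M" "b \<in> measurable N M" "c \<in> measurable N M"
      "d \<in> measurable N M" "e \<in> measurable N M" "f \<in> measurable N M"
  shows "(\<lambda>p. F (a p) (b p) (c p) (d p) (e p) (f p)) \<in> borel_measurable N"
proof -
  have "(\<lambda>p. (a p, b p, c p, d p, e p, f p)) \<in> measurable N (M \<Otimes>\<^sub>M M \<Otimes>\<^sub>M M \<Otimes>\<^sub>M M \<Otimes>\<^sub>M M \<Otimes>\<^sub>M M)"
    by measurable
  from measurable_compose[OF this F] show ?thesis by simp
qed

lemma pair_nested_add:
  fixes F G :: "'a \<Rightarrow> 'a \<Rightarrow> 'a \<Rightarrow> 'a \<Rightarrow> 'a \<Rightarrow> 'a \<Rightarrow> ennreal"
  assumes M: "sigma_finite_measure M"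
    and F: "(\<lambda>(x1,x2,x3,y1,y2,y3). F x1 x2 x3 y1 y2 y3) \<in> borel_measurable (M \<Otimes>\<^sub>M M \<Otimes>\<^sub>M M \<Otimes>\<^sub>M M \<Otimes>\<^sub>M M \<Otimes>\<^sub>M M)"
    and G: "(\<lambda>(x1,x2,x3,y1,y2,y3). G x1 x2 x3 y1 y2 y3) \<in> borel_measurable (M \<Otimes>\<^sub>M M \<Otimes>\<^sub>M M \<Otimes>\<^sub>M M \<Otimes>\<^sub>M M \<Otimes>\<^sub>M M)"
  shows "pair_nested M (\<lambda>x1 x2 x3 y1 y2 y3. F x1 x2 x3 y1 y2 y3 + G x1 x2 x3 y1 y2 y3) = pair_nested M F + pair_nested M G"
proof -
  interpret sigma_finite_measure M by fact
  note [measurable] = measurable_curry6[OF F] measurable_curry6[OF G]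
  show ?thesis unfolding pair_nested_def
    by (simp add: nn_integral_add cong: nn_integral_cong)
qed

lemma pair_nested_swap:
  fixes F :: "'a \<Rightarrow> 'a \<Rightarrow> 'a \<Rightarrow> 'a \<Rightarrow> 'a \<Rightarrow> 'a \<Rightarrow> ennreal"
  assumes M: "sigma_finite_measure M"
    and F: "(\<lambda>(x1,x2,x3,y1,y2,y3). F x1 x2 x3 y1 y2 y3) \<in> borel_measurable (M \<Otimes>\<^sub>M M \<Otimes>\<^sub>M M \<Otimes>\<^sub>M M \<Otimes>\<^sub>M M \<Otimes>\<^sub>M M)"
  shows "pair_nested M (\<lambda>x1 x2 x3 y1 y2 y3. F y1 x2 x3 x1 y2 y3) = pair_nested M F"
    "pair_nested M (\<lambda>x1 x2 x3 y1 y2 y3. F x1 y2 x3 y1 x2 y3) = pair_nested M F"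
    "pair_nested M (\<lambda>x1 x2 x3 y1 y2 y3. F x1 x2 y3 y1 y2 x3) = pair_nested M F"
proof -
  interpret sigma_finite_measure M by fact
  note [measurable] = measurable_curry6[OF F]
  show "pair_nested M (\<lambda>x1 x2 x3 y1 y2 y3. F y1 x2 x3 x1 y2 y3) = pair_nested M F"
    unfolding pair_nested_def by (rule nn_integral_swap[OF M M]) measurable
  show "pair_nested M (\<lambda>x1 x2 x3 y1 y2 y3. F x1 y2 x3 y1 x2 y3) = pair_nested M F"
    unfolding pair_nested_def by (rule nn_integral_cong, rule nn_integral_cong, rule nn_integral_swap[OF M M]) measurable
  show "pair_nested M (\<lambda>x1 x2 x3 y1 y2 y3. F x1 x2 y3 y1 y2 x3) = pair_nested M F"
    unfolding pair_nested_def by (rule nn_integral_cong, rule nn_integral_cong, rule nn_integral_cong,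
        rule nn_integral_cong, rule nn_integral_swap[OF M M]) measurable
qed

lemma measurable_curry3:
  assumes F: "(\<lambda>(x,y,z). D x y z) \<in> borel_measurable (M \<Otimes>\<^sub>M M \<Otimes>\<^sub>M M)"
    and [measurable]: "a \<in> measurable N M" "b \<in> measurable N M" "c \<in> measurable N M"
  shows "(\<lambda>p. D (a p) (b p) (c p)) \<in> borel_measurable N"
proof -
  have "(\<lambda>p. (a p, b p, c p)) \<in> measurable N (M \<Otimes>\<^sub>M M \<Otimes>\<^sub>M M)"
    by measurable
  from measurable_compose[OF this F] show ?thesis by simp
qed

lemma measurable_curry2:
  assumes F: "(\<lambda>(x,y). P x y) \<in> borel_measurable (M \<Otimes>\<^sub>M M)"
    and [measurable]: "a \<in> measurable N M" "b \<in> measurable N M"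
  shows "(\<lambda>p. P (a p) (b p)) \<in> borel_measurable N"
proof -
  have "(\<lambda>p. (a p, b p)) \<in> measurable N (M \<Otimes>\<^sub>M M)"
    by measurable
  from measurable_compose[OF this F] show ?thesis by simp
qed

text \<open>
  The abstract form of the pointwise inequality.  By symmetry the eight terms have the same integral,
  and in each of them the three variables without \<open>g\<close> separate into three integrals of the
  hypothesis \<open>kernel\<close>.
\<close>

theorem integral_pow6_le_triple_integral:
  fixes M :: "'a measure" and g :: "'a \<Rightarrow> real" and K :: ennreal
  assumes M: "sigma_finite_measure M"
    and g[measurable]: "g \<in> borel_measurable M"
    and mD: "(\<lambda>(x,y,z). D x y z) \<in> borel_measurable (M \<Otimes>\<^sub>M M \<Otimes>\<^sub>M M)"
    and mP: "(\<lambda>(x,y). P x y) \<in> borel_measurable (M \<Otimes>\<^sub>M M)"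
    and D: "\<And>x y z. D x y z = D y x z" "\<And>x y z. D x y z = D x z y" and P: "\<And>x y. P x y = P y x"
    and g0: "\<And>x. 0 \<le> g x" and D0: "\<And>x y z. 0 \<le> D x y z" and P0: "\<And>x y. 0 \<le> P x y"
    and Ppos: "\<And>x. x \<in> space M \<Longrightarrow> AE y in M. 0 < P x y"
    and Dpos: "\<And>x y. x \<in> space M \<Longrightarrow> y \<in> space M \<Longrightarrow> 0 < P x y \<Longrightarrow> AE z in M. 0 < D x y z"
    and kernel: "\<And>x y. x \<in> space M \<Longrightarrow> y \<in> space M \<Longrightarrow> 0 < P x y \<Longrightarrow>
       (\<integral>\<^sup>+u. ennreal (pair_kernel D P u x y) \<partial>M) * ennreal ((P x y)\<^sup>2) \<le> K"
  shows "(\<integral>\<^sup>+x. g x \<partial>M) ^ 6 \<le> K ^ 3 * (\<integral>\<^sup>+x. \<integral>\<^sup>+y. \<integral>\<^sup>+z. ennreal ((g x * g y * g z)\<^sup>2 * D x y z) \<partial>M \<partial>M \<partial>M)"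
proof -
  interpret sigma_finite_measure M by fact
  note [measurable] = measurable_curry3[OF mD] measurable_curry2[OF mP]
  let ?T = "triple_term g D P"
  let ?S = "\<lambda>x1 x2 x3 y1 y2 y3. ?T x1 x2 x3 y1 y2 y3 + ?T y1 x2 x3 x1 y2 y3
     + (?T x1 y2 x3 y1 x2 y3 + ?T y1 y2 x3 x1 x2 y3)
     + (?T x1 x2 y3 y1 y2 x3 + ?T y1 x2 y3 x1 y2 x3
     + (?T x1 y2 y3 y1 x2 x3 + ?T y1 y2 y3 x1 x2 x3))"
  have T0: "0 \<le> ?T x1 x2 x3 y1 y2 y3" for x1 x2 x3 y1 y2 y3
    unfolding triple_term_def pair_kernel_def by (intro mult_nonneg_nonneg divide_nonneg_nonneg) (auto simp: D0 P0)
  define T where "T x1 x2 x3 y1 y2 y3 = ennreal (?T x1 x2 x3 y1 y2 y3)" for x1 x2 x3 y1 y2 y3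
  have mT: "(\<lambda>p. T (a p) (b p) (c p) (d p) (e p) (f p)) \<in> borel_measurable N"
    if [measurable]: "a \<in> measurable N M" "b \<in> measurable N M" "c \<in> measurable N M"
      "d \<in> measurable N M" "e \<in> measurable N M" "f \<in> measurable N M"
    for a b c d e f and N :: "'n measure"
    unfolding T_def triple_term_def pair_kernel_def by measurable
  note [measurable] = mT
  define N where "N = (\<integral>\<^sup>+x. g x \<partial>M)"
  let ?L = "\<lambda>x1 x2 x3 y1 y2 y3. 8 * (ennreal (g x1) * ennreal (g y1) * (ennreal (g x2) * ennreal (g y2)) * (ennreal (g x3) * ennreal (g y3)))"
  let ?R = "\<lambda>x1 x2 x3 y1 y2 y3. T x1 x2 x3 y1 y2 y3 + T y1 x2 x3 x1 y2 y3
     + (T x1 y2 x3 y1 x2 y3 + T y1 y2 x3 x1 x2 y3)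
     + (T x1 x2 y3 y1 y2 x3 + T y1 x2 y3 x1 y2 x3
     + (T x1 y2 y3 y1 x2 x3 + T y1 y2 y3 x1 x2 x3))"
  \<comment> \<open>Each further variable avoids a null set that depends on the variables before it.\<close>
  have inner: "(\<integral>\<^sup>+y3. ?L x1 x2 x3 y1 y2 y3 \<partial>M) \<le> (\<integral>\<^sup>+y3. ?R x1 x2 x3 y1 y2 y3 \<partial>M)"
    if sp: "x1 \<in> space M" "y1 \<in> space M" "x2 \<in> space M" "y2 \<in> space M" "x3 \<in> space M"
    and p: "0 < P x1 x2" "0 < P y1 x2" "0 < P x1 y2" "0 < P y1 y2" 
      "0 < P x1 x3" "0 < P y1 x3" "0 < P x2 x3" "0 < P y2 x3"
      "0 < D x1 x2 x3" "0 < D y1 x2 x3" "0 < D x1 y2 x3" "0 < D y1 y2 x3"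
    for x1 x2 x3 y1 y2
  proof (rule nn_integral_mono_AE)
    show "AE y3 in M. ?L x1 x2 x3 y1 y2 y3 \<le> ?R x1 x2 x3 y1 y2 y3"
      using Ppos[OF sp(1)] Ppos[OF sp(2)] Ppos[OF sp(3)] Ppos[OF sp(4)]
        Dpos[OF sp(1,3) p(1)] Dpos[OF sp(2,3) p(2)] Dpos[OF sp(1,4) p(3)] Dpos[OF sp(2,4) p(4)]
    proof eventually_elim
      fix y3
      assume q: "0 < P x1 y3" "0 < P y1 y3" "0 < P x2 y3" "0 < P y2 y3"
        "0 < D x1 x2 y3" "0 < D y1 x2 y3" "0 < D x1 y2 y3" "0 < D y1 y2 y3"
      have "?L x1 x2 x3 y1 y2 y3 = ennreal (8 * (g x1 * g y1 * (g x2 * g y2) * (g x3 * g y3)))"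
        by (simp add: ennreal_mult g0)
      also have "\<dots> \<le> ennreal (?S x1 x2 x3 y1 y2 y3)"
        by (rule ennreal_leI, rule mean_triple_terms_ge[OF D P g0 D0 P0]) (use p q in auto)
      also have "\<dots> = ?R x1 x2 x3 y1 y2 y3"
        unfolding T_def by (simp add: T0)
      finally show "?L x1 x2 x3 y1 y2 y3 \<le> ?R x1 x2 x3 y1 y2 y3" .
    qed
  qed
  have middle: "(\<integral>\<^sup>+x3. \<integral>\<^sup>+y3. ?L x1 x2 x3 y1 y2 y3 \<partial>M \<partial>M) \<le> (\<integral>\<^sup>+x3. \<integral>\<^sup>+y3. ?R x1 x2 x3 y1 y2 y3 \<partial>M \<partial>M)"
    if sp: "x1 \<in> space M" "y1 \<in> space M" "x2 \<in> space M" "y2 \<in> space M"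
    and p: "0 < P x1 x2" "0 < P y1 x2" "0 < P x1 y2" "0 < P y1 y2" 
    for x1 x2 y1 y2
  proof (rule nn_integral_mono_AE)
    show "AE x3 in M. (\<integral>\<^sup>+y3. ?L x1 x2 x3 y1 y2 y3 \<partial>M) \<le> (\<integral>\<^sup>+y3. ?R x1 x2 x3 y1 y2 y3 \<partial>M)"
      using Ppos[OF sp(1)] Ppos[OF sp(2)] Ppos[OF sp(3)] Ppos[OF sp(4)] AE_space
        Dpos[OF sp(1,3) p(1)] Dpos[OF sp(2,3) p(2)] Dpos[OF sp(1,4) p(3)] Dpos[OF sp(2,4) p(4)]
      by eventually_elim (rule inner; (rule sp p | assumption))
  qed
  have outer: "pair_nested M ?L \<le> pair_nested M ?R"
    unfolding pair_nested_def
  proof (rule nn_integral_mono, rule nn_integral_mono)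
    fix x1 y1 assume sp: "x1 \<in> space M" "y1 \<in> space M"
    show "(\<integral>\<^sup>+x2. \<integral>\<^sup>+y2. \<integral>\<^sup>+x3. \<integral>\<^sup>+y3. ?L x1 x2 x3 y1 y2 y3 \<partial>M \<partial>M \<partial>M \<partial>M) \<le> 
        (\<integral>\<^sup>+x2. \<integral>\<^sup>+y2. \<integral>\<^sup>+x3. \<integral>\<^sup>+y3. ?R x1 x2 x3 y1 y2 y3 \<partial>M \<partial>M \<partial>M \<partial>M)"
    proof (rule nn_integral_mono_AE)
      show "AE x2 in M. (\<integral>\<^sup>+y2. \<integral>\<^sup>+x3. \<integral>\<^sup>+y3. ?L x1 x2 x3 y1 y2 y3 \<partial>M \<partial>M \<partial>M) \<le> 
        (\<integral>\<^sup>+y2. \<integral>\<^sup>+x3. \<integral>\<^sup>+y3. ?R x1 x2 x3 y1 y2 y3 \<partial>M \<partial>M \<partial>M)"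
        using Ppos[OF sp(1)] Ppos[OF sp(2)] AE_space
      proof eventually_elim
        fix x2 assume x2: "0 < P x1 x2" "0 < P y1 x2" "x2 \<in> space M"
        show "(\<integral>\<^sup>+y2. \<integral>\<^sup>+x3. \<integral>\<^sup>+y3. ?L x1 x2 x3 y1 y2 y3 \<partial>M \<partial>M \<partial>M) \<le> 
          (\<integral>\<^sup>+y2. \<integral>\<^sup>+x3. \<integral>\<^sup>+y3. ?R x1 x2 x3 y1 y2 y3 \<partial>M \<partial>M \<partial>M)"
        proof (rule nn_integral_mono_AE)
          show "AE y2 in M. (\<integral>\<^sup>+x3. \<integral>\<^sup>+y3. ?L x1 x2 x3 y1 y2 y3 \<partial>M \<partial>M) \<le> 
            (\<integral>\<^sup>+x3. \<integral>\<^sup>+y3. ?R x1 x2 x3 y1 y2 y3 \<partial>M \<partial>M)"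
            using Ppos[OF sp(1)] Ppos[OF sp(2)] AE_space
            by eventually_elim (rule middle; (rule sp x2 | assumption))
        qed
      qed
    qed
  qed
  have m6: "(\<lambda>(x1,x2,x3,y1,y2,y3). T x1 x2 x3 y1 y2 y3) \<in> borel_measurable (M \<Otimes>\<^sub>M M \<Otimes>\<^sub>M M \<Otimes>\<^sub>M M \<Otimes>\<^sub>M M \<Otimes>\<^sub>M M)"
    "(\<lambda>(x1,x2,x3,y1,y2,y3). T y1 x2 x3 x1 y2 y3) \<in> borel_measurable (M \<Otimes>\<^sub>M M \<Otimes>\<^sub>M M \<Otimes>\<^sub>M M \<Otimes>\<^sub>M M \<Otimes>\<^sub>M M)"
    "(\<lambda>(x1,x2,x3,y1,y2,y3). T x1 y2 x3 y1 x2 y3) \<in> borel_measurable (M \<Otimes>\<^sub>M M \<Otimes>\<^sub>M M \<Otimes>\<^sub>M M \<Otimes>\<^sub>M M \<Otimes>\<^sub>M M)"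
    "(\<lambda>(x1,x2,x3,y1,y2,y3). T x1 x2 y3 y1 y2 x3) \<in> borel_measurable (M \<Otimes>\<^sub>M M \<Otimes>\<^sub>M M \<Otimes>\<^sub>M M \<Otimes>\<^sub>M M \<Otimes>\<^sub>M M)"
    "(\<lambda>(x1,x2,x3,y1,y2,y3). T y1 y2 x3 x1 x2 y3) \<in> borel_measurable (M \<Otimes>\<^sub>M M \<Otimes>\<^sub>M M \<Otimes>\<^sub>M M \<Otimes>\<^sub>M M \<Otimes>\<^sub>M M)"
    "(\<lambda>(x1,x2,x3,y1,y2,y3). T y1 x2 y3 x1 y2 x3) \<in> borel_measurable (M \<Otimes>\<^sub>M M \<Otimes>\<^sub>M M \<Otimes>\<^sub>M M \<Otimes>\<^sub>M M \<Otimes>\<^sub>M M)"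
    "(\<lambda>(x1,x2,x3,y1,y2,y3). T x1 y2 y3 y1 x2 x3) \<in> borel_measurable (M \<Otimes>\<^sub>M M \<Otimes>\<^sub>M M \<Otimes>\<^sub>M M \<Otimes>\<^sub>M M \<Otimes>\<^sub>M M)"
    "(\<lambda>(x1,x2,x3,y1,y2,y3). T y1 y2 y3 x1 x2 x3) \<in> borel_measurable (M \<Otimes>\<^sub>M M \<Otimes>\<^sub>M M \<Otimes>\<^sub>M M \<Otimes>\<^sub>M M \<Otimes>\<^sub>M M)"
    unfolding case_prod_beta' by measurable
  note sw = pair_nested_swap[OF M]
  have s1: "pair_nested M (\<lambda>x1 x2 x3 y1 y2 y3. T y1 x2 x3 x1 y2 y3) = pair_nested M T"
    and s2: "pair_nested M (\<lambda>x1 x2 x3 y1 y2 y3. T x1 y2 x3 y1 x2 y3) = pair_nested M T"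
    and s3: "pair_nested M (\<lambda>x1 x2 x3 y1 y2 y3. T x1 x2 y3 y1 y2 x3) = pair_nested M T"
    using sw[OF m6(1)] by blast+
  have s12: "pair_nested M (\<lambda>x1 x2 x3 y1 y2 y3. T y1 y2 x3 x1 x2 y3) = pair_nested M T"
    using sw(1)[OF m6(3)] s2 by simp
  have s13: "pair_nested M (\<lambda>x1 x2 x3 y1 y2 y3. T y1 x2 y3 x1 y2 x3) = pair_nested M T"
    using sw(1)[OF m6(4)] s3 by simp
  have s23: "pair_nested M (\<lambda>x1 x2 x3 y1 y2 y3. T x1 y2 y3 y1 x2 x3) = pair_nested M T"
    using sw(2)[OF m6(4)] s3 by simp
  have s123: "pair_nested M (\<lambda>x1 x2 x3 y1 y2 y3. T y1 y2 y3 x1 x2 x3) = pair_nested M T"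
    using sw(1)[OF m6(7)] s23 by simp
  have eight: "a + a + (a + a) + (a + a + (a + a)) = 8 * a" for a :: ennreal
    by (simp flip: mult_2 add: mult.assoc[symmetric])
  have sum8: "pair_nested M ?R = 8 * pair_nested M T"
    apply (subst pair_nested_add[OF M], (unfold case_prod_beta', measurable)[2])+
    apply (simp only: s1 s2 s3 s12 s13 s23 s123 eight)
    done
  have kernel': "(\<integral>\<^sup>+u. ennreal (pair_kernel D P u x y * (P x y)\<^sup>2) \<partial>M) \<le> K"
    if "x \<in> space M" "y \<in> space M" for x y
  proof (cases "0 < P x y")
    case True
    have "(\<integral>\<^sup>+u. ennreal (pair_kernel D P u x y * (P x y)\<^sup>2) \<partial>M) = (\<integral>\<^sup>+u. ennreal (pair_kernel D P u x y) \<partial>M) * ennreal ((P x y)\<^sup>2)"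
      using that unfolding pair_kernel_def
      by (subst nn_integral_multc[symmetric]) (measurable, simp only: ennreal_mult''[OF zero_le_power2])
    then show ?thesis using kernel[OF that True] by simp
  next
    case False
    then have "P x y = 0" using P0[of x y] by simp
    then show ?thesis by simp
  qed
  have product: "pair_nested M (\<lambda>x1 x2 x3 y1 y2 y3. 8 * (G x1 * G y1 * (G x2 * G y2) * (G x3 * G y3))) = 8 * (\<integral>\<^sup>+x. G x \<partial>M) ^ 6"
    if [measurable]: "G \<in> borel_measurable M" for G :: "'a \<Rightarrow> ennreal"
  proof -
    have N6: "(\<integral>\<^sup>+x. G x \<partial>M) ^ 6 = n * (n * (n * (n * (n * n))))" if "n = (\<integral>\<^sup>+x. G x \<partial>M)" for n
      by (simp add: numeral_eq_Suc that)
    show ?thesis unfolding pair_nested_def N6[OF refl]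
      by (simp add: nn_integral_cmult nn_integral_multc mult.assoc)
  qed
  have "8 * N ^ 6 = pair_nested M (\<lambda>x1 x2 x3 y1 y2 y3. 8 * (ennreal (g x1) * ennreal (g y1) * (ennreal (g x2) * ennreal (g y2)) * (ennreal (g x3) * ennreal (g y3))))"
    unfolding N_def by (subst product[of "\<lambda>x. ennreal (g x)"]) simp_all
  also have "\<dots> \<le> pair_nested M (\<lambda>x1 x2 x3 y1 y2 y3. T x1 x2 x3 y1 y2 y3 + T y1 x2 x3 x1 y2 y3
     + (T x1 y2 x3 y1 x2 y3 + T y1 y2 x3 x1 x2 y3)
     + (T x1 x2 y3 y1 y2 x3 + T y1 x2 y3 x1 y2 x3
     + (T x1 y2 y3 y1 x2 x3 + T y1 y2 y3 x1 x2 x3)))"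
    by (rule outer)
  also have "\<dots> = 8 * pair_nested M T"
    by (rule sum8)
  finally have "N ^ 6 \<le> pair_nested M T"
    by (subst (asm) ennreal_mult_le_mult_iff) auto
  also have "\<dots> = (\<integral>\<^sup>+x1. \<integral>\<^sup>+y1. \<integral>\<^sup>+x2. \<integral>\<^sup>+x3. \<integral>\<^sup>+y2. \<integral>\<^sup>+y3. T x1 x2 x3 y1 y2 y3 \<partial>M \<partial>M \<partial>M \<partial>M \<partial>M \<partial>M)"
    unfolding pair_nested_def by (rule nn_integral_cong, rule nn_integral_cong, rule nn_integral_cong,
        rule nn_integral_swap[OF M M]) measurable
  also have "\<dots> = (\<integral>\<^sup>+x1. \<integral>\<^sup>+x2. \<integral>\<^sup>+y1. \<integral>\<^sup>+x3. \<integral>\<^sup>+y2. \<integral>\<^sup>+y3. T x1 x2 x3 y1 y2 y3 \<partial>M \<partial>M \<partial>M \<partial>M \<partial>M \<partial>M)"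
    by (rule nn_integral_cong, rule nn_integral_swap[OF M M]) measurable
  also have "\<dots> = (\<integral>\<^sup>+x1. \<integral>\<^sup>+x2. \<integral>\<^sup>+x3. \<integral>\<^sup>+y1. \<integral>\<^sup>+y2. \<integral>\<^sup>+y3. T x1 x2 x3 y1 y2 y3 \<partial>M \<partial>M \<partial>M \<partial>M \<partial>M \<partial>M)"
    by (rule nn_integral_cong, rule nn_integral_cong, rule nn_integral_swap[OF M M]) measurable
  also have "\<dots> \<le> (\<integral>\<^sup>+x1. \<integral>\<^sup>+x2. \<integral>\<^sup>+x3. K ^ 3 * ennreal ((g x1 * g x2 * g x3)\<^sup>2 * D x1 x2 x3) \<partial>M \<partial>M \<partial>M)"
  proof (intro nn_integral_mono)
    fix x1 x2 x3 assume sp: "x1 \<in> space M" "x2 \<in> space M" "x3 \<in> space M"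
    define k where "k x y u = ennreal (pair_kernel D P u x y * (P x y)\<^sup>2)" for x y u
    have mk: "k x y \<in> borel_measurable M" if "x \<in> space M" "y \<in> space M" for x y
      unfolding k_def pair_kernel_def using that by measurable
    note [measurable] = mk[OF sp(2,3)] mk[OF sp(1,3)] mk[OF sp(1,2)]
    have k0: "0 \<le> pair_kernel D P u x y * (P x y)\<^sup>2" for x y u
      unfolding pair_kernel_def by (intro mult_nonneg_nonneg divide_nonneg_nonneg) (auto simp: D0 P0)
    have split: "ennreal (c * (v * w * z)) = ennreal c * (ennreal v * (ennreal w * ennreal z))"
      if "0 \<le> c" "0 \<le> v" "0 \<le> w" "0 \<le> z" for c v w z :: real
      using that by (simp add: ennreal_mult mult_ac)
    have Tk: "T x1 x2 x3 y1 y2 y3 = ennreal ((g x1 * g x2 * g x3)\<^sup>2 * D x1 x2 x3) * (k x2 x3 y1 * (k x1 x3 y2 * k x1 x2 y3))" for y1 y2 y3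
      unfolding T_def triple_term_def k_def
      by (rule split) (simp_all only: k0 D0 mult_nonneg_nonneg zero_le_power2)
    have "(\<integral>\<^sup>+y1. \<integral>\<^sup>+y2. \<integral>\<^sup>+y3. T x1 x2 x3 y1 y2 y3 \<partial>M \<partial>M \<partial>M) = ennreal ((g x1 * g x2 * g x3)\<^sup>2 * D x1 x2 x3) *
        ((\<integral>\<^sup>+u. k x2 x3 u \<partial>M) * ((\<integral>\<^sup>+u. k x1 x3 u \<partial>M) * (\<integral>\<^sup>+u. k x1 x2 u \<partial>M)))"
      unfolding Tk by (simp add: nn_integral_cmult nn_integral_multc)
    also have "\<dots> \<le> ennreal ((g x1 * g x2 * g x3)\<^sup>2 * D x1 x2 x3) * (K * (K * K))"
      using kernel' sp unfolding k_def by (intro mult_mono order_refl) auto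
    finally show "(\<integral>\<^sup>+y1. \<integral>\<^sup>+y2. \<integral>\<^sup>+y3. T x1 x2 x3 y1 y2 y3 \<partial>M \<partial>M \<partial>M) \<le> K ^ 3 * ennreal ((g x1 * g x2 * g x3)\<^sup>2 * D x1 x2 x3)"
      by (simp add: power3_eq_cube mult_ac)
  qed
  also have "\<dots> = K ^ 3 * (\<integral>\<^sup>+x. \<integral>\<^sup>+y. \<integral>\<^sup>+z. ennreal ((g x * g y * g z)\<^sup>2 * D x y z) \<partial>M \<partial>M \<partial>M)"
  proof -
    have "K ^ 3 * (\<integral>\<^sup>+x. \<integral>\<^sup>+y. \<integral>\<^sup>+z. ennreal ((g x * g y * g z)\<^sup>2 * D x y z) \<partial>M \<partial>M \<partial>M)
        = (\<integral>\<^sup>+x. K ^ 3 * (\<integral>\<^sup>+y. \<integral>\<^sup>+z. ennreal ((g x * g y * g z)\<^sup>2 * D x y z) \<partial>M \<partial>M) \<partial>M)"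
      by (rule nn_integral_cmult[symmetric]) measurable
    also have "\<dots> = (\<integral>\<^sup>+x. \<integral>\<^sup>+y. K ^ 3 * (\<integral>\<^sup>+z. ennreal ((g x * g y * g z)\<^sup>2 * D x y z) \<partial>M) \<partial>M \<partial>M)"
      by (rule nn_integral_cong, rule nn_integral_cmult[symmetric]) measurable
    also have "\<dots> = (\<integral>\<^sup>+x. \<integral>\<^sup>+y. \<integral>\<^sup>+z. K ^ 3 * ennreal ((g x * g y * g z)\<^sup>2 * D x y z) \<partial>M \<partial>M \<partial>M)"
      by (rule nn_integral_cong, rule nn_integral_cong, rule nn_integral_cmult[symmetric]) measurable
    finally show ?thesis by (rule sym)
  qed
  finally show ?thesis unfolding N_def .
qed

section \<open>The kernel estimate on a circle\<close>

text \<open>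
  The singularity of the circle kernel, as a function of the distance to a singular point: near the
  point the exponent is \<open>-11/12 > -1\<close>, and beyond the scale \<open>m\<close> it is \<open>-7/6 < -1\<close>.  The value \<open>\<infinity>\<close> at the
  origin makes the profile antitone on the whole line.
\<close>

definition sing_profile :: "real \<Rightarrow> real \<Rightarrow> ennreal" where
  "sing_profile m t = (if t \<le> 0 then \<infinity> else ennreal (t powr (-11/12) * max m t powr (-1/4)))"

lemma sing_profile_antimono: assumes "0 < m" "s \<le> t" shows "sing_profile m t \<le> sing_profile m s"
  using assms unfolding sing_profile_def
  by (auto intro!: ennreal_leI mult_mono powr_mono2')

lemma measurable_sing_profile[measurable]: "sing_profile m \<in> borel_measurable borel"
  unfolding sing_profile_def[abs_def] by measurable

lemma nn_integral_sing_profile: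
  assumes m: "0 < m"
  shows "(\<integral>\<^sup>+t. sing_profile m t * indicator {0<..} t \<partial>lborel) \<le> ennreal (18 * m powr (-1/6))"
proof -
  have A: "(\<integral>\<^sup>+t. ennreal (t powr (-11/12) * m powr (-1/4)) * indicator {0..m} t \<partial>lborel)
      = ennreal (m powr (1/12) / (1/12) * m powr (-1/4))"
    using has_integral_mult_left[OF has_integral_powr_from_0[of "-11/12" m], of "m powr (-1/4)"] m
    by (intro nn_integral_has_integral_lebesgue') auto
  have B: "(\<integral>\<^sup>+t. ennreal (t powr (-7/6)) * indicator {m..} t \<partial>lborel) = ennreal (6 * m powr (-1/6))"
    using has_integral_powr_to_inf[of "-7/6" m] m
    by (intro nn_integral_has_integral_lebesgue') (auto simp: mult.commute)
  have "(\<integral>\<^sup>+t. sing_profile m t * indicator {0<..} t \<partial>lborel) \<le> 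
     (\<integral>\<^sup>+t. ennreal (t powr (-11/12) * m powr (-1/4)) * indicator {0..m} t + ennreal (t powr (-7/6)) * indicator {m..} t \<partial>lborel)"
  proof (rule nn_integral_mono)
    fix t :: real
    consider "t \<le> 0" | "0 < t" "t \<le> m" | "m < t" by linarith
    then show "sing_profile m t * indicator {0<..} t \<le> ennreal (t powr (-11/12) * m powr (-1/4)) * indicator {0..m} t + ennreal (t powr (-7/6)) * indicator {m..} t"
    proof cases
      case 2
      then show ?thesis by (simp add: sing_profile_def max_def indicator_def)
    next
      case 3
      then have "t powr (-11/12) * max m t powr (-1/4) = t powr (-7/6)"
        using m by (simp add: max_def flip: powr_add)
      then show ?thesis using 3 m by (simp add: sing_profile_def indicator_def)
    qed (simp add: sing_profile_def)
  qed
  also have "\<dots> = ennreal (m powr (1/12) / (1/12) * m powr (-1/4)) + ennreal (6 * m powr (-1/6))"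
    by (subst nn_integral_add) (measurable, simp only: A B)
  also have "\<dots> = ennreal (18 * m powr (-1/6))"
  proof -
    have "m powr (1/12) * m powr (-1/4) = m powr (-1/6)" using m by (simp flip: powr_add)
    then show ?thesis using m by (simp flip: ennreal_plus)
  qed
  finally show ?thesis .
qed

lemma abs_sin_half_ge:
  assumes "\<bar>x\<bar> \<le> pi" shows "\<bar>x\<bar> / pi \<le> \<bar>sin (x / 2)\<bar>"
proof -
  have conc: "concave_on {0..pi/2} sin"
    by (rule f''_le0_imp_concave[where f' = cos and f'' = "\<lambda>x. - sin x"])
       (auto intro!: derivative_eq_intros sin_ge_zero)
  have "y / pi \<le> sin (y / 2)" if "0 \<le> y" "y \<le> pi" for y
    using concave_onD[OF conc, of "y / pi" 0 "pi / 2"] that by (simp add: field_simps)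
  from this[of "\<bar>x\<bar>"] show ?thesis using assms
    by (cases "x \<ge> 0") (auto simp: abs_if intro: order_trans[OF _ abs_ge_self] )
qed

lemma nn_integral_sing_profile_abs:
  assumes m: "0 < m"
  shows "(\<integral>\<^sup>+x. sing_profile m (\<bar>x - c\<bar> / pi) \<partial>lborel) \<le> ennreal (36 * pi * m powr (-1/6))"
proof -
  have "(\<integral>\<^sup>+x. sing_profile m (\<bar>x - c\<bar> / pi) \<partial>lborel) = pi * (\<integral>\<^sup>+x. sing_profile m \<bar>x\<bar> \<partial>lborel)"
    by (subst nn_integral_real_affine[of _ pi c]) (auto simp: abs_mult)
  also have "(\<integral>\<^sup>+x. sing_profile m \<bar>x\<bar> \<partial>lborel) = (\<integral>\<^sup>+x. sing_profile m x * indicator {0<..} x + sing_profile m (-x) * indicator {0<..} (-x) \<partial>lborel)"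
    using AE_lborel_singleton[of 0]
    by (intro nn_integral_cong_AE) (auto simp: indicator_def elim!: eventually_mono)
  also have "\<dots> = (\<integral>\<^sup>+x. sing_profile m x * indicator {0<..} x \<partial>lborel) + (\<integral>\<^sup>+x. sing_profile m (-x) * indicator {0<..} (-x) \<partial>lborel)"
    by (rule nn_integral_add) auto
  also have "(\<integral>\<^sup>+x. sing_profile m (-x) * indicator {0<..} (-x) \<partial>lborel) = (\<integral>\<^sup>+x. sing_profile m x * indicator {0<..} x \<partial>lborel)"
    by (subst nn_integral_real_affine[of _ "-1" 0]) auto
  also have "ennreal pi * (\<dots> + \<dots>) \<le> ennreal pi * (ennreal (18 * m powr (-1/6)) + ennreal (18 * m powr (-1/6)))"
    by (intro mult_left_mono add_mono nn_integral_sing_profile m) auto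
  also have "\<dots> = ennreal (36 * pi * m powr (-1/6))"
    by (simp flip: ennreal_plus ennreal_mult)
  finally show ?thesis by simp
qed

text \<open>
  Up to a factor, \<open>|sin (\<phi>/2)|\<close> is the distance of \<open>\<phi>\<close> to the multiples of \<open>2\<pi>\<close>; for \<open>r\<close> reduced to
  \<open>[-\<pi>,\<pi>]\<close> only three of these multiples matter.
\<close>

lemma nn_integral_sing_profile_sin:
  assumes m: "0 < m"
  shows "(\<integral>\<^sup>+\<theta>. sing_profile m \<bar>sin ((\<theta> - r) / 2)\<bar> * indicator {-pi<..<pi} \<theta> \<partial>lborel) \<le> ennreal (108 * pi * m powr (-1/6))"
proof -
  define n where "n = \<lfloor>(r + pi) / (2 * pi)\<rfloor>"
  define q where "q = r - 2 * pi * n"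
  have "of_int n \<le> (r + pi) / (2 * pi)" "(r + pi) / (2 * pi) < of_int n + 1"
    unfolding n_def by linarith+
  then have q: "-pi \<le> q" "q \<le> pi" unfolding q_def by (auto simp: field_simps)
  have S: "\<bar>sin ((\<theta> - r) / 2)\<bar> = \<bar>sin ((\<theta> - q) / 2)\<bar>" for \<theta>
  proof -
    have "(\<theta> - r) / 2 = (\<theta> - q) / 2 - pi * n" by (simp add: q_def field_simps)
    then show ?thesis by (simp only: sin_diff sin_npi_int cos_npi_int) (simp add: abs_mult)
  qed
  let ?h = "\<lambda>c \<theta>. sing_profile m (\<bar>\<theta> - c\<bar> / pi)"
  have le: "sing_profile m \<bar>sin ((\<theta> - q) / 2)\<bar> \<le> ?h q \<theta> + ?h (q + 2 * pi) \<theta> + ?h (q - 2 * pi) \<theta>"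
    if \<theta>: "-pi < \<theta>" "\<theta> < pi" for \<theta>
  proof -
    consider "\<bar>\<theta> - q\<bar> \<le> pi" | "\<bar>\<theta> - (q + 2 * pi)\<bar> \<le> pi" | "\<bar>\<theta> - (q - 2 * pi)\<bar> \<le> pi"
      using \<theta> q by linarith
    then show ?thesis
    proof cases
      case 1
      from sing_profile_antimono[OF m abs_sin_half_ge[OF 1]] show ?thesis by (simp add: add_increasing2)
    next
      case 2
      have "(\<theta> - (q + 2 * pi)) / 2 = (\<theta> - q) / 2 - pi" by (simp add: field_simps)
      then have "\<bar>sin ((\<theta> - (q + 2 * pi)) / 2)\<bar> = \<bar>sin ((\<theta> - q) / 2)\<bar>" by (simp only: sin_diff sin_pi cos_pi mult_minus_right mult_zero_right mult_1_right diff_zero abs_minus_cancel)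
      with sing_profile_antimono[OF m abs_sin_half_ge[OF 2]] show ?thesis by (simp add: add_increasing2 add_increasing)
    next
      case 3
      have "(\<theta> - (q - 2 * pi)) / 2 = (\<theta> - q) / 2 + pi" by (simp add: field_simps)
      then have "\<bar>sin ((\<theta> - (q - 2 * pi)) / 2)\<bar> = \<bar>sin ((\<theta> - q) / 2)\<bar>" by (simp only: sin_add sin_pi cos_pi mult_minus_right mult_zero_right mult_1_right add_0_right abs_minus_cancel)
      with sing_profile_antimono[OF m abs_sin_half_ge[OF 3]] show ?thesis by (simp add: add_increasing)
    qed
  qed
  have "(\<integral>\<^sup>+\<theta>. sing_profile m \<bar>sin ((\<theta> - r) / 2)\<bar> * indicator {-pi<..<pi} \<theta> \<partial>lborel) \<le> 
     (\<integral>\<^sup>+\<theta>. ?h q \<theta> + ?h (q + 2 * pi) \<theta> + ?h (q - 2 * pi) \<theta> \<partial>lborel)"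
    unfolding S by (rule nn_integral_mono) (auto simp: indicator_def intro: le)
  also have "\<dots> = (\<integral>\<^sup>+\<theta>. ?h q \<theta> \<partial>lborel) + (\<integral>\<^sup>+\<theta>. ?h (q + 2 * pi) \<theta> \<partial>lborel) + (\<integral>\<^sup>+\<theta>. ?h (q - 2 * pi) \<theta> \<partial>lborel)"
    by (subst nn_integral_add; simp)+
  also have "\<dots> \<le> ennreal (36 * pi * m powr (-1/6)) + ennreal (36 * pi * m powr (-1/6)) + ennreal (36 * pi * m powr (-1/6))"
    by (intro add_mono nn_integral_sing_profile_abs m)
  also have "\<dots> = ennreal (108 * pi * m powr (-1/6))"
    by (simp flip: ennreal_plus)
  finally show ?thesis .
qed

text \<open>
  The half-angle sine compares distances in the plane with distances of angles, also for points off
  the unit circle.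
\<close>

lemma cmod_cis_diff_ge: "\<bar>sin ((\<theta> - Arg p) / 2)\<bar> \<le> cmod (cis \<theta> - p)"
proof -
  define \<phi> where "\<phi> = \<theta> - Arg p"
  have "cmod (cis \<theta> - p) = cmod (cis (Arg p) * (cis \<phi> - cmod p))"
    by (simp add: \<phi>_def ring_distribs cis_mult mult.commute[of "cis _" "complex_of_real _"] flip: rcis_def)
       (simp add: rcis_cmod_Arg)
  also have "\<dots> = cmod (cis \<phi> - cmod p)" by (simp add: norm_mult)
  finally have eq: "cmod (cis \<theta> - p) = cmod (cis \<phi> - cmod p)" .
  have c: "cos \<phi> = 1 - 2 * (sin (\<phi> / 2))\<^sup>2" "sin \<phi> = 2 * sin (\<phi> / 2) * cos (\<phi> / 2)"
    using cos_double_sin[of "\<phi> / 2"] sin_double[of "\<phi> / 2"] by simp_all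
  have "(sin (\<phi> / 2))\<^sup>2 \<le> (cos \<phi> - cmod p)\<^sup>2 + (sin \<phi>)\<^sup>2"
  proof (cases "cos \<phi> \<ge> 0")
    case True
    then have s: "(sin (\<phi> / 2))\<^sup>2 \<le> 1 / 2" using c by simp
    have "(sin \<phi>)\<^sup>2 = 4 * (sin (\<phi> / 2))\<^sup>2 * (1 - (sin (\<phi> / 2))\<^sup>2)"
      by (simp add: c power_mult_distrib cos_squared_eq)
    also have "\<dots> \<ge> 4 * (sin (\<phi> / 2))\<^sup>2 * (1 / 2)" using s by (intro mult_left_mono) auto
    finally show ?thesis using zero_le_power2[of "sin (\<phi> / 2)"] zero_le_power2[of "cos \<phi> - cmod p"] by linarith
  next
    case False
    have "(cos \<phi>)\<^sup>2 \<le> (cos \<phi> - cmod p)\<^sup>2"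
      using False norm_ge_zero[of p] unfolding abs_le_square_iff[symmetric] by linarith
    then have "1 \<le> (cos \<phi> - cmod p)\<^sup>2 + (sin \<phi>)\<^sup>2" using sin_cos_squared_add3[of \<phi>] sin_cos_squared_add[of \<phi>] by linarith
    moreover have "(sin (\<phi> / 2))\<^sup>2 \<le> 1" by (simp add: abs_square_le_1)
    ultimately show ?thesis by linarith
  qed
  then have "sqrt ((sin (\<phi> / 2))\<^sup>2) \<le> cmod (cis \<phi> - cmod p)"
    by (simp add: cmod_def del: real_sqrt_abs)
  then show ?thesis unfolding eq by (simp add: \<phi>_def)
qed

text \<open>
  For \<open>|d| \<le> 1\<close> the difference \<open>sin \<phi> - d\<close> factors over its two zeros.  Otherwise replacing \<open>d\<close> by the
  nearest of \<open>1\<close> and \<open>-1\<close> only decreases the absolute value and leaves a double zero.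
\<close>

lemma abs_sin_minus_ge:
  fixes d :: real
  obtains \<psi> where "\<And>\<phi>. 2 * \<bar>sin ((\<phi> - \<psi>) / 2)\<bar> * \<bar>sin ((\<phi> - (pi - \<psi>)) / 2)\<bar> \<le> \<bar>sin \<phi> - d\<bar>"
proof
  define \<psi> where "\<psi> = arcsin (max (-1) (min 1 d))"
  have s: "sin \<psi> = max (-1) (min 1 d)" unfolding \<psi>_def by (rule sin_arcsin) auto
  fix \<phi>
  have "cos ((\<phi> + \<psi>) / 2) = sin (pi / 2 - (\<phi> + \<psi>) / 2)" by (simp add: cos_sin_eq)
  also have "\<dots> = - sin ((\<phi> - (pi - \<psi>)) / 2)" 
  proof -
    have "pi / 2 - (\<phi> + \<psi>) / 2 = - ((\<phi> - (pi - \<psi>)) / 2)" by (simp add: field_simps)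
    then show ?thesis by (simp only: sin_minus)
  qed
  finally have "sin \<phi> - sin \<psi> = - (2 * sin ((\<phi> - \<psi>) / 2) * sin ((\<phi> - (pi - \<psi>)) / 2))"
    by (simp add: sin_diff_sin)
  then have "2 * \<bar>sin ((\<phi> - \<psi>) / 2)\<bar> * \<bar>sin ((\<phi> - (pi - \<psi>)) / 2)\<bar> = \<bar>sin \<phi> - sin \<psi>\<bar>"
    by (simp add: abs_mult)
  also have "\<dots> \<le> \<bar>sin \<phi> - d\<bar>"
  proof -
    consider "d < -1" | "-1 \<le> d" "d \<le> 1" | "1 < d" by linarith
    then show ?thesis unfolding s using sin_le_one[of \<phi>] sin_ge_minus_one[of \<phi>] by cases linarith+
  qed
  finally show "2 * \<bar>sin ((\<phi> - \<psi>) / 2)\<bar> * \<bar>sin ((\<phi> - (pi - \<psi>)) / 2)\<bar> \<le> \<bar>sin \<phi> - d\<bar>" .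
qed

text \<open>
  Here \<open>D\<close> is twice a triangle area, \<open>l\<close> the length of its fixed side, \<open>a\<close> and \<open>b\<close> the lengths of the other
  sides, \<open>s1\<close> and \<open>s2\<close> the angular distances to the zeros of \<open>D\<close>, and \<open>s3\<close>, \<open>s4\<close> those to the end points
  of the fixed side.  The longer of the other two sides is at least \<open>l/2\<close>, which replaces one of the
  two quarter powers by a bounded quantity at scale \<open>l\<close>; a product of decreasing functions of two
  distances is at most the sum of the products with both distances equal.
\<close>

lemma sing_pointwise:
  fixes a b s1 s2 s3 s4 l D :: real
  assumes l: "0 < l" and D: "2 * l * s1 * s2 \<le> D" and ab: "l \<le> a + b" and s: "s3 \<le> a" "s4 \<le> b"
    and nn: "0 \<le> s1" "0 \<le> s2" "0 \<le> s3" "0 \<le> s4" "0 \<le> D"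
  defines "h \<equiv> sing_profile (l / 2)"
  shows "ennreal (D powr (-1/3) * a powr (-1/4) * b powr (-1/4)) \<le> ennreal (l powr (-1/3)) * (2 * (h s1 + h s2 + h s3 + h s4))"
proof (cases "s1 = 0 \<or> s2 = 0 \<or> s3 = 0 \<or> s4 = 0")
  case True
  then have "h s1 + h s2 + h s3 + h s4 = top" by (auto simp: h_def sing_profile_def)
  then have "ennreal (l powr (-1/3)) * (2 * (h s1 + h s2 + h s3 + h s4)) = top"
    using l by (simp only:) (simp add: ennreal_mult_top)
  then show ?thesis by simp
next
  case False
  then have p: "0 < s1" "0 < s2" "0 < s3" "0 < s4" using nn by auto
  then have pab: "0 < a" "0 < b" using s by auto
  define f where "f t = t powr (-1/4) * max (l/2) t powr (-1/4)" for t :: real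
  define H where "H t = t powr (-2/3) * f t" for t :: real
  have hH: "h t = ennreal (H t)" if "0 < t" for t
    using that by (simp add: h_def sing_profile_def H_def f_def mult.assoc[symmetric] flip: powr_add)
  have f_anti: "f t \<le> f u" if "0 < u" "u \<le> t" for t u
    unfolding f_def using that l by (intro mult_mono powr_mono2') auto
  have f0: "0 \<le> f t" for t by (simp add: f_def)
  have H0: "0 \<le> H t" for t by (simp add: H_def f0)
  have mix: "u powr (-2/3) * f t \<le> H u + H t" if "0 < u" "0 < t" for u t
  proof (cases "u \<le> t")
    case True
    then have "u powr (-2/3) * f t \<le> H u" unfolding H_def using that by (intro mult_left_mono f_anti) auto
    then show ?thesis using H0[of t] by linarith
  next
    case False
    then have "u powr (-2/3) * f t \<le> H t" unfolding H_def using that f0 by (intro mult_right_mono powr_mono2') auto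
    then show ?thesis using H0[of u] by linarith
  qed
  have dd: "D powr (-1/3) \<le> l powr (-1/3) * (s1 powr (-2/3) + s2 powr (-2/3))"
  proof -
    have "D powr (-1/3) \<le> (l * (s1 * s2)) powr (-1/3)"
      using l p D by (intro powr_mono2') (auto intro: order_trans[OF _ D])
    also have "\<dots> = l powr (-1/3) * (s1 powr (-1/3) * s2 powr (-1/3))"
      using l p by (simp add: powr_mult)
    also have "s1 powr (-1/3) * s2 powr (-1/3) \<le> s1 powr (-2/3) + s2 powr (-2/3)"
    proof -
      have "x * y \<le> x * x + y * y" if "0 \<le> x" "0 \<le> y" for x y :: real
        using that sum_squares_bound[of x y] mult_nonneg_nonneg[OF that] unfolding power2_eq_square by linarith
      from this[of "s1 powr (-1/3)" "s2 powr (-1/3)"] show ?thesis by (simp flip: powr_add)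
    qed
    finally show ?thesis by (simp add: mult_left_mono)
  qed
  have ff: "a powr (-1/4) * b powr (-1/4) \<le> f s3 + f s4"
  proof (cases "b \<le> a")
    case True
    then have "a powr (-1/4) \<le> max (l/2) b powr (-1/4)" using ab pab l by (intro powr_mono2') auto
    then have "a powr (-1/4) * b powr (-1/4) \<le> f b" unfolding f_def by (subst (2) mult.commute) (intro mult_right_mono, auto)
    also have "\<dots> \<le> f s4" using p s by (intro f_anti) auto
    finally show ?thesis using f0[of s3] by linarith
  next
    case False
    then have "b powr (-1/4) \<le> max (l/2) a powr (-1/4)" using ab pab l by (intro powr_mono2') auto
    then have "a powr (-1/4) * b powr (-1/4) \<le> f a" unfolding f_def by (simp add: mult_left_mono)
    also have "\<dots> \<le> f s3" using p s by (intro f_anti) auto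
    finally show ?thesis using f0[of s4] by linarith
  qed
  have "D powr (-1/3) * a powr (-1/4) * b powr (-1/4) \<le> (l powr (-1/3) * (s1 powr (-2/3) + s2 powr (-2/3))) * (f s3 + f s4)"
    by (subst mult.assoc, rule mult_mono[OF dd ff]) simp_all
  also have "\<dots> = l powr (-1/3) * (s1 powr (-2/3) * f s3 + s1 powr (-2/3) * f s4 + s2 powr (-2/3) * f s3 + s2 powr (-2/3) * f s4)"
    by (simp add: algebra_simps)
  also have "\<dots> \<le> l powr (-1/3) * (2 * (H s1 + H s2 + H s3 + H s4))"
    using mix[OF p(1,3)] mix[OF p(1,4)] mix[OF p(2,3)] mix[OF p(2,4)] by (intro mult_left_mono) auto
  finally have "ennreal (D powr (-1/3) * a powr (-1/4) * b powr (-1/4)) \<le> ennreal (l powr (-1/3) * (2 * (H s1 + H s2 + H s3 + H s4)))"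
    by (rule ennreal_leI)
  also have "\<dots> = ennreal (l powr (-1/3)) * (2 * (h s1 + h s2 + h s3 + h s4))"
    using p by (simp add: hH H0 ennreal_mult)
  finally show ?thesis .
qed

text \<open>
  Twice the area of the triangle with vertices \<open>u, p, q\<close>.
\<close>

definition tri_area :: "complex \<Rightarrow> complex \<Rightarrow> complex \<Rightarrow> real" where
  "tri_area u p q = \<bar>Im ((u - p) * cnj (q - p))\<bar>"

lemma measurable_tri_area[measurable]:
  assumes [measurable]: "u \<in> borel_measurable M" "v \<in> borel_measurable M" "w \<in> borel_measurable M"
  shows "(\<lambda>x. tri_area (u x) (v x) (w x)) \<in> borel_measurable M"
proof -
  have [measurable]: "cnj \<in> borel_measurable borel"
    by (intro borel_measurable_continuous_onI continuous_intros)
  show ?thesis unfolding tri_area_def by measurable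
qed

lemma measurable_cis[measurable]: "cis \<in> borel_measurable borel"
  by (intro borel_measurable_continuous_onI continuous_intros)

text \<open>
  The bound is uniform in the position of \<open>p\<close> and \<open>q\<close> relative to the circle.  The exponents \<open>-1/3\<close>
  and \<open>-1/4\<close> fit together: at a double zero of the area that coincides with \<open>p\<close> the total exponent
  is \<open>-2/3 - 1/4 > -1\<close>, while at distances larger than that of \<open>p\<close> and \<open>q\<close> it is
  \<open>-2/3 - 1/2 < -1\<close>.
\<close>

lemma circle_kernel_unit:
  assumes pq: "p \<noteq> q"
  shows "(\<integral>\<^sup>+\<theta>. ennreal (tri_area (cis \<theta>) p q powr (-1/3) * cmod (cis \<theta> - p) powr (-1/4) * cmod (cis \<theta> - q) powr (-1/4)) * indicator {-pi<..<pi} \<theta> \<partial>lborel)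
     \<le> ennreal (1728 * pi * cmod (p - q) powr (-1/2))"
proof -
  define l where "l = cmod (q - p)"
  have l: "0 < l" using pq by (simp add: l_def)
  define \<beta> where "\<beta> = Arg (q - p)"
  have qp: "q - p = l * cis \<beta>"
    unfolding l_def \<beta>_def using rcis_cmod_Arg[of "q - p"] by (simp add: rcis_def)
  define d where "d = Im (p * cnj (q - p)) / l"
  have area: "tri_area (cis \<theta>) p q = l * \<bar>sin (\<theta> - \<beta>) - d\<bar>" for \<theta>
  proof -
    have "Im ((cis \<theta> - p) * cnj (q - p)) = Im (cis \<theta> * cnj (q - p)) - Im (p * cnj (q - p))"
      by (simp add: left_diff_distrib)
    also have "Im (cis \<theta> * cnj (q - p)) = l * sin (\<theta> - \<beta>)"
      unfolding qp by (simp add: sin_diff algebra_simps)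
    also have "Im (p * cnj (q - p)) = l * d" using l by (simp add: d_def)
    finally show ?thesis using l unfolding tri_area_def by (simp add: abs_mult flip: right_diff_distrib)
  qed
  obtain \<psi> where \<psi>: "\<And>\<phi>. 2 * \<bar>sin ((\<phi> - \<psi>) / 2)\<bar> * \<bar>sin ((\<phi> - (pi - \<psi>)) / 2)\<bar> \<le> \<bar>sin \<phi> - d\<bar>"
    using abs_sin_minus_ge[where d = d] by blast
  let ?h = "sing_profile (l / 2)" and ?s = "\<lambda>r \<theta>. \<bar>sin ((\<theta> - r) / 2)\<bar>"
  let ?I = "\<lambda>\<theta>. indicator {-pi<..<pi} \<theta> :: ennreal"
  let ?r1 = "\<beta> + \<psi>" and ?r2 = "\<beta> + (pi - \<psi>)"
  have "(\<integral>\<^sup>+\<theta>. ennreal (tri_area (cis \<theta>) p q powr (-1/3) * cmod (cis \<theta> - p) powr (-1/4) * cmod (cis \<theta> - q) powr (-1/4)) * ?I \<theta> \<partial>lborel)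
     \<le> (\<integral>\<^sup>+\<theta>. ennreal (l powr (-1/3)) * (2 * (?h (?s ?r1 \<theta>) * ?I \<theta> + ?h (?s ?r2 \<theta>) * ?I \<theta> + ?h (?s (Arg p) \<theta>) * ?I \<theta> + ?h (?s (Arg q) \<theta>) * ?I \<theta>)) \<partial>lborel)"
  proof (rule nn_integral_mono)
    fix \<theta>
    have "ennreal (tri_area (cis \<theta>) p q powr (-1/3) * cmod (cis \<theta> - p) powr (-1/4) * cmod (cis \<theta> - q) powr (-1/4))
       \<le> ennreal (l powr (-1/3)) * (2 * (?h (?s ?r1 \<theta>) + ?h (?s ?r2 \<theta>) + ?h (?s (Arg p) \<theta>) + ?h (?s (Arg q) \<theta>)))"
    proof (rule sing_pointwise[OF l])
      show "2 * l * ?s ?r1 \<theta> * ?s ?r2 \<theta> \<le> tri_area (cis \<theta>) p q"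
        unfolding area using mult_left_mono[OF \<psi>[of "\<theta> - \<beta>"], of l] l by (simp add: algebra_simps)
      show "l \<le> cmod (cis \<theta> - p) + cmod (cis \<theta> - q)"
        unfolding l_def using norm_triangle_ineq4[of "cis \<theta> - p" "cis \<theta> - q"] by (simp add: norm_minus_commute)
    qed (auto simp: cmod_cis_diff_ge tri_area_def)
    then show "ennreal (tri_area (cis \<theta>) p q powr (-1/3) * cmod (cis \<theta> - p) powr (-1/4) * cmod (cis \<theta> - q) powr (-1/4)) * ?I \<theta>
       \<le> ennreal (l powr (-1/3)) * (2 * (?h (?s ?r1 \<theta>) * ?I \<theta> + ?h (?s ?r2 \<theta>) * ?I \<theta> + ?h (?s (Arg p) \<theta>) * ?I \<theta> + ?h (?s (Arg q) \<theta>) * ?I \<theta>))"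
      by (simp add: indicator_def)
  qed
  also have "\<dots> = ennreal (l powr (-1/3)) * (2 * ((\<integral>\<^sup>+\<theta>. ?h (?s ?r1 \<theta>) * ?I \<theta> \<partial>lborel) + (\<integral>\<^sup>+\<theta>. ?h (?s ?r2 \<theta>) * ?I \<theta> \<partial>lborel)
      + (\<integral>\<^sup>+\<theta>. ?h (?s (Arg p) \<theta>) * ?I \<theta> \<partial>lborel) + (\<integral>\<^sup>+\<theta>. ?h (?s (Arg q) \<theta>) * ?I \<theta> \<partial>lborel)))"
    by (simp add: nn_integral_cmult nn_integral_add)
  also have "\<dots> \<le> ennreal (l powr (-1/3)) * (2 * (ennreal (108 * pi * (l/2) powr (-1/6)) + ennreal (108 * pi * (l/2) powr (-1/6))
     + ennreal (108 * pi * (l/2) powr (-1/6)) + ennreal (108 * pi * (l/2) powr (-1/6))))"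
    using l by (intro mult_left_mono add_mono nn_integral_sing_profile_sin) auto
  also have "\<dots> = ennreal (l powr (-1/3) * (2 * (4 * (108 * pi * (l/2) powr (-1/6)))))"
  proof -
    have "ennreal x * (2 * (ennreal y + ennreal y + ennreal y + ennreal y)) = ennreal (x * (2 * (4 * y)))"
      if "0 \<le> x" "0 \<le> y" for x y
    proof -
      have "ennreal y + ennreal y + ennreal y + ennreal y = ennreal (4 * y)"
        using that by (simp flip: ennreal_plus)
      then show ?thesis using that by (simp add: ennreal_mult)
    qed
    from this[of "l powr (-1/3)" "108 * pi * (l/2) powr (-1/6)"] show ?thesis by simp
  qed
  also have "\<dots> \<le> ennreal (1728 * pi * cmod (p - q) powr (-1/2))"
  proof (rule ennreal_leI)
    have "(l/2) powr (-1/6) = l powr (-1/6) * 2 powr (1/6)" using l by (simp add: powr_divide powr_minus_divide)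
    also have "\<dots> \<le> l powr (-1/6) * 2" using powr_mono[of "1/6" 1 "2::real"] by (intro mult_left_mono) auto
    finally have "l powr (-1/3) * (2 * (4 * (108 * pi * (l/2) powr (-1/6)))) \<le> l powr (-1/3) * (2 * (4 * (108 * pi * (l powr (-1/6) * 2))))"
      by (intro mult_left_mono) auto
    also have "\<dots> = 1728 * pi * (l powr (-1/3) * l powr (-1/6))" by simp
    also have "l powr (-1/3) * l powr (-1/6) = l powr (-1/2)" by (simp flip: powr_add)
    finally show "l powr (-1/3) * (2 * (4 * (108 * pi * (l/2) powr (-1/6)))) \<le> 1728 * pi * cmod (p - q) powr (-1/2)"
      by (simp add: l_def norm_minus_commute)
  qed
  finally show ?thesis .
qed

lemma circle_kernel:
  assumes pq: "p \<noteq> q" and T: "T \<noteq> 0"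
  shows "(\<integral>\<^sup>+\<theta>. ennreal (tri_area (of_real T * cis \<theta>) p q powr (-1/3) * cmod (of_real T * cis \<theta> - p) powr (-1/4) * cmod (of_real T * cis \<theta> - q) powr (-1/4)) * indicator {-pi<..<pi} \<theta> \<partial>lborel)
     \<le> ennreal (1728 * pi * \<bar>T\<bar> powr (-2/3) * cmod (p - q) powr (-1/2))"
proof -
  define p' where "p' = p / of_real T"
  define q' where "q' = q / of_real T"
  have p: "p = of_real T * p'" and q: "q = of_real T * q'" using T by (simp_all add: p'_def q'_def)
  have ne: "p' \<noteq> q'" using pq p q by auto
  have d: "cmod (of_real T * u - of_real T * v) = \<bar>T\<bar> * cmod (u - v)" for u v
    by (simp add: norm_mult flip: right_diff_distrib)
  have a: "tri_area (of_real T * u) p q = T\<^sup>2 * tri_area u p' q'" for u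
  proof -
    have "(of_real T * u - p) * cnj (q - p) = of_real (T\<^sup>2) * ((u - p') * cnj (q' - p'))"
      unfolding p q by (simp add: algebra_simps power2_eq_square)
    then show ?thesis unfolding tri_area_def by (simp add: abs_mult)
  qed
  have T2: "(T\<^sup>2) powr (-1/3) = \<bar>T\<bar> powr (-2/3)"
  proof -
    have "T\<^sup>2 = \<bar>T\<bar> * \<bar>T\<bar>" by (simp add: power2_eq_square)
    then show ?thesis by (simp only: powr_mult) (simp flip: powr_add)
  qed
  have "(\<integral>\<^sup>+\<theta>. ennreal (tri_area (of_real T * cis \<theta>) p q powr (-1/3) * cmod (of_real T * cis \<theta> - p) powr (-1/4) * cmod (of_real T * cis \<theta> - q) powr (-1/4)) * indicator {-pi<..<pi} \<theta> \<partial>lborel)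
    = (\<integral>\<^sup>+\<theta>. ennreal (\<bar>T\<bar> powr (-7/6)) * (ennreal (tri_area (cis \<theta>) p' q' powr (-1/3) * cmod (cis \<theta> - p') powr (-1/4) * cmod (cis \<theta> - q') powr (-1/4)) * indicator {-pi<..<pi} \<theta>) \<partial>lborel)"
  proof (rule nn_integral_cong)
    fix \<theta>
    have c: "\<bar>T\<bar> powr (-7/6) = \<bar>T\<bar> powr (-2/3) * \<bar>T\<bar> powr (-1/4) * \<bar>T\<bar> powr (-1/4)" by (simp flip: powr_add)
    have m: "ennreal (t2 * y * (t4 * u) * (t4 * v)) * i = ennreal (t2 * t4 * t4) * (ennreal (y * u * v) * i)"
      if "0 \<le> t2" "0 \<le> t4" "0 \<le> y" "0 \<le> u" "0 \<le> v" for t2 t4 y u v :: real and i :: ennreal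
      using that by (simp add: ennreal_mult mult_ac)
    show "ennreal (tri_area (of_real T * cis \<theta>) p q powr (-1/3) * cmod (of_real T * cis \<theta> - p) powr (-1/4) * cmod (of_real T * cis \<theta> - q) powr (-1/4)) * indicator {-pi<..<pi} \<theta>
      = ennreal (\<bar>T\<bar> powr (-7/6)) * (ennreal (tri_area (cis \<theta>) p' q' powr (-1/3) * cmod (cis \<theta> - p') powr (-1/4) * cmod (cis \<theta> - q') powr (-1/4)) * indicator {-pi<..<pi} \<theta>)"
      unfolding a unfolding p q d powr_mult T2 c
      by (rule m) (simp_all only: powr_ge_zero)
  qed
  also have "\<dots> = ennreal (\<bar>T\<bar> powr (-7/6)) * (\<integral>\<^sup>+\<theta>. ennreal (tri_area (cis \<theta>) p' q' powr (-1/3) * cmod (cis \<theta> - p') powr (-1/4) * cmod (cis \<theta> - q') powr (-1/4)) * indicator {-pi<..<pi} \<theta> \<partial>lborel)"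
    by (rule nn_integral_cmult) measurable
  also have "\<dots> \<le> ennreal (\<bar>T\<bar> powr (-7/6)) * ennreal (1728 * pi * cmod (p' - q') powr (-1/2))"
    by (intro mult_left_mono circle_kernel_unit ne) auto
  also have "\<dots> = ennreal (1728 * pi * \<bar>T\<bar> powr (-2/3) * cmod (p - q) powr (-1/2))"
  proof -
    have c: "\<bar>T\<bar> powr (-7/6) = \<bar>T\<bar> powr (-2/3) * \<bar>T\<bar> powr (-1/2)" by (simp flip: powr_add)
    show ?thesis unfolding p q d powr_mult c by (subst ennreal_mult[symmetric]) (auto simp: mult_ac)
  qed
  finally show ?thesis .
qed

section \<open>Linear changes of variables and the sphere measure\<close>

lemma nn_integral_matrix_lborel:
  fixes A :: "real^'n::{finite,wellorder}^'n::_" and h :: "real^'n::_ \<Rightarrow> ennreal"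
  assumes A: "det A \<noteq> 0" and h[measurable]: "h \<in> borel_measurable borel"
  shows "ennreal \<bar>det A\<bar> * (\<integral>\<^sup>+x. h (A *v x) \<partial>lborel) = (\<integral>\<^sup>+x. h x \<partial>lborel)"
proof -
  obtain B where B: "A ** B = mat 1" "B ** A = mat 1"
    using A invertible_det_nz[of A] unfolding invertible_def by auto
  have dAB: "\<bar>det A\<bar> * \<bar>det B\<bar> = 1" using B(1) det_mul[of A B] by (simp flip: abs_mult)
  have BA: "B *v (A *v x) = x" and AB: "A *v (B *v x) = x" for x
    using B by (simp_all add: matrix_vector_mul_assoc)
  have [measurable]: "(\<lambda>x. A *v x) \<in> borel_measurable borel"
    by (intro borel_measurable_continuous_onI matrix_vector_mult_linear_continuous_on)
  have "lborel = scale_measure (ennreal \<bar>det A\<bar>) (distr lborel borel ((*v) A))"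
  proof (rule lborel_eqI)
    fix l u :: "real^'n::_" assume lu: "\<And>b. b \<in> Basis \<Longrightarrow> l \<bullet> b \<le> u \<bullet> b"
    have pre: "(*v) A -` box l u = (*v) B ` box l u"
      by (auto simp: image_iff AB) (metis BA)
    have lm: "(*v) B ` box l u \<in> lmeasurable"
      by (rule measurable_linear_image) auto
    have bor: "(*v) B ` box l u \<in> sets borel"
      unfolding pre[symmetric] using measurable_sets[of "(*v) A" borel borel "box l u"] by simp
    have "emeasure (distr lborel borel ((*v) A)) (box l u) = emeasure lborel ((*v) B ` box l u)"
      by (simp add: emeasure_distr pre)
    also have "\<dots> = emeasure lebesgue ((*v) B ` box l u)" using bor by simp
    also have "\<dots> = ennreal (measure lebesgue ((*v) B ` box l u))"
      by (rule emeasure_eq_measure2[OF lm])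
    also have "measure lebesgue ((*v) B ` box l u) = \<bar>det B\<bar> * measure lebesgue (box l u)"
      by (subst measure_linear_image) auto
    also have "measure lebesgue (box l u) = (\<Prod>b\<in>Basis. (u - l) \<bullet> b)"
      using lu by (simp add: measure_lborel_box_eq)
    finally have e: "emeasure (distr lborel borel ((*v) A)) (box l u) = ennreal (\<bar>det B\<bar> * (\<Prod>b\<in>Basis. (u - l) \<bullet> b))" .
    show "emeasure (scale_measure (ennreal \<bar>det A\<bar>) (distr lborel borel ((*v) A))) (box l u) = (\<Prod>b\<in>Basis. (u - l) \<bullet> b)"
      unfolding emeasure_scale_measure e
      by (subst ennreal_mult'[symmetric]) (simp_all add: dAB mult.assoc[symmetric])
  qed simp
  then have "(\<integral>\<^sup>+x. h x \<partial>lborel) = (\<integral>\<^sup>+x. h x \<partial>scale_measure (ennreal \<bar>det A\<bar>) (distr lborel borel ((*v) A)))"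
    by simp
  also have "\<dots> = ennreal \<bar>det A\<bar> * (\<integral>\<^sup>+x. h (A *v x) \<partial>lborel)"
    by (simp add: nn_integral_scale_measure nn_integral_distr)
  finally show ?thesis by simp
qed

lemma nn_integral_lborel_prod_vec:
  fixes H :: "'n::finite \<Rightarrow> real \<Rightarrow> ennreal"
  assumes [measurable]: "\<And>i. H i \<in> borel_measurable borel"
  shows "(\<integral>\<^sup>+x. (\<Prod>i\<in>UNIV. H i ((x::real^'n) $ i)) \<partial>lborel) = (\<Prod>i\<in>UNIV. \<integral>\<^sup>+s. H i s \<partial>lborel)"
proof -
  define F where "F b = H (SOME i. b = axis i 1)" for b :: "real^'n"
  have F: "F (axis i 1) = H i" for i by (simp add: F_def axis_eq_axis)
  have B: "(Basis :: (real^'n) set) = (\<lambda>i. axis i 1) ` UNIV" by (auto simp: Basis_vec_def)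
  have inj: "inj (\<lambda>i. axis i 1 :: real^'n)" by (auto simp: inj_on_def axis_eq_axis)
  have "(\<integral>\<^sup>+x. (\<Prod>b\<in>Basis. F b ((x::real^'n) \<bullet> b)) \<partial>lborel) = (\<Prod>b\<in>Basis. \<integral>\<^sup>+s. F b s \<partial>lborel)"
    by (rule nn_integral_lborel_prod) (auto simp: B F)
  then show ?thesis
    unfolding B by (simp add: prod.reindex[OF inj] F inner_axis)
qed

lemma prod3: "(\<Prod>i\<in>UNIV. F (i::3)) = F 1 * F 2 * (F 3 :: 'a::comm_monoid_mult)"
  unfolding UNIV_3 by (simp add: mult.assoc)

definition vol3 :: "real^3 \<Rightarrow> real^3 \<Rightarrow> real^3 \<Rightarrow> real" where
  "vol3 x y z = \<bar>det (vector [x, y, z] :: real^3^3)\<bar>"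

text \<open>
  The change of variables by the three inner products.  When the directions are linearly dependent
  the left-hand side vanishes, so only an inequality is claimed.
\<close>

lemma nn_integral_three_planes:
  fixes H1 H2 H3 :: "real \<Rightarrow> ennreal"
  assumes [measurable]: "H1 \<in> borel_measurable borel" "H2 \<in> borel_measurable borel" "H3 \<in> borel_measurable borel"
  shows "ennreal (vol3 u v w) * (\<integral>\<^sup>+x. H1 (x \<bullet> u) * H2 (x \<bullet> v) * H3 (x \<bullet> w) \<partial>lborel)
    \<le> (\<integral>\<^sup>+s. H1 s \<partial>lborel) * (\<integral>\<^sup>+s. H2 s \<partial>lborel) * (\<integral>\<^sup>+s. H3 s \<partial>lborel)"
proof (cases "vol3 u v w = 0")
  case False
  let ?A = "vector [u, v, w] :: real^3^3"
  define H where "H i = (if i = (1::3) then H1 else if i = 2 then H2 else H3)" for i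
  have [measurable]: "H i \<in> borel_measurable borel" for i by (simp add: H_def)
  have Ax: "(?A *v x) $ 1 = x \<bullet> u" "(?A *v x) $ 2 = x \<bullet> v" "(?A *v x) $ 3 = x \<bullet> w" for x
    by (simp_all add: matrix_vector_mult_def inner_vec_def mult.commute)
  have HH: "H 1 = H1" "H 2 = H2" "H 3 = H3" by (simp_all add: H_def)
  have "ennreal \<bar>det ?A\<bar> * (\<integral>\<^sup>+x. (\<Prod>i\<in>UNIV. H i ((?A *v x) $ i)) \<partial>lborel) = (\<integral>\<^sup>+x. (\<Prod>i\<in>UNIV. H i ((x::real^3) $ i)) \<partial>lborel)"
    by (rule nn_integral_matrix_lborel) (use False in \<open>auto simp: vol3_def\<close>)
  also have "\<dots> = (\<Prod>i\<in>UNIV. \<integral>\<^sup>+s. H i s \<partial>lborel)"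
    by (rule nn_integral_lborel_prod_vec) measurable
  finally show ?thesis
    unfolding prod3 Ax HH vol3_def by simp
qed simp

lemma vol3_eq: "vol3 x y z = \<bar>x$1 * (y$2 * z$3 - y$3 * z$2) + x$2 * (y$3 * z$1 - y$1 * z$3) + x$3 * (y$1 * z$2 - y$2 * z$1)\<bar>"
  by (simp add: vol3_def det_3 algebra_simps)

lemma vol3_commute: "vol3 x y z = vol3 y x z" "vol3 x y z = vol3 x z y"
proof -
  show "vol3 x y z = vol3 y x z" unfolding vol3_eq by (subst abs_minus_cancel[symmetric]) (simp add: algebra_simps)
  show "vol3 x y z = vol3 x z y" unfolding vol3_eq by (subst abs_minus_cancel[symmetric]) (simp add: algebra_simps)
qed

lemma vol3_orthogonal:
  assumes "orthogonal_transformation f"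
  shows "vol3 (f x) (f y) (f z) = vol3 x y z"
proof -
  have lin: "linear f" and M: "orthogonal_matrix (matrix f)"
    using assms by (auto simp: orthogonal_transformation_matrix)
  have f: "f v = matrix f *v v" for v using lin by simp
  have "(vector [f x, f y, f z] :: real^3^3) = vector [x, y, z] ** transpose (matrix f)"
    by (auto simp: vec_eq_iff forall_3 f matrix_matrix_mult_def matrix_vector_mult_def transpose_def mult.commute)
  then have "det (vector [f x, f y, f z] :: real^3^3) = det (vector [x, y, z]:: real^3^3) * det (matrix f)"
    by (simp add: det_mul)
  moreover have "\<bar>det (matrix f)\<bar> = 1" using det_orthogonal_matrix[OF M] by auto
  ultimately show ?thesis by (simp add: vol3_def abs_mult)
qed

lemma nn_integral_sphere_measure:
  assumes [measurable]: "f \<in> borel_measurable borel"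
  shows "(\<integral>\<^sup>+w. f w \<partial>sphere_measure) = 3 * (\<integral>\<^sup>+x. f (x /\<^sub>R norm x) * indicator (ball 0 1 - {0}) x \<partial>lborel)"
proof -
  let ?B = "ball 0 1 - {0} :: (real^3) set"
  have m: "(\<lambda>x. x /\<^sub>R norm x) \<in> measurable (restrict_space lborel ?B) (restrict_space borel (sphere 0 1))"
    by (rule measurable_restrict_space2) (auto simp: space_restrict_space intro: measurable_restrict_space1)
  have f: "f \<in> borel_measurable (restrict_space borel (sphere 0 1))" by (rule measurable_restrict_space1) measurable
  show ?thesis
    unfolding sphere_measure_def
    by (simp add: nn_integral_scale_measure nn_integral_distr[OF m] f nn_integral_restrict_space)
qed

lemma nn_integral_sphere_measure_orthogonal:
  assumes Q: "orthogonal_transformation Q" and [measurable]: "f \<in> borel_measurable borel"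
  shows "(\<integral>\<^sup>+w. f (Q w) \<partial>sphere_measure) = (\<integral>\<^sup>+w. f w \<partial>sphere_measure)"
proof -
  have lin: "linear Q" and M: "orthogonal_matrix (matrix Q)"
    using Q by (auto simp: orthogonal_transformation_matrix)
  have Qv: "matrix Q *v v = Q v" for v using lin by simp
  have [measurable]: "Q \<in> borel_measurable borel"
    using lin by (intro borel_measurable_continuous_onI linear_continuous_on linear_conv_bounded_linear[THEN iffD1])
  have d: "\<bar>det (matrix Q)\<bar> = 1" using det_orthogonal_matrix[OF M] by auto
  have n: "norm (Q v) = norm v" for v using Q by (simp add: orthogonal_transformation_norm)
  have Qs: "Q (v /\<^sub>R c) = Q v /\<^sub>R c" for v c using lin by (simp add: linear_cmul)
  have Q0: "Q v = 0 \<longleftrightarrow> v = 0" for v using n[of v] by (metis norm_eq_zero)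
  have ind: "indicator (ball 0 1 - {0}) (Q x) = (indicator (ball 0 1 - {0}) x :: ennreal)" for x
    by (simp add: indicator_def n Q0)
  have "ennreal \<bar>det (matrix Q)\<bar> * (\<integral>\<^sup>+x. (\<lambda>x. f (x /\<^sub>R norm x) * indicator (ball 0 1 - {0}) x) (matrix Q *v x) \<partial>lborel)
     = (\<integral>\<^sup>+x. f (x /\<^sub>R norm x) * indicator (ball 0 1 - {0}) x \<partial>lborel)"
  proof (rule nn_integral_matrix_lborel)
    have [measurable]: "ball 0 1 - {0 :: real^3} \<in> sets borel" by auto
    show "(\<lambda>x. f (x /\<^sub>R norm x) * indicator (ball 0 1 - {0}) x) \<in> borel_measurable borel" by measurable
  qed (use d in auto)
  then show ?thesis
    by (simp add: nn_integral_sphere_measure Qv d n Qs ind)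
qed

lemma nn_integral_lborel_vec3:
  fixes h :: "real \<Rightarrow> real \<Rightarrow> real \<Rightarrow> ennreal"
  assumes h: "(\<lambda>(a,b,c). h a b c) \<in> borel_measurable (borel \<Otimes>\<^sub>M borel \<Otimes>\<^sub>M borel)"
  shows "(\<integral>\<^sup>+v. h (v$1) (v$2) (v$3) \<partial>(lborel :: (real^3) measure)) = (\<integral>\<^sup>+a. \<integral>\<^sup>+b. \<integral>\<^sup>+c. h a b c \<partial>lborel \<partial>lborel \<partial>lborel)"
proof -
  let ?L = "lborel \<Otimes>\<^sub>M (lborel \<Otimes>\<^sub>M lborel) :: (real \<times> real \<times> real) measure"
  let ?V = "\<lambda>(a,b,c). vector [a,b,c] :: real^3"
  have hL[measurable]: "(\<lambda>(a,b,c). h a b c) \<in> borel_measurable ?L"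
  proof -
    have "sets ?L = sets (borel \<Otimes>\<^sub>M borel \<Otimes>\<^sub>M borel)" by (intro sets_pair_measure_cong) simp_all
    then show ?thesis using h by (simp cong: measurable_cong_sets)
  qed
  have mh: "(\<lambda>v::real^3. h (v$1) (v$2) (v$3)) \<in> borel_measurable borel"
  proof -
    have [measurable]: "(\<lambda>v::real^3. v $ i) \<in> borel_measurable borel" for i
      by (intro borel_measurable_continuous_onI continuous_intros)
    have "(\<lambda>v::real^3. (v$1, v$2, v$3)) \<in> measurable borel (borel \<Otimes>\<^sub>M borel \<Otimes>\<^sub>M borel)" by measurable
    from measurable_compose[OF this h] show ?thesis by simp
  qed
  have V[measurable]: "?V \<in> borel_measurable ?L"
  proof -
    have "?V = (\<lambda>p. fst p *\<^sub>R axis 1 1 + fst (snd p) *\<^sub>R axis 2 1 + snd (snd p) *\<^sub>R axis 3 1)"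
      by (auto simp: vec_eq_iff forall_3 axis_def)
    then show ?thesis by simp
  qed
  have "lborel = distr ?L borel ?V"
  proof (rule lborel_eqI)
    fix l u :: "real^3" assume lu: "\<And>b. b \<in> Basis \<Longrightarrow> l \<bullet> b \<le> u \<bullet> b"
    have lu': "l $ i \<le> u $ i" for i using lu[of "axis i 1"] by (auto simp: Basis_vec_def inner_axis)
    have pre: "?V -` box l u \<inter> space ?L = {l$1<..<u$1} \<times> {l$2<..<u$2} \<times> {l$3<..<u$3}"
      by (auto simp: mem_box_cart forall_3 space_pair_measure)
    have B: "(Basis :: (real^3) set) = (\<lambda>i. axis i 1) ` UNIV" by (auto simp: Basis_vec_def)
    have inj: "inj (\<lambda>i. axis i 1 :: real^3)" by (auto simp: inj_on_def axis_eq_axis)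
    have pr: "(\<Prod>b\<in>Basis. (u - l) \<bullet> b) = (u$1 - l$1) * ((u$2 - l$2) * (u$3 - l$3))"
      unfolding B prod.reindex[OF inj] comp_def prod3 inner_axis by (simp add: mult.assoc)
    have "emeasure (distr ?L borel ?V) (box l u) = emeasure ?L ({l$1<..<u$1} \<times> {l$2<..<u$2} \<times> {l$3<..<u$3})"
      by (simp add: emeasure_distr pre)
    also have "\<dots> = ennreal (u$1 - l$1) * (ennreal (u$2 - l$2) * ennreal (u$3 - l$3))"
    proof -
      have sf: "sigma_finite_measure (lborel \<Otimes>\<^sub>M lborel :: (real \<times> real) measure)"
        by (simp add: lborel_prod sigma_finite_lborel)
      have "emeasure ?L ({l$1<..<u$1} \<times> ({l$2<..<u$2} \<times> {l$3<..<u$3}))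
          = emeasure lborel {l$1<..<u$1} * emeasure (lborel \<Otimes>\<^sub>M lborel) ({l$2<..<u$2} \<times> {l$3<..<u$3})"
        by (rule sigma_finite_measure.emeasure_pair_measure_Times[OF sf]) auto
      also have "emeasure (lborel \<Otimes>\<^sub>M lborel) ({l$2<..<u$2} \<times> {l$3<..<u$3}) = emeasure lborel {l$2<..<u$2} * emeasure lborel {l$3<..<u$3}"
        by (rule lborel.emeasure_pair_measure_Times) auto
      finally show ?thesis by (simp only: emeasure_lborel_Ioo[OF lu'])
    qed
    finally show "emeasure (distr ?L borel ?V) (box l u) = (\<Prod>b\<in>Basis. (u - l) \<bullet> b)"
      using lu' by (simp add: pr ennreal_mult)
  qed simp
  then have "(\<integral>\<^sup>+v. h (v$1) (v$2) (v$3) \<partial>(lborel :: (real^3) measure)) = (\<integral>\<^sup>+v. h (v$1) (v$2) (v$3) \<partial>distr ?L borel ?V)"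
    by simp
  also have "\<dots> = (\<integral>\<^sup>+p. (\<lambda>(a,b,c). h a b c) p \<partial>?L)"
    by (subst nn_integral_distr) (auto simp: mh intro!: nn_integral_cong)
  also have "\<dots> = (\<integral>\<^sup>+a. \<integral>\<^sup>+p. (\<lambda>(b,c). h a b c) p \<partial>(lborel \<Otimes>\<^sub>M lborel) \<partial>lborel)"
    by (subst sigma_finite_measure.nn_integral_fst[symmetric, OF _ hL]) (auto simp: lborel_prod sigma_finite_lborel)
  also have "\<dots> = (\<integral>\<^sup>+a. \<integral>\<^sup>+b. \<integral>\<^sup>+c. h a b c \<partial>lborel \<partial>lborel \<partial>lborel)"
  proof (rule nn_integral_cong)
    fix a :: real
    have "(\<lambda>p. (\<lambda>(a,b,c). h a b c) (a, p)) \<in> borel_measurable (lborel \<Otimes>\<^sub>M lborel)"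
      using hL by (rule measurable_compose[rotated]) measurable
    then have "(\<lambda>(b,c). h a b c) \<in> borel_measurable (lborel \<Otimes>\<^sub>M lborel)" by (simp add: case_prod_beta')
    from lborel.nn_integral_fst[OF this]
    show "(\<integral>\<^sup>+p. (\<lambda>(b,c). h a b c) p \<partial>(lborel \<Otimes>\<^sub>M lborel)) = (\<integral>\<^sup>+b. \<integral>\<^sup>+c. h a b c \<partial>lborel \<partial>lborel)" by simp
  qed
  finally show ?thesis .
qed

section \<open>Spherical coordinates\<close>

text \<open>
  Spherical coordinates: radius, height on the unit sphere, and longitude.  With the height in place
  of the latitude the Jacobian is the square of the radius.
\<close>

definition sph :: "real^3 \<Rightarrow> real^3" where
  "sph v = vector [v$1 * (sqrt (1 - (v$2)\<^sup>2) * cos (v$3)), v$1 * (sqrt (1 - (v$2)\<^sup>2) * sin (v$3)), v$1 * v$2]"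

definition dsph :: "real^3 \<Rightarrow> real^3 \<Rightarrow> real^3" where
  "dsph v h = vector [
     h$1 * (sqrt (1 - (v$2)\<^sup>2) * cos (v$3)) + v$1 * (- (v$2 * h$2 / sqrt (1 - (v$2)\<^sup>2)) * cos (v$3) - sqrt (1 - (v$2)\<^sup>2) * sin (v$3) * h$3),
     h$1 * (sqrt (1 - (v$2)\<^sup>2) * sin (v$3)) + v$1 * (- (v$2 * h$2 / sqrt (1 - (v$2)\<^sup>2)) * sin (v$3) + sqrt (1 - (v$2)\<^sup>2) * cos (v$3) * h$3),
     h$1 * v$2 + v$1 * h$2]"

text \<open>
  Longitude \<open>0\<close> is left out along with \<open>\<pi>\<close>, so that the image is the unit ball without the plane
  \<open>x\<^sub>2 = 0\<close>.
\<close>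

definition sph_dom :: "(real^3) set" where
  "sph_dom = {v. 0 < v$1 \<and> v$1 < 1 \<and> -1 < v$2 \<and> v$2 < 1 \<and> -pi < v$3 \<and> v$3 < pi \<and> v$3 \<noteq> 0}"

lemma vector3_axis: "(vector [a, b, c] :: real^3) = a *\<^sub>R axis 1 1 + b *\<^sub>R axis 2 1 + c *\<^sub>R axis 3 1"
  by (auto simp: vec_eq_iff forall_3 axis_def)

lemma one_minus_square_pos: "-1 < s \<Longrightarrow> s < 1 \<Longrightarrow> 0 < 1 - s\<^sup>2" for s :: real
  by (simp add: abs_square_less_1)

lemma sph_has_derivative:
  assumes "-1 < v$2" "v$2 < 1"
  shows "(sph has_derivative dsph v) (at v within S)"
proof -
  have p: "0 < 1 - (v$2)\<^sup>2" using assms by (rule one_minus_square_pos)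
  have nth: "((\<lambda>v. v $ i) has_derivative (\<lambda>h. h $ i)) (at v within S)" for i :: 3
    by (rule bounded_linear_imp_has_derivative) (rule bounded_linear_vec_nth)
  let ?c = "\<lambda>v::real^3. sqrt (1 - (v$2)\<^sup>2)"
  have q: "((\<lambda>v. 1 - (v$2)\<^sup>2) has_derivative (\<lambda>h. - (2 * v$2 * h$2))) (at v within S)"
    by (rule derivative_eq_intros nth refl)+ (simp add: fun_eq_iff)
  have sq: "(?c has_derivative (\<lambda>h. - (v$2 * h$2 / ?c v))) (at v within S)"
  proof -
    have e: "- (2 * a * b) * (inverse c / 2) = - (a * b / c)" for a b c :: real
      by (cases "c = 0") (simp_all add: field_simps)
    show ?thesis
      using has_derivative_real_sqrt[where g = "\<lambda>v. 1 - (v$2)\<^sup>2" and x = v, OF p q] unfolding e .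
  qed
  have co: "((\<lambda>v. cos (v$3)) has_derivative (\<lambda>h. - sin (v$3) * h$3)) (at v within S)"
    by (rule has_derivative_eq_rhs[OF has_derivative_cos[OF nth]]) (simp add: fun_eq_iff)
  have si: "((\<lambda>v. sin (v$3)) has_derivative (\<lambda>h. cos (v$3) * h$3)) (at v within S)"
    by (rule has_derivative_eq_rhs[OF has_derivative_sin[OF nth]]) (simp add: fun_eq_iff)
  have 1: "((\<lambda>v. v$1 * (?c v * cos (v$3))) has_derivative (\<lambda>h. dsph v h $ 1)) (at v within S)"
    by (rule has_derivative_eq_rhs[OF has_derivative_mult[OF nth has_derivative_mult[OF sq co]]])
       (simp add: fun_eq_iff dsph_def algebra_simps)
  have 2: "((\<lambda>v. v$1 * (?c v * sin (v$3))) has_derivative (\<lambda>h. dsph v h $ 2)) (at v within S)"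
    by (rule has_derivative_eq_rhs[OF has_derivative_mult[OF nth has_derivative_mult[OF sq si]]])
       (simp add: fun_eq_iff dsph_def algebra_simps)
  have 3: "((\<lambda>v. v$1 * v$2) has_derivative (\<lambda>h. dsph v h $ 3)) (at v within S)"
    by (rule has_derivative_eq_rhs[OF has_derivative_mult[OF nth nth]])
       (simp add: fun_eq_iff dsph_def algebra_simps)
  have d: "dsph v h = dsph v h $ 1 *\<^sub>R axis 1 1 + dsph v h $ 2 *\<^sub>R axis 2 1 + dsph v h $ 3 *\<^sub>R axis 3 1" for h
    by (auto simp: vec_eq_iff forall_3 axis_def)
  show ?thesis
    unfolding sph_def[abs_def] vector3_axis
    by (rule has_derivative_eq_rhs[OF has_derivative_add[OF has_derivative_add[OF
          has_derivative_scaleR_left[OF 1] has_derivative_scaleR_left[OF 2]] has_derivative_scaleR_left[OF 3]]])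
      (simp add: fun_eq_iff d[symmetric])
qed

lemma det_dsph:
  assumes "-1 < v$2" "v$2 < 1"
  shows "\<bar>det (matrix (dsph v))\<bar> = (v$1)\<^sup>2"
proof -
  define c where "c = sqrt (1 - (v$2)\<^sup>2)"
  have c: "c \<noteq> 0" "c\<^sup>2 = 1 - (v$2)\<^sup>2" using one_minus_square_pos[OF assms] by (auto simp: c_def)
  define S where "S = sin (v$3)"
  define C where "C = cos (v$3)"
  have SC: "S * S + C * C = 1" using sin_cos_squared_add[of "v$3"] by (simp add: S_def C_def power2_eq_square)
  have "det (matrix (dsph v)) = - (v$1 * v$1) * ((S * S + C * C) * (c * c + v$2 * v$2))"
    unfolding det_3 matrix_def dsph_def c_def[symmetric] S_def[symmetric] C_def[symmetric] using c(1)
    by (simp add: axis_def) (simp add: field_simps)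
  then show ?thesis using c by (simp add: SC power2_eq_square)
qed

lemma norm_sph:
  assumes "-1 \<le> v$2" "v$2 \<le> 1"
  shows "norm (sph v) = \<bar>v$1\<bar>"
proof -
  have p: "(v$2)\<^sup>2 \<le> 1" using assms by (simp add: abs_square_le_1)
  define S where "S = sin (v$3)"
  define C where "C = cos (v$3)"
  have SC: "S\<^sup>2 + C\<^sup>2 = 1" using sin_cos_squared_add[of "v$3"] by (simp add: S_def C_def)
  have "(norm (sph v))\<^sup>2 = (v$1)\<^sup>2 * ((1 - (v$2)\<^sup>2) * (S\<^sup>2 + C\<^sup>2) + (v$2)\<^sup>2)"
    unfolding power2_norm_eq_inner inner_vec_def sum_3 sph_def S_def[symmetric] C_def[symmetric] using p
    by (simp add: power2_eq_square[symmetric] power_mult_distrib) (simp add: algebra_simps)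
  then have "(norm (sph v))\<^sup>2 = (v$1)\<^sup>2" unfolding SC by simp
  then have "(norm (sph v))\<^sup>2 = \<bar>v$1\<bar>\<^sup>2" by simp
  then show ?thesis by (subst (asm) power2_eq_iff_nonneg) auto
qed

lemma inj_on_sph: "inj_on sph sph_dom"
proof (rule inj_onI)
  fix v w assume v: "v \<in> sph_dom" and w: "w \<in> sph_dom" and eq: "sph v = sph w"
  have 1: "v$1 = w$1" using norm_sph[of v] norm_sph[of w] eq v w by (auto simp: sph_dom_def)
  have "sph v $ 3 = sph w $ 3" using eq by simp
  then have 2: "v$2 = w$2" using 1 v by (simp add: sph_def sph_dom_def)
  define c where "c = v$1 * sqrt (1 - (v$2)\<^sup>2)"
  have c: "c \<noteq> 0" using v one_minus_square_pos[of "v$2"] by (auto simp: c_def sph_dom_def)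
  have "sph v $ 1 = sph w $ 1" "sph v $ 2 = sph w $ 2" using eq by simp_all
  then have "c * cos (v$3) = c * cos (w$3)" "c * sin (v$3) = c * sin (w$3)"
    using 1 2 by (simp_all add: sph_def c_def)
  then have "cis (v$3) = cis (w$3)" using c by (simp add: complex_eq_iff)
  moreover have "Arg (cis (v$3)) = v$3" "Arg (cis (w$3)) = w$3"
    using v w by (auto simp: sph_dom_def intro!: cis_Arg_unique)
  ultimately have 3: "v$3 = w$3" by metis
  show "v = w" using 1 2 3 by (simp add: vec_eq_iff forall_3)
qed

lemma image_sph: "sph ` sph_dom = {x \<in> ball 0 1. x $ 2 \<noteq> 0}"
proof (intro equalityI subsetI)
  fix x assume "x \<in> sph ` sph_dom"
  then obtain v where v: "v \<in> sph_dom" and x: "x = sph v" by auto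
  have "sin (v$3) \<noteq> 0"
  proof (cases "0 < v$3")
    case True then show ?thesis using v sin_gt_zero[of "v$3"] by (auto simp: sph_dom_def)
  next
    case False then show ?thesis using v sin_gt_zero[of "- (v$3)"] by (auto simp: sph_dom_def)
  qed
  moreover have "0 < 1 - (v$2)\<^sup>2" using v one_minus_square_pos by (auto simp: sph_dom_def)
  ultimately have "x $ 2 \<noteq> 0" using v by (auto simp: x sph_def sph_dom_def)
  moreover have "norm x < 1" using norm_sph[of v] v by (auto simp: x sph_dom_def)
  ultimately show "x \<in> {x \<in> ball 0 1. x $ 2 \<noteq> 0}" by simp
next
  fix x :: "real^3" assume "x \<in> {x \<in> ball 0 1. x $ 2 \<noteq> 0}"
  then have x: "norm x < 1" "x $ 2 \<noteq> 0" by auto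
  have n2: "(norm x)\<^sup>2 = (x$1)\<^sup>2 + (x$2)\<^sup>2 + (x$3)\<^sup>2"
    unfolding power2_norm_eq_inner inner_vec_def sum_3 by (simp add: power2_eq_square)
  define r where "r = norm x"
  have r: "0 < r" using x by (auto simp: r_def)
  define s where "s = x $ 3 / r"
  have lt: "(x$3)\<^sup>2 < r\<^sup>2" using n2 x(2) by (simp add: r_def add_nonneg_pos)
  then have "\<bar>x$3\<bar>\<^sup>2 < r\<^sup>2" by simp
  then have "\<bar>x$3\<bar> < r" using r by (intro power2_less_imp_less[of _ r]) auto
  then have s: "\<bar>s\<bar> < 1" using r by (simp add: s_def abs_divide)
  define z where "z = Complex (x$1) (x$2)"
  have zc: "cmod z = r * sqrt (1 - s\<^sup>2)"
  proof -
    have "(cmod z)\<^sup>2 = r\<^sup>2 - (x$3)\<^sup>2" using n2 by (simp add: z_def cmod_power2 r_def)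
    also have "\<dots> = r\<^sup>2 * (1 - s\<^sup>2)" using r by (simp add: s_def field_simps power_divide)
    finally have "sqrt ((cmod z)\<^sup>2) = sqrt (r\<^sup>2 * (1 - s\<^sup>2))" by simp
    then show ?thesis using r by (simp add: real_sqrt_mult)
  qed
  have zA: "z = cmod z * cis (Arg z)" using rcis_cmod_Arg[of z] by (simp add: rcis_def)
  have "x$1 = cmod z * cos (Arg z)" "x$2 = cmod z * sin (Arg z)"
    using arg_cong[OF zA, of Re] arg_cong[OF zA, of Im] by (simp_all add: z_def)
  define v where "v = (vector [r, s, Arg z] :: real^3)"
  have "sph v = x"
    using \<open>x$1 = _\<close> \<open>x$2 = _\<close> r by (simp add: sph_def v_def vec_eq_iff forall_3 zc s_def mult.assoc)
  moreover have "v \<in> sph_dom"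
  proof -
    have "sin (Arg z) \<noteq> 0" using \<open>x$2 = _\<close> x by auto
    then have "Arg z \<noteq> 0" "Arg z \<noteq> pi" by auto
    moreover have "-pi < Arg z" "Arg z \<le> pi" using Arg_bounded[of z] by auto
    ultimately show ?thesis using r x s by (auto simp: v_def sph_dom_def r_def)
  qed
  ultimately show "x \<in> sph ` sph_dom" by blast
qed

lemma measurable_vec_nth[measurable]: "(\<lambda>v::real^'n::finite. v $ i) \<in> borel_measurable borel"
  by (intro borel_measurable_continuous_onI continuous_intros)

lemma measurable_sph[measurable]: "sph \<in> borel_measurable borel"
  unfolding sph_def[abs_def] vector3_axis by measurable

lemma sets_sph_dom[measurable]: "sph_dom \<in> sets borel"
  unfolding sph_dom_def by measurable

lemma nn_integral_sph:
  assumes F[measurable]: "F \<in> borel_measurable borel"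
  shows "(\<integral>\<^sup>+x. F x * indicator {x \<in> ball 0 1. x $ 2 \<noteq> 0} x \<partial>lborel)
     = (\<integral>\<^sup>+v. ennreal ((v$1)\<^sup>2) * indicator sph_dom v * F (sph v) \<partial>lborel)"
proof -
  let ?B = "{x::real^3 \<in> ball 0 1. x $ 2 \<noteq> 0}"
  have B[measurable]: "?B \<in> sets borel" by measurable
  let ?N2 = "density lborel (indicator ?B :: _ \<Rightarrow> ennreal)"
  let ?N1 = "distr (density lborel (\<lambda>v. ennreal ((v$1)\<^sup>2) * indicator sph_dom v)) borel sph"
  have "?N2 = ?N1"
  proof (rule measure_eqI)
    fix A assume "A \<in> sets ?N2"
    then have A[measurable]: "A \<in> sets borel" by simp
    define S where "S = sph_dom \<inter> sph -` A"
    have S[measurable]: "S \<in> sets borel"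
      unfolding S_def using measurable_sets[OF measurable_sph A] by auto
    have im: "sph ` S = ?B \<inter> A" unfolding S_def image_sph[symmetric] by auto
    have lm: "sph ` S \<in> lmeasurable"
      unfolding im by (rule bounded_set_imp_lmeasurable) (auto intro: bounded_subset[OF bounded_ball[of 0 1]])
    define m where "m = measure lebesgue (sph ` S)"
    have "((\<lambda>x. \<bar>det (matrix (dsph x))\<bar>) has_integral m) S"
    proof (rule has_measure_differentiable_image[THEN iffD1])
      show "S \<in> sets lebesgue" using S by simp
      show "(sph has_derivative dsph x) (at x within S)" if "x \<in> S" for x
        using that by (intro sph_has_derivative) (auto simp: S_def sph_dom_def)
      show "inj_on sph S" using inj_on_sph by (rule inj_on_subset) (auto simp: S_def)
    qed (use lm m_def in auto)
    then have "(\<integral>\<^sup>+v. ennreal \<bar>det (matrix (dsph v))\<bar> * indicator S v \<partial>lborel) = ennreal m"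
      by (intro nn_integral_has_integral_lebesgue') auto
    also have "(\<integral>\<^sup>+v. ennreal \<bar>det (matrix (dsph v))\<bar> * indicator S v \<partial>lborel) = (\<integral>\<^sup>+v. ennreal ((v$1)\<^sup>2) * indicator sph_dom v * indicator (sph -` A) v \<partial>lborel)"
      by (intro nn_integral_cong) (auto simp: S_def indicator_def sph_dom_def det_dsph)
    also have "\<dots> = emeasure ?N1 A"
    proof -
      have [measurable]: "sph -` A \<in> sets borel" using measurable_sets[OF measurable_sph A] by simp
      show ?thesis by (subst emeasure_distr) (auto simp: emeasure_density)
    qed
    finally have 1: "emeasure ?N1 A = ennreal m" .
    have "emeasure ?N2 A = emeasure lborel (?B \<inter> A)"
      by (simp add: emeasure_density flip: indicator_inter_arith)
    also have "\<dots> = emeasure lebesgue (sph ` S)" unfolding im by simp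
    also have "\<dots> = ennreal m" unfolding m_def by (rule emeasure_eq_measure2[OF lm])
    finally show "emeasure ?N2 A = emeasure ?N1 A" using 1 by simp
  qed simp
  then have "(\<integral>\<^sup>+x. F x \<partial>?N2) = (\<integral>\<^sup>+x. F x \<partial>?N1)" by simp
  then show ?thesis by (simp add: nn_integral_density nn_integral_distr mult_ac)
qed

definition sph_pt :: "real \<Rightarrow> real \<Rightarrow> real^3" where
  "sph_pt s \<theta> = vector [sqrt (1 - s\<^sup>2) * cos \<theta>, sqrt (1 - s\<^sup>2) * sin \<theta>, s]"

lemma measurable_sph_pt[measurable]:
  assumes [measurable]: "f \<in> borel_measurable M" "g \<in> borel_measurable M"
  shows "(\<lambda>x. sph_pt (f x) (g x)) \<in> borel_measurable M"
  unfolding sph_pt_def vector3_axis by measurable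

lemma AE_sphere_coord_nonzero: "AE x in lborel. (x::real^3) $ 2 \<noteq> 0"
proof -
  have "negligible {x::real^3. axis 2 1 \<bullet> x = 0}"
    by (rule negligible_hyperplane) (simp add: axis_eq_0_iff)
  then have "{x::real^3. x $ 2 = 0} \<in> null_sets lebesgue"
    by (simp add: negligible_iff_null_sets inner_axis')
  moreover have "{x::real^3. x $ 2 = 0} \<in> sets borel" by measurable
  ultimately have "{x::real^3. x $ 2 = 0} \<in> null_sets lborel" by (simp add: null_sets_def)
  then show ?thesis by (rule AE_I') auto
qed

text \<open>
  Archimedes: height and longitude together carry Lebesgue measure.  The factor \<open>3\<close> of the sphere
  measure cancels the integral of the squared radius.
\<close>

theorem nn_integral_sphere_coords:
  assumes f[measurable]: "f \<in> borel_measurable borel"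
  shows "(\<integral>\<^sup>+w. f w \<partial>sphere_measure) = (\<integral>\<^sup>+s. indicator {-1<..<1} s * (\<integral>\<^sup>+\<theta>. f (sph_pt s \<theta>) * indicator {-pi<..<pi} \<theta> \<partial>lborel) \<partial>lborel)"
proof -
  have cube: "(\<integral>\<^sup>+a. ennreal (a\<^sup>2) * indicator {0<..<1} a \<partial>lborel) = ennreal (1/3)"
  proof -
    have "((\<lambda>a::real. a\<^sup>2) has_integral (1 ^ 3 / 3 - 0 ^ 3 / 3)) {0..1}"
      by (rule fundamental_theorem_of_calculus)
        (auto intro!: derivative_eq_intros simp flip: has_real_derivative_iff_has_vector_derivative)
    then have "(\<integral>\<^sup>+a. ennreal (a\<^sup>2) * indicator {0..1} a \<partial>lborel) = ennreal (1/3)"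
      using nn_integral_has_integral_lebesgue'[of "{0..1}" "\<lambda>a. a\<^sup>2" "1/3"] by simp
    moreover have "(\<integral>\<^sup>+a. ennreal (a\<^sup>2) * indicator {0<..<1} a \<partial>lborel) = (\<integral>\<^sup>+a. ennreal (a\<^sup>2) * indicator {0..1} a \<partial>lborel)"
      using AE_lborel_singleton[of "0::real"] AE_lborel_singleton[of "1::real"]
      by (intro nn_integral_cong_AE) (auto simp: indicator_def)
    ultimately show ?thesis by simp
  qed
  have "(\<integral>\<^sup>+w. f w \<partial>sphere_measure) = 3 * (\<integral>\<^sup>+x. f (x /\<^sub>R norm x) * indicator (ball 0 1 - {0}) x \<partial>lborel)"
    by (rule nn_integral_sphere_measure) measurable
  also have "(\<integral>\<^sup>+x. f (x /\<^sub>R norm x) * indicator (ball 0 1 - {0}) x \<partial>lborel) = (\<integral>\<^sup>+x. f (x /\<^sub>R norm x) * indicator {x \<in> ball 0 1. x $ 2 \<noteq> 0} x \<partial>lborel)"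
    using AE_sphere_coord_nonzero by (intro nn_integral_cong_AE) (auto simp: indicator_def elim!: eventually_mono)
  also have "\<dots> = (\<integral>\<^sup>+v. ennreal ((v$1)\<^sup>2) * indicator sph_dom v * f (sph v /\<^sub>R norm (sph v)) \<partial>lborel)"
    by (rule nn_integral_sph) measurable
  also have "\<dots> = (\<integral>\<^sup>+v. (ennreal ((v$1)\<^sup>2) * indicator {0<..<1} (v$1)) * (indicator {-1<..<1} (v$2) * (f (sph_pt (v$2) (v$3)) * (indicator {-pi<..<pi} (v$3) * indicator (-{0}) (v$3)))) \<partial>(lborel :: (real^3) measure))"
  proof (rule nn_integral_cong)
    fix v :: "real^3"
    have "sph v /\<^sub>R norm (sph v) = sph_pt (v$2) (v$3)" if "v \<in> sph_dom"
      using that norm_sph[of v] by (simp add: sph_dom_def) (simp add: sph_def sph_pt_def vec_eq_iff forall_3)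
    then show "ennreal ((v$1)\<^sup>2) * indicator sph_dom v * f (sph v /\<^sub>R norm (sph v)) =
      (ennreal ((v$1)\<^sup>2) * indicator {0<..<1} (v$1)) * (indicator {-1<..<1} (v$2) * (f (sph_pt (v$2) (v$3)) * (indicator {-pi<..<pi} (v$3) * indicator (-{0}) (v$3))))"
      by (auto simp: indicator_def sph_dom_def)
  qed
  also have "\<dots> = (\<integral>\<^sup>+a. \<integral>\<^sup>+b. \<integral>\<^sup>+c. (ennreal (a\<^sup>2) * indicator {0<..<1} a) * (indicator {-1<..<1} b * (f (sph_pt b c) * (indicator {-pi<..<pi} c * indicator (-{0}) c))) \<partial>lborel \<partial>lborel \<partial>lborel)"
    by (rule nn_integral_lborel_vec3) measurable
  also have "\<dots> = (\<integral>\<^sup>+a. ennreal (a\<^sup>2) * indicator {0<..<1} a \<partial>lborel) * (\<integral>\<^sup>+b. indicator {-1<..<1} b * (\<integral>\<^sup>+c. f (sph_pt b c) * (indicator {-pi<..<pi} c * indicator (-{0}) c) \<partial>lborel) \<partial>lborel)"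
    by (simp add: nn_integral_cmult nn_integral_multc)
  also have "(\<lambda>b. \<integral>\<^sup>+c. f (sph_pt b c) * (indicator {-pi<..<pi} c * indicator (-{0}) c) \<partial>lborel) = (\<lambda>b. \<integral>\<^sup>+c. f (sph_pt b c) * indicator {-pi<..<pi} c \<partial>lborel)"
    by (intro ext nn_integral_cong_AE eventually_mono[OF AE_lborel_singleton[of "0::real"]]) (simp add: indicator_def)
  also have "3 * ((\<integral>\<^sup>+a. ennreal (a\<^sup>2) * indicator {0<..<1} a \<partial>lborel) * (\<integral>\<^sup>+b. indicator {-1<..<1} b * (\<integral>\<^sup>+c. f (sph_pt b c) * indicator {-pi<..<pi} c \<partial>lborel) \<partial>lborel))
     = (\<integral>\<^sup>+b. indicator {-1<..<1} b * (\<integral>\<^sup>+c. f (sph_pt b c) * indicator {-pi<..<pi} c \<partial>lborel) \<partial>lborel)"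
    unfolding cube by (simp flip: mult.assoc ennreal_mult' ennreal_numeral)
  finally show ?thesis .
qed

section \<open>The pointwise inequality on a band\<close>

definition central_proj :: "real^3 \<Rightarrow> complex" where
  "central_proj u = Complex (u$1 / u$3) (u$2 / u$3)"

text \<open>
  The exponent of the heights is forced by \<open>vol3_central_proj\<close>: it makes the powers of \<open>y\<^sub>3\<close> and
  \<open>z\<^sub>3\<close> cancel in the kernel condition.  The exponent \<open>1/4\<close> is that of \<open>circle_kernel\<close>.
\<close>

definition pair_weight :: "real^3 \<Rightarrow> real^3 \<Rightarrow> real" where
  "pair_weight y z = cmod (central_proj y - central_proj z) powr (1/4) * \<bar>y$3 * z$3\<bar> powr (1/3)"

definition band_weight :: "real set \<Rightarrow> ennreal" where
  "band_weight J = (\<integral>\<^sup>+s. ennreal (\<bar>s\<bar> powr (-1/3) * (1 - s\<^sup>2) powr (-1/3)) * indicator {-1<..<1} s * indicator J s \<partial>lborel)"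

lemma measurable_central_proj[measurable]: "central_proj \<in> borel_measurable borel"
proof -
  have e: "central_proj = (\<lambda>u. complex_of_real (u$1 / u$3) + \<i> * complex_of_real (u$2 / u$3))"
    by (auto simp: central_proj_def complex_eq_iff)
  show ?thesis unfolding e by measurable
qed

lemma vol3_central_proj:
  assumes "u$3 \<noteq> 0" "y$3 \<noteq> 0" "z$3 \<noteq> 0"
  shows "vol3 u y z = \<bar>u$3\<bar> * \<bar>y$3 * z$3\<bar> * tri_area (central_proj u) (central_proj y) (central_proj z)"
proof -
  have "u$1 * (y$2 * z$3 - y$3 * z$2) + u$2 * (y$3 * z$1 - y$1 * z$3) + u$3 * (y$1 * z$2 - y$2 * z$1)
     = u$3 * (y$3 * z$3) * Im ((central_proj u - central_proj y) * cnj (central_proj z - central_proj y))"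
    using assms unfolding central_proj_def by (simp add: field_simps)
  then show ?thesis unfolding vol3_eq tri_area_def by (simp add: abs_mult)
qed

text \<open>
  On the left all powers of the heights of \<open>y\<close> and \<open>z\<close> cancel, and \<open>u\<close> contributes \<open>|u\<^sub>3|\<^sup>-\<^sup>1\<close>.
\<close>

lemma pair_kernel_central_proj:
  assumes nz: "u$3 \<noteq> 0" "y$3 \<noteq> 0" "z$3 \<noteq> 0"
  shows "pair_kernel vol3 pair_weight u y z * (pair_weight y z)\<^sup>2 = 
     inverse \<bar>u$3\<bar> * cmod (central_proj y - central_proj z) powr (1/2) *
       (tri_area (central_proj u) (central_proj y) (central_proj z) powr (-1/3)
        * cmod (central_proj u - central_proj y) powr (-1/4) * cmod (central_proj u - central_proj z) powr (-1/4))"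
proof -
  define U where "U = \<bar>u$3\<bar> powr (1/3)"
  define Y where "Y = \<bar>y$3\<bar> powr (1/3)"
  define Z where "Z = \<bar>z$3\<bar> powr (1/3)"
  have p: "0 < U" "0 < Y" "0 < Z" using nz by (auto simp: U_def Y_def Z_def)
  have m: "x powr (-r) = inverse (x powr r)" for x r :: real by (rule powr_minus)
  have U3: "\<bar>u$3\<bar> = U * U * U" using nz by (simp add: U_def flip: powr_add)
  have half: "x powr (1/2) = (x powr (1/4))\<^sup>2" for x :: real
    by (simp add: power2_eq_square flip: powr_add)
  have V: "vol3 u y z powr (-1/3) = inverse (U * Y * Z) * tri_area (central_proj u) (central_proj y) (central_proj z) powr (-1/3)"
    unfolding vol3_central_proj[OF nz] powr_mult abs_mult using m[of _ "1/3"] by (simp add: U_def Y_def Z_def)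
  have W: "pair_weight a b = cmod (central_proj a - central_proj b) powr (1/4) * (\<bar>a$3\<bar> powr (1/3) * \<bar>b$3\<bar> powr (1/3))" for a b
    by (simp add: pair_weight_def abs_mult powr_mult)
  have q: "x powr (-1/4) = inverse (x powr (1/4))" for x :: real using m[of x "1/4"] by simp
  have alg: "inverse (U * Y * Z) * t / (c1 * (U * Y) * (c2 * (U * Z))) * (c * (Y * Z))\<^sup>2 = inverse (U * U * U) * c\<^sup>2 * (t * inverse c1 * inverse c2)"
    for t c1 c2 c :: real using p by (simp add: divide_simps power2_eq_square)
  show ?thesis
    unfolding pair_kernel_def V W U_def[symmetric] Y_def[symmetric] Z_def[symmetric] half q
    unfolding U3 by (rule alg)
qed

lemma finite_measure_sphere: "finite_measure sphere_measure"
  by (rule finite_measureI) (simp add: space_sphere_measure emeasure_sphere_measure_total)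

lemma measurable_sphere_ident[measurable]: "(\<lambda>w. w) \<in> measurable sphere_measure borel"
proof -
  have "(\<lambda>w. w) \<in> measurable (restrict_space borel (sphere 0 1)) borel"
    by (rule measurable_restrict_space1) simp
  then show ?thesis by (simp cong: measurable_cong_sets add: sets_sphere_measure)
qed

lemma measurable_sphere_borel[measurable_dest]:
  assumes "f \<in> borel_measurable borel" shows "f \<in> borel_measurable sphere_measure"
  using measurable_compose[OF measurable_sphere_ident assms] .

text \<open>
  Null sets of the sphere measure come from cones; the exceptional sets of the abstract
  inequality lie in great circles.
\<close>

lemma AE_sphere_hyperplane:
  assumes "n \<noteq> (0 :: real^3)"
  shows "AE w in sphere_measure. n \<bullet> w \<noteq> 0"
proof -
  have "negligible {x::real^3. n \<bullet> x = 0}"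
    using assms by (intro negligible_hyperplane) auto
  then have "{x::real^3. n \<bullet> x = 0} \<in> null_sets lebesgue"
    by (simp add: negligible_iff_null_sets)
  moreover have "{x::real^3. n \<bullet> x = 0} \<in> sets borel" by measurable
  ultimately have "{x::real^3. n \<bullet> x = 0} \<in> null_sets lborel" by (simp add: null_sets_def)
  then have ae: "AE x in lborel. n \<bullet> x \<noteq> 0" by (rule AE_I') auto
  have "(\<integral>\<^sup>+w. indicator {w. n \<bullet> w = 0} w \<partial>sphere_measure) = 3 * (\<integral>\<^sup>+x. indicator {w. n \<bullet> w = 0} (x /\<^sub>R norm x) * indicator (ball 0 1 - {0}) x \<partial>lborel)"
    by (rule nn_integral_sphere_measure) measurable
  also have "(\<integral>\<^sup>+x. indicator {w. n \<bullet> w = 0} (x /\<^sub>R norm x) * indicator (ball 0 1 - {0}) x \<partial>lborel) = (\<integral>\<^sup>+x. 0 \<partial>(lborel :: (real^3) measure))"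
    by (rule nn_integral_cong_AE) (use ae in eventually_elim, auto simp: indicator_def)
  finally have "(\<integral>\<^sup>+w. indicator {w. n \<bullet> w = 0} w \<partial>sphere_measure) = 0" by simp
  then have "AE w in sphere_measure. indicator {w. n \<bullet> w = 0} w = (0::ennreal)"
    by (subst (asm) nn_integral_0_iff_AE) measurable
  then show ?thesis by eventually_elim (auto simp: indicator_def split: if_splits)
qed

lemma central_proj_eq_iff:
  assumes "x$3 \<noteq> 0" "y$3 \<noteq> 0"
  shows "central_proj x = central_proj y \<longleftrightarrow> x$1 * y$3 = y$1 * x$3 \<and> x$2 * y$3 = y$2 * x$3"
  using assms by (auto simp: central_proj_def frac_eq_eq)

text \<open>
  The kernel condition, circle by circle: at height \<open>s\<close> the central projection is a circle of radius
  \<open>\<surd>(1 - s\<^sup>2) / |s|\<close>, and the power \<open>-2/3\<close> of this radius combines with \<open>|s|\<^sup>-\<^sup>1\<close> to the density of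
  \<open>band_weight\<close>.
\<close>

lemma band_kernel_bound:
  assumes yz: "y$3 \<noteq> 0" "z$3 \<noteq> 0" "central_proj y \<noteq> central_proj z" and J[measurable]: "J \<in> sets borel"
  shows "(\<integral>\<^sup>+u. ennreal (pair_kernel vol3 pair_weight u y z * (pair_weight y z)\<^sup>2) * indicator {w. w$3 \<in> J \<and> w$3 \<noteq> 0} u \<partial>sphere_measure)
    \<le> ennreal (1728 * pi) * band_weight J"
proof -
  let ?p = "central_proj y" and ?q = "central_proj z"
  let ?F = "\<lambda>u. ennreal (pair_kernel vol3 pair_weight u y z * (pair_weight y z)\<^sup>2) * indicator {w. w$3 \<in> J \<and> w$3 \<noteq> 0} u"
  have mF: "?F \<in> borel_measurable borel"
    unfolding pair_kernel_def vol3_eq pair_weight_def by measurable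
  have inner: "(\<integral>\<^sup>+\<theta>. ?F (sph_pt s \<theta>) * indicator {-pi<..<pi} \<theta> \<partial>lborel)
      \<le> ennreal (1728 * pi) * (ennreal (\<bar>s\<bar> powr (-1/3) * (1 - s\<^sup>2) powr (-1/3)) * indicator J s)"
    if s: "-1 < s" "s < 1" for s
  proof (cases "s \<in> J \<and> s \<noteq> 0")
    case True
    \<comment> \<open>The radius is negative for negative height, since central projection reverses the direction.\<close>
    define T where "T = sqrt (1 - s\<^sup>2) / s"
    have p: "0 < 1 - s\<^sup>2" using s by (rule one_minus_square_pos)
    have T: "T \<noteq> 0" using p True by (simp add: T_def)
    have s3: "sph_pt s \<theta> $ 3 = s" for \<theta> by (simp add: sph_pt_def)
    have cp: "central_proj (sph_pt s \<theta>) = of_real T * cis \<theta>" for \<theta>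
      by (simp add: central_proj_def sph_pt_def T_def complex_eq_iff)
    let ?t = "\<lambda>\<theta>. tri_area (of_real T * cis \<theta>) ?p ?q powr (-1/3) * cmod (of_real T * cis \<theta> - ?p) powr (-1/4) * cmod (of_real T * cis \<theta> - ?q) powr (-1/4)"
    have "(\<integral>\<^sup>+\<theta>. ?F (sph_pt s \<theta>) * indicator {-pi<..<pi} \<theta> \<partial>lborel)
       = (\<integral>\<^sup>+\<theta>. ennreal (inverse \<bar>s\<bar> * cmod (?p - ?q) powr (1/2)) * (ennreal (?t \<theta>) * indicator {-pi<..<pi} \<theta>) \<partial>lborel)"
    proof (rule nn_integral_cong)
      fix \<theta>
      have "pair_kernel vol3 pair_weight (sph_pt s \<theta>) y z * (pair_weight y z)\<^sup>2 = inverse \<bar>s\<bar> * cmod (?p - ?q) powr (1/2) * ?t \<theta>"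
        using pair_kernel_central_proj[of "sph_pt s \<theta>" y z] yz True unfolding s3 cp by simp
      then show "?F (sph_pt s \<theta>) * indicator {-pi<..<pi} \<theta> = ennreal (inverse \<bar>s\<bar> * cmod (?p - ?q) powr (1/2)) * (ennreal (?t \<theta>) * indicator {-pi<..<pi} \<theta>)"
        using True by (simp only:) (simp add: s3 ennreal_mult' mult.assoc)
    qed
    also have "\<dots> = ennreal (inverse \<bar>s\<bar> * cmod (?p - ?q) powr (1/2)) * (\<integral>\<^sup>+\<theta>. ennreal (?t \<theta>) * indicator {-pi<..<pi} \<theta> \<partial>lborel)"
      by (rule nn_integral_cmult) measurable
    also have "\<dots> \<le> ennreal (inverse \<bar>s\<bar> * cmod (?p - ?q) powr (1/2)) * ennreal (1728 * pi * \<bar>T\<bar> powr (-2/3) * cmod (?p - ?q) powr (-1/2))"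
      by (intro mult_left_mono circle_kernel yz T) auto
    also have "\<dots> = ennreal (1728 * pi * (\<bar>s\<bar> powr (-1/3) * (1 - s\<^sup>2) powr (-1/3)))"
    proof -
      have m1: "x powr (-1) = inverse x" if "0 \<le> x" for x :: real using that by (simp add: powr_minus)
      have c: "cmod (?p - ?q) powr (1/2) * cmod (?p - ?q) powr (-1/2) = 1"
        using yz(3) by (simp flip: powr_add)
      have "\<bar>T\<bar> = sqrt (1 - s\<^sup>2) / \<bar>s\<bar>" using p by (simp add: T_def)
      then have "\<bar>T\<bar> powr (-2/3) = sqrt (1 - s\<^sup>2) powr (-2/3) / \<bar>s\<bar> powr (-2/3)"
        using p by (simp add: powr_divide)
      also have "sqrt (1 - s\<^sup>2) powr (-2/3) = (1 - s\<^sup>2) powr (-1/3)"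
        using p powr_powr[of "1 - s\<^sup>2" "1/2" "-2/3"] by (simp add: powr_half_sqrt)
      finally have T23: "\<bar>T\<bar> powr (-2/3) = (1 - s\<^sup>2) powr (-1/3) / \<bar>s\<bar> powr (-2/3)" .
      have s13: "\<bar>s\<bar> powr (-1/3) = \<bar>s\<bar> powr (-1) / \<bar>s\<bar> powr (-2/3)"
        by (subst powr_diff[symmetric]) simp
      then have t: "inverse \<bar>s\<bar> * \<bar>T\<bar> powr (-2/3) = \<bar>s\<bar> powr (-1/3) * (1 - s\<^sup>2) powr (-1/3)"
        unfolding T23 s13 m1[OF abs_ge_zero] using True by (simp add: divide_simps)
      have "inverse \<bar>s\<bar> * cmod (?p - ?q) powr (1/2) * (1728 * pi * \<bar>T\<bar> powr (-2/3) * cmod (?p - ?q) powr (-1/2))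
         = 1728 * pi * (inverse \<bar>s\<bar> * \<bar>T\<bar> powr (-2/3)) * (cmod (?p - ?q) powr (1/2) * cmod (?p - ?q) powr (-1/2))"
        by (simp only: mult_ac)
      then show ?thesis unfolding c t by (subst ennreal_mult[symmetric]) (simp_all only: mult_1_right zero_le_mult_iff, auto)
    qed
    finally show ?thesis using True by (simp add: ennreal_mult')
  next
    case False
    then have "?F (sph_pt s \<theta>) = 0" for \<theta> by (auto simp: sph_pt_def)
    then show ?thesis by (simp only: mult_zero_left) simp
  qed
  have "(\<integral>\<^sup>+u. ?F u \<partial>sphere_measure) = (\<integral>\<^sup>+s. indicator {-1<..<1} s * (\<integral>\<^sup>+\<theta>. ?F (sph_pt s \<theta>) * indicator {-pi<..<pi} \<theta> \<partial>lborel) \<partial>lborel)"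
    by (rule nn_integral_sphere_coords[OF mF])
  also have "\<dots> \<le> (\<integral>\<^sup>+s. ennreal (1728 * pi) * (ennreal (\<bar>s\<bar> powr (-1/3) * (1 - s\<^sup>2) powr (-1/3)) * indicator {-1<..<1} s * indicator J s) \<partial>lborel)"
  proof (rule nn_integral_mono)
    fix s :: real
    show "indicator {-1<..<1} s * (\<integral>\<^sup>+\<theta>. ?F (sph_pt s \<theta>) * indicator {-pi<..<pi} \<theta> \<partial>lborel)
       \<le> ennreal (1728 * pi) * (ennreal (\<bar>s\<bar> powr (-1/3) * (1 - s\<^sup>2) powr (-1/3)) * indicator {-1<..<1} s * indicator J s)"
    proof (cases "s \<in> {-1<..<1}")
      case True
      then show ?thesis using inner[of s] by (simp add: mult.assoc)
    qed simp
  qed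
  also have "\<dots> = ennreal (1728 * pi) * band_weight J"
    unfolding band_weight_def by (rule nn_integral_cmult) measurable
  finally show ?thesis .
qed

lemma measurable_vol3[measurable]:
  assumes [measurable]: "f \<in> borel_measurable M" "g \<in> borel_measurable M" "h \<in> borel_measurable M"
  shows "(\<lambda>x. vol3 (f x) (g x) (h x)) \<in> borel_measurable M"
  unfolding vol3_eq by measurable

text \<open>
  The abstract inequality on the measure space of all \<open>w\<close> in the band with \<open>w\<^sub>3 \<noteq> 0\<close>; removing the
  equator makes the central projection meaningful and changes no integral.
\<close>

theorem band_integral_pow6_le:
  fixes g :: "real^3 \<Rightarrow> real"
  assumes g[measurable]: "g \<in> borel_measurable borel" and g0: "\<And>w. 0 \<le> g w" and J[measurable]: "J \<in> sets borel"
  shows "(\<integral>\<^sup>+w. ennreal (g w) * indicator J (w$3) \<partial>sphere_measure) ^ 6 \<le> (ennreal (1728 * pi) * band_weight J) ^ 3 *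
    (\<integral>\<^sup>+x. \<integral>\<^sup>+y. \<integral>\<^sup>+z. ennreal ((g x * g y * g z)\<^sup>2 * vol3 x y z) \<partial>sphere_measure \<partial>sphere_measure \<partial>sphere_measure)"
proof -
  define B where "B = {w::real^3. w$3 \<in> J \<and> w$3 \<noteq> 0}"
  define S where "S = B \<inter> sphere 0 1"
  let ?\<sigma> = "sphere_measure"
  define M where "M = restrict_space ?\<sigma> S"
  interpret sig: finite_measure ?\<sigma> by (rule finite_measure_sphere)
  have B[measurable]: "B \<in> sets borel" unfolding B_def by measurable
  have S: "S \<in> sets ?\<sigma>" using B unfolding S_def sets_sphere_measure sets_restrict_space by blast
  have spM: "space M = S" using S_def by (auto simp: M_def space_restrict_space space_sphere_measure)
  have SM: "S \<inter> space ?\<sigma> \<in> sets ?\<sigma>" using S by auto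
  have fin: "finite_measure M" unfolding M_def by (rule finite_measure_restrict_space) (use SM S sig.finite_measure_axioms in auto)
  interpret M: finite_measure M by (rule fin)
  have id[measurable]: "(\<lambda>w. w) \<in> measurable M borel"
    unfolding M_def by (rule measurable_restrict_space1) measurable
  have fst': "fst \<in> measurable (M \<Otimes>\<^sub>M N) borel" and snd': "snd \<in> measurable (N \<Otimes>\<^sub>M M) borel" for N :: "'n measure"
    using measurable_compose[OF measurable_fst id] measurable_compose[OF measurable_snd id] by auto
  have nnM: "(\<integral>\<^sup>+w. f w \<partial>M) = (\<integral>\<^sup>+w. f w * indicator S w \<partial>?\<sigma>)" for f :: "_ \<Rightarrow> ennreal"
    unfolding M_def by (rule nn_integral_restrict_space) (rule SM)
  have AEM: "AE w in M. Q w" if "AE w in ?\<sigma>. Q w" for Q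
    unfolding M_def using that by (subst AE_restrict_space_iff[OF SM]) (auto elim: eventually_mono)
  have indS: "indicator S w = (indicator B w :: ennreal)" if "w \<in> space ?\<sigma>" for w
    using that by (auto simp: S_def indicator_def space_sphere_measure)
  have main: "(\<integral>\<^sup>+w. g w \<partial>M) ^ 6 \<le> (ennreal (1728 * pi) * band_weight J) ^ 3 *
      (\<integral>\<^sup>+x. \<integral>\<^sup>+y. \<integral>\<^sup>+z. ennreal ((g x * g y * g z)\<^sup>2 * vol3 x y z) \<partial>M \<partial>M \<partial>M)"
  proof (rule integral_pow6_le_triple_integral[where P = pair_weight])
    show "sigma_finite_measure M" by unfold_locales
    show "g \<in> borel_measurable M" using measurable_compose[OF id g] by simp
    have [measurable]: "fst \<in> measurable (M \<Otimes>\<^sub>M M \<Otimes>\<^sub>M M) borel"  "(\<lambda>p. fst (snd p)) \<in> measurable (M \<Otimes>\<^sub>M M \<Otimes>\<^sub>M M) borel" "(\<lambda>p. snd (snd p)) \<in> measurable (M \<Otimes>\<^sub>M M \<Otimes>\<^sub>M M) borel"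
      using fst' measurable_compose[OF measurable_snd fst'] measurable_compose[OF measurable_snd snd'] by auto
    show "(\<lambda>(x, y, z). vol3 x y z) \<in> borel_measurable (M \<Otimes>\<^sub>M M \<Otimes>\<^sub>M M)"
      unfolding case_prod_beta' by measurable
    have [measurable]: "fst \<in> measurable (M \<Otimes>\<^sub>M M) borel"  "snd \<in> measurable (M \<Otimes>\<^sub>M M) borel"
      using fst' snd' by auto
    show "(\<lambda>(x, y). pair_weight x y) \<in> borel_measurable (M \<Otimes>\<^sub>M M)"
      unfolding case_prod_beta' pair_weight_def by measurable
    show "vol3 x y z = vol3 y x z" "vol3 x y z = vol3 x z y" for x y z by (rule vol3_commute)+
    show "pair_weight x y = pair_weight y x" for x y
      unfolding pair_weight_def by (simp add: norm_minus_commute mult.commute)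
    show "0 \<le> vol3 x y z" for x y z by (simp add: vol3_def)
    show "0 \<le> pair_weight x y" for x y by (simp add: pair_weight_def)
    have pos_iff: "0 < pair_weight x y \<longleftrightarrow> central_proj x \<noteq> central_proj y" if "x \<in> S" "y \<in> S" for x y
      using that by (auto simp: pair_weight_def S_def B_def)
    show "AE y in M. 0 < pair_weight x y" if "x \<in> space M" for x
    proof -
      have x: "x \<in> S" using that spM by simp
      then have x3: "x$3 \<noteq> 0" by (simp add: S_def B_def)
      define n where "n = (vector [x$3, 0, - (x$1)] :: real^3)"
      have "n \<noteq> 0" using x3 by (auto simp: n_def vec_eq_iff forall_3)
      from AEM[OF AE_sphere_hyperplane[OF this]] AE_space[of M] show ?thesis
      proof eventually_elim
        fix y assume y: "n \<bullet> y \<noteq> 0" "y \<in> space M"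
        then have "y \<in> S" by (simp add: spM)
        moreover have "x$1 * y$3 \<noteq> y$1 * x$3" using y by (simp add: n_def inner_vec_def sum_3 mult.commute)
        ultimately show "0 < pair_weight x y" using pos_iff[OF x] central_proj_eq_iff[of x y] x3 by (auto simp: S_def B_def)
      qed
    qed
    show "AE z in M. 0 < vol3 x y z" if "x \<in> space M" "y \<in> space M" "0 < pair_weight x y" for x y
    proof -
      have x: "x \<in> S" and y: "y \<in> S" using that spM by simp_all
      then have 3: "x$3 \<noteq> 0" "y$3 \<noteq> 0" by (simp_all add: S_def B_def)
      define n where "n = (vector [x$2 * y$3 - x$3 * y$2, x$3 * y$1 - x$1 * y$3, x$1 * y$2 - x$2 * y$1] :: real^3)"
      have "central_proj x \<noteq> central_proj y" using that pos_iff[OF x y] by simp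
      then have "n \<noteq> 0" using central_proj_eq_iff[OF 3] by (auto simp: n_def vec_eq_iff forall_3 mult.commute)
      from AEM[OF AE_sphere_hyperplane[OF this]] show ?thesis
      proof eventually_elim
        fix z assume "n \<bullet> z \<noteq> 0"
        moreover have "vol3 x y z = \<bar>n \<bullet> z\<bar>"
          unfolding vol3_eq n_def inner_vec_def sum_3 by (simp add: algebra_simps)
        ultimately show "0 < vol3 x y z" by simp
      qed
    qed
    show "(\<integral>\<^sup>+u. ennreal (pair_kernel vol3 pair_weight u x y) \<partial>M) * ennreal ((pair_weight x y)\<^sup>2) \<le> ennreal (1728 * pi) * band_weight J"
      if "x \<in> space M" "y \<in> space M" "0 < pair_weight x y" for x y
    proof -
      have x: "x \<in> S" and y: "y \<in> S" using that spM by simp_all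
      have [measurable]: "(\<lambda>u. pair_kernel vol3 pair_weight u x y) \<in> borel_measurable borel"
        unfolding pair_kernel_def pair_weight_def by measurable
      have m: "(\<lambda>u. ennreal (pair_kernel vol3 pair_weight u x y)) \<in> borel_measurable M"
        by (rule measurable_compose[OF id]) measurable
      have "(\<integral>\<^sup>+u. ennreal (pair_kernel vol3 pair_weight u x y) \<partial>M) * ennreal ((pair_weight x y)\<^sup>2)
         = (\<integral>\<^sup>+u. ennreal (pair_kernel vol3 pair_weight u x y) * ennreal ((pair_weight x y)\<^sup>2) \<partial>M)"
        by (rule nn_integral_multc[symmetric, OF m])
      also have "\<dots> = (\<integral>\<^sup>+u. ennreal (pair_kernel vol3 pair_weight u x y * (pair_weight x y)\<^sup>2) * indicator B u \<partial>?\<sigma>)"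
        unfolding nnM by (rule nn_integral_cong) (simp only: indS ennreal_mult''[OF zero_le_power2])
      also have "\<dots> \<le> ennreal (1728 * pi) * band_weight J"
        unfolding B_def using that x y pos_iff[OF x y] by (intro band_kernel_bound J) (auto simp: S_def B_def)
      finally show ?thesis .
    qed
  qed (rule g0)
  have mu: "(\<integral>\<^sup>+w. f w \<partial>M) \<le> (\<integral>\<^sup>+w. f w \<partial>?\<sigma>)" for f :: "_ \<Rightarrow> ennreal"
    unfolding nnM by (intro nn_integral_mono) (auto simp: indicator_def)
  have "(\<integral>\<^sup>+w. ennreal (g w) * indicator J (w$3) \<partial>?\<sigma>) = (\<integral>\<^sup>+w. g w \<partial>M)"
    unfolding nnM
  proof (rule nn_integral_cong_AE)
    have "axis 3 1 \<noteq> (0::real^3)" by (simp add: axis_eq_0_iff)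
    from AE_sphere_hyperplane[OF this] AE_space[of ?\<sigma>]
    show "AE w in ?\<sigma>. ennreal (g w) * indicator J (w$3) = ennreal (g w) * indicator S w"
    proof eventually_elim
      fix w :: "real^3" assume "axis 3 1 \<bullet> w \<noteq> 0" "w \<in> space ?\<sigma>"
      then show "ennreal (g w) * indicator J (w$3) = ennreal (g w) * indicator S w"
        by (simp only: indS) (auto simp: B_def inner_axis' indicator_def)
    qed
  qed
  also have "(\<integral>\<^sup>+w. g w \<partial>M) ^ 6 \<le> (ennreal (1728 * pi) * band_weight J) ^ 3 *
      (\<integral>\<^sup>+x. \<integral>\<^sup>+y. \<integral>\<^sup>+z. ennreal ((g x * g y * g z)\<^sup>2 * vol3 x y z) \<partial>M \<partial>M \<partial>M)"
    by (rule main)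
  also have "\<dots> \<le> (ennreal (1728 * pi) * band_weight J) ^ 3 *
      (\<integral>\<^sup>+x. \<integral>\<^sup>+y. \<integral>\<^sup>+z. ennreal ((g x * g y * g z)\<^sup>2 * vol3 x y z) \<partial>?\<sigma> \<partial>?\<sigma> \<partial>?\<sigma>)"
    by (intro mult_left_mono order_trans[OF mu] nn_integral_mono) (auto intro!: order_trans[OF mu] nn_integral_mono)
  finally show ?thesis .
qed

text \<open>
  The determinant and the sphere measure are invariant under the rotation that moves the third
  coordinate axis to \<open>e\<close>.
\<close>

theorem band_integral_pow6_le_axis:
  fixes g :: "real^3 \<Rightarrow> real"
  assumes g[measurable]: "g \<in> borel_measurable borel" and g0: "\<And>w. 0 \<le> g w" and J[measurable]: "J \<in> sets borel"
    and e: "norm e = 1"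
  shows "(\<integral>\<^sup>+w. ennreal (g w) * indicator J (w \<bullet> e) \<partial>sphere_measure) ^ 6 \<le> (ennreal (1728 * pi) * band_weight J) ^ 3 *
    (\<integral>\<^sup>+x. \<integral>\<^sup>+y. \<integral>\<^sup>+z. ennreal ((g x * g y * g z)\<^sup>2 * vol3 x y z) \<partial>sphere_measure \<partial>sphere_measure \<partial>sphere_measure)"
proof -
  interpret sig: finite_measure sphere_measure by (rule finite_measure_sphere)
  obtain Q where Q: "orthogonal_transformation Q" and Qe: "Q (axis 3 1 :: real^3) = e"
    using orthogonal_transformation_exists[of "axis 3 1 :: real^3" e] e by (auto simp: norm_axis_1)
  have lin: "linear Q" using Q by (simp add: orthogonal_transformation_linear)
  have [measurable]: "Q \<in> borel_measurable borel"
    using lin by (intro borel_measurable_continuous_onI linear_continuous_on linear_conv_bounded_linear[THEN iffD1])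
  have in3: "Q w \<bullet> e = w $ 3" for w
    using Q unfolding Qe[symmetric] orthogonal_transformation_def by (simp add: inner_axis)
  have fst': "fst \<in> measurable (sphere_measure \<Otimes>\<^sub>M N) borel" and snd': "snd \<in> measurable (N \<Otimes>\<^sub>M sphere_measure) borel" for N :: "'n measure"
    using measurable_compose[OF measurable_fst measurable_sphere_ident] measurable_compose[OF measurable_snd measurable_sphere_ident] by auto
  let ?f = "\<lambda>x y z. ennreal ((g x * g y * g z)\<^sup>2 * vol3 x y z)"
  have "(\<integral>\<^sup>+w. ennreal (g w) * indicator J (w \<bullet> e) \<partial>sphere_measure) = (\<integral>\<^sup>+w. ennreal (g (Q w)) * indicator J (Q w \<bullet> e) \<partial>sphere_measure)"
    by (rule nn_integral_sphere_measure_orthogonal[symmetric, OF Q]) measurable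
  then have "(\<integral>\<^sup>+w. ennreal (g w) * indicator J (w \<bullet> e) \<partial>sphere_measure) ^ 6 = (\<integral>\<^sup>+w. ennreal ((\<lambda>w. g (Q w)) w) * indicator J (w $ 3) \<partial>sphere_measure) ^ 6"
    by (simp add: in3)
  also have "\<dots> \<le> (ennreal (1728 * pi) * band_weight J) ^ 3 *
    (\<integral>\<^sup>+x. \<integral>\<^sup>+y. \<integral>\<^sup>+z. ennreal ((g (Q x) * g (Q y) * g (Q z))\<^sup>2 * vol3 x y z) \<partial>sphere_measure \<partial>sphere_measure \<partial>sphere_measure)"
    by (rule band_integral_pow6_le) (auto simp: g0)
  also have "(\<integral>\<^sup>+x. \<integral>\<^sup>+y. \<integral>\<^sup>+z. ennreal ((g (Q x) * g (Q y) * g (Q z))\<^sup>2 * vol3 x y z) \<partial>sphere_measure \<partial>sphere_measure \<partial>sphere_measure)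
     = (\<integral>\<^sup>+x. \<integral>\<^sup>+y. \<integral>\<^sup>+z. ?f (Q x) (Q y) (Q z) \<partial>sphere_measure \<partial>sphere_measure \<partial>sphere_measure)"
    by (simp add: vol3_orthogonal[OF Q])
  also have "\<dots> = (\<integral>\<^sup>+x. \<integral>\<^sup>+y. \<integral>\<^sup>+z. ?f (Q x) (Q y) z \<partial>sphere_measure \<partial>sphere_measure \<partial>sphere_measure)"
    by (intro nn_integral_cong nn_integral_sphere_measure_orthogonal[OF Q]) measurable
  also have "\<dots> = (\<integral>\<^sup>+x. \<integral>\<^sup>+y. \<integral>\<^sup>+z. ?f (Q x) y z \<partial>sphere_measure \<partial>sphere_measure \<partial>sphere_measure)"
  proof (rule nn_integral_cong)
    fix x
    have [measurable]: "(\<lambda>p. snd p) \<in> measurable (borel \<Otimes>\<^sub>M sphere_measure) (borel :: (real^3) measure)" by (rule snd')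
    show "(\<integral>\<^sup>+y. \<integral>\<^sup>+z. ?f (Q x) (Q y) z \<partial>sphere_measure \<partial>sphere_measure) = (\<integral>\<^sup>+y. \<integral>\<^sup>+z. ?f (Q x) y z \<partial>sphere_measure \<partial>sphere_measure)"
      by (rule nn_integral_sphere_measure_orthogonal[OF Q, of "\<lambda>y. \<integral>\<^sup>+z. ?f (Q x) y z \<partial>sphere_measure"]) measurable
  qed
  also have "\<dots> = (\<integral>\<^sup>+x. \<integral>\<^sup>+y. \<integral>\<^sup>+z. ?f x y z \<partial>sphere_measure \<partial>sphere_measure \<partial>sphere_measure)"
  proof -
    have [measurable]: "(\<lambda>p. snd p) \<in> measurable (borel \<Otimes>\<^sub>M sphere_measure) (borel :: (real^3) measure)" by (rule snd')
    have [measurable]: "(\<lambda>p. snd p) \<in> measurable ((borel \<Otimes>\<^sub>M sphere_measure) \<Otimes>\<^sub>M sphere_measure) (borel :: (real^3) measure)" by (rule snd')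
    have [measurable]: "(\<lambda>p. snd (fst p)) \<in> measurable ((borel \<Otimes>\<^sub>M sphere_measure) \<Otimes>\<^sub>M sphere_measure) (borel :: (real^3) measure)"
      by (rule measurable_compose[OF measurable_fst snd'])
    show ?thesis
      by (rule nn_integral_sphere_measure_orthogonal[OF Q, of "\<lambda>x. \<integral>\<^sup>+y. \<integral>\<^sup>+z. ?f x y z \<partial>sphere_measure \<partial>sphere_measure"]) measurable
  qed
  finally show ?thesis .
qed

section \<open>The weight of a band\<close>

text \<open>
  The bound keeps the factor \<open>\<beta> - \<alpha>\<close>, which is what produces the third power of \<open>1 - a/b\<close> in the
  theorem, and degenerates only like \<open>(1 - \<alpha>)\<^sup>-\<^sup>1\<^sup>/\<^sup>3\<close> near the pole \<open>s = 1\<close>.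
\<close>

lemma nn_integral_powr_one_minus:
  fixes \<alpha> \<beta> :: real
  assumes "0 \<le> \<alpha>" "\<alpha> \<le> \<beta>" "\<beta> \<le> 1" "\<alpha> < 1"
  shows "(\<integral>\<^sup>+s. ennreal ((1 - s) powr (-1/3)) * indicator {\<alpha>..\<beta>} s \<partial>lborel) \<le> ennreal (3/2 * (\<beta> - \<alpha>) * (1 - \<alpha>) powr (-1/3))"
proof -
  have "((\<lambda>s. (1 - s) powr (-1/3)) has_integral (- (3/2) * (1 - \<beta>) powr (2/3)) - (- (3/2) * (1 - \<alpha>) powr (2/3))) {\<alpha>..\<beta>}"
  proof (rule fundamental_theorem_of_calculus_interior)
    show "continuous_on {\<alpha>..\<beta>} (\<lambda>s. - (3/2) * (1 - s) powr (2/3))"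
      using assms by (intro continuous_intros continuous_on_powr') auto
    show "((\<lambda>s. - (3/2) * (1 - s) powr (2/3)) has_vector_derivative (1 - s) powr (-1/3)) (at s)" if "s \<in> {\<alpha><..<\<beta>}" for s
      unfolding has_real_derivative_iff_has_vector_derivative[symmetric] using that assms
      by (auto intro!: derivative_eq_intros)
  qed (use assms in auto)
  then have "(\<integral>\<^sup>+s. ennreal ((1 - s) powr (-1/3)) * indicator {\<alpha>..\<beta>} s \<partial>lborel) = ennreal (3/2 * ((1 - \<alpha>) powr (2/3) - (1 - \<beta>) powr (2/3)))"
    by (intro nn_integral_has_integral_lebesgue') (auto simp: field_simps)
  also have "\<dots> \<le> ennreal (3/2 * (\<beta> - \<alpha>) * (1 - \<alpha>) powr (-1/3))"
  proof (rule ennreal_leI)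
    define a where "a = 1 - \<alpha>"
    define b where "b = 1 - \<beta>"
    have ab: "0 < a" "0 \<le> b" "b \<le> a" using assms by (auto simp: a_def b_def)
    have a2: "a powr (2/3) = a * a powr (-1/3)"
      using ab powr_add[of a 1 "-1/3"] by simp
    have "b * a powr (-1/3) \<le> b powr (2/3)"
    proof (cases "b = 0")
      case False
      then have "b powr (2/3) = b * b powr (-1/3)" using ab powr_add[of b 1 "-1/3"] by simp
      moreover have "a powr (-1/3) \<le> b powr (-1/3)" using ab False by (intro powr_mono2') auto
      ultimately show ?thesis using ab by (simp add: mult_left_mono)
    qed simp
    then have "a powr (2/3) - b powr (2/3) \<le> (a - b) * a powr (-1/3)"
      using a2 by (simp add: left_diff_distrib)
    then have "3/2 * (a powr (2/3) - b powr (2/3)) \<le> 3/2 * ((a - b) * a powr (-1/3))"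
      by (rule mult_left_mono) simp
    moreover have "a - b = \<beta> - \<alpha>" by (simp add: a_def b_def)
    ultimately show "3/2 * ((1 - \<alpha>) powr (2/3) - (1 - \<beta>) powr (2/3)) \<le> 3/2 * (\<beta> - \<alpha>) * (1 - \<alpha>) powr (-1/3)"
      unfolding mult.assoc by (simp only: a_def b_def)
  qed
  finally show ?thesis .
qed

lemma band_weight_le:
  assumes J: "\<And>s. s \<in> J \<Longrightarrow> \<bar>s\<bar> < 1 \<Longrightarrow> \<alpha> \<le> \<bar>s\<bar> \<and> \<bar>s\<bar> \<le> \<beta>"
  shows "band_weight J \<le> 2 * (\<integral>\<^sup>+s. ennreal (s powr (-1/3) * (1 - s) powr (-1/3)) * indicator {0<..<1} s * indicator {\<alpha>..\<beta>} s \<partial>lborel)"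
proof -
  let ?f = "\<lambda>s. ennreal (s powr (-1/3) * (1 - s) powr (-1/3)) * indicator {0<..<1} s * indicator {\<alpha>..\<beta>} s"
  have pw: "(1 - s\<^sup>2) powr (-1/3) \<le> (1 - \<bar>s\<bar>) powr (-1/3)" if "\<bar>s\<bar> < 1" for s :: real
  proof (rule powr_mono2')
    have "\<bar>s\<bar> * \<bar>s\<bar> \<le> \<bar>s\<bar> * 1" using that by (intro mult_left_mono) auto
    then show "1 - \<bar>s\<bar> \<le> 1 - s\<^sup>2" by (simp add: power2_eq_square abs_mult_self_eq)
  qed (use that in auto)
  have "band_weight J \<le> (\<integral>\<^sup>+s. ?f s + ?f (- s) \<partial>lborel)"
    unfolding band_weight_def
  proof (rule nn_integral_mono_AE, rule eventually_mono[OF AE_lborel_singleton[of "0::real"]])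
    fix s :: real assume s0: "s \<noteq> 0"
    show "ennreal (\<bar>s\<bar> powr (-1/3) * (1 - s\<^sup>2) powr (-1/3)) * indicator {-1<..<1} s * indicator J s \<le> ?f s + ?f (- s)"
    proof (cases "s \<in> J \<and> \<bar>s\<bar> < 1")
      case True
      then have r: "\<alpha> \<le> \<bar>s\<bar>" "\<bar>s\<bar> \<le> \<beta>" using J by auto
      have "ennreal (\<bar>s\<bar> powr (-1/3) * (1 - s\<^sup>2) powr (-1/3)) * indicator {-1<..<1} s * indicator J s = ennreal (\<bar>s\<bar> powr (-1/3) * (1 - s\<^sup>2) powr (-1/3))"
        using True by (simp add: indicator_def abs_less_iff)
      also have "\<dots> \<le> ennreal (\<bar>s\<bar> powr (-1/3) * (1 - \<bar>s\<bar>) powr (-1/3))"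
        using True by (intro ennreal_leI mult_left_mono pw) auto
      also have "\<dots> = ?f \<bar>s\<bar>" using True r s0 by (simp add: indicator_def)
      also have "\<dots> \<le> ?f s + ?f (- s)" by (cases "0 \<le> s") (auto simp: abs_if)
      finally show ?thesis .
    next
      case False
      then show ?thesis by (auto simp: indicator_def)
    qed
  qed
  also have "\<dots> = (\<integral>\<^sup>+s. ?f s \<partial>lborel) + (\<integral>\<^sup>+s. ?f (- s) \<partial>lborel)"
    by (rule nn_integral_add) measurable
  also have "(\<integral>\<^sup>+s. ?f (- s) \<partial>lborel) = (\<integral>\<^sup>+s. ?f s \<partial>lborel)"
    by (subst nn_integral_real_affine[of ?f "-1" 0]) simp_all
  finally show ?thesis by (simp add: mult_2)
qed

lemma ennreal_cube_le:
  assumes "x \<le> ennreal y" "0 \<le> y" "y ^ 3 \<le> z"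
  shows "x ^ 3 \<le> ennreal z"
proof -
  have "x ^ 3 \<le> ennreal y ^ 3" using assms(1) by (intro power_mono) auto
  also have "\<dots> = ennreal (y ^ 3)" using assms(2) by (simp add: ennreal_power)
  also have "\<dots> \<le> ennreal z" using assms(3) by (rule ennreal_leI)
  finally show ?thesis .
qed

lemma band_weight_annulus:
  assumes J: "\<And>s. s \<in> J \<Longrightarrow> \<bar>s\<bar> < 1 \<Longrightarrow> \<alpha> \<le> \<bar>s\<bar> \<and> \<bar>s\<bar> \<le> \<beta>" and ab: "0 < \<alpha>" "\<alpha> < 1" "\<alpha> \<le> \<beta>"
  shows "band_weight J ^ 3 \<le> ennreal (27 * (min \<beta> 1 - \<alpha>) ^ 3 / (\<alpha> * (1 - \<alpha>)))"
proof -
  let ?\<gamma> = "min \<beta> 1"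
  have J': "\<alpha> \<le> \<bar>s\<bar> \<and> \<bar>s\<bar> \<le> ?\<gamma>" if "s \<in> J" "\<bar>s\<bar> < 1" for s using J[OF that] that by simp
  have "band_weight J \<le> 2 * (\<integral>\<^sup>+s. ennreal (s powr (-1/3) * (1 - s) powr (-1/3)) * indicator {0<..<1} s * indicator {\<alpha>..?\<gamma>} s \<partial>lborel)"
    by (rule band_weight_le[OF J'])
  also have "\<dots> \<le> 2 * (\<integral>\<^sup>+s. ennreal (\<alpha> powr (-1/3)) * (ennreal ((1 - s) powr (-1/3)) * indicator {\<alpha>..?\<gamma>} s) \<partial>lborel)"
  proof (intro mult_left_mono nn_integral_mono)
    fix s :: real
    show "ennreal (s powr (-1/3) * (1 - s) powr (-1/3)) * indicator {0<..<1} s * indicator {\<alpha>..?\<gamma>} s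
       \<le> ennreal (\<alpha> powr (-1/3)) * (ennreal ((1 - s) powr (-1/3)) * indicator {\<alpha>..?\<gamma>} s)"
    proof (cases "s \<in> {\<alpha>..?\<gamma>}")
      case True
      then have "s powr (-1/3) \<le> \<alpha> powr (-1/3)" using ab by (intro powr_mono2') auto
      then have "ennreal (s powr (-1/3) * (1 - s) powr (-1/3)) \<le> ennreal (\<alpha> powr (-1/3) * (1 - s) powr (-1/3))"
        by (intro ennreal_leI mult_right_mono) auto
      then show ?thesis using True by (simp add: indicator_def ennreal_mult)
    qed simp
  qed simp
  also have "\<dots> = 2 * (ennreal (\<alpha> powr (-1/3)) * (\<integral>\<^sup>+s. ennreal ((1 - s) powr (-1/3)) * indicator {\<alpha>..?\<gamma>} s \<partial>lborel))"
    by (subst nn_integral_cmult) simp_all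
  also have "\<dots> \<le> 2 * (ennreal (\<alpha> powr (-1/3)) * ennreal (3/2 * (?\<gamma> - \<alpha>) * (1 - \<alpha>) powr (-1/3)))"
    using ab by (intro mult_left_mono nn_integral_powr_one_minus) auto
  also have "\<dots> = ennreal (3 * (?\<gamma> - \<alpha>) * (\<alpha> powr (-1/3) * (1 - \<alpha>) powr (-1/3)))"
  proof -
    have scale: "2 * (ennreal x * ennreal (3/2 * y * z)) = ennreal (3 * y * (x * z))" if "0 \<le> x" "0 \<le> y" "0 \<le> z" for x y z
    proof -
      have "2 * (ennreal x * ennreal (3/2 * y * z)) = ennreal (2 * (x * (3/2 * y * z)))"
        using that by (simp only: ennreal_mult[symmetric] mult_nonneg_nonneg zero_le_numeral ennreal_numeral[symmetric] divide_nonneg_nonneg)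
      also have "2 * (x * (3/2 * y * z)) = 3 * y * (x * z)" by simp
      finally show ?thesis .
    qed
    show ?thesis by (rule scale) (use ab in auto)
  qed
  finally show ?thesis
  proof (rule ennreal_cube_le)
    have c: "(x powr (-1/3)) ^ 3 = 1 / x" if "0 < x" for x :: real
      using that powr_power[of x "-1/3" 3] by (simp add: powr_minus_divide)
    show "(3 * (?\<gamma> - \<alpha>) * (\<alpha> powr (-1/3) * (1 - \<alpha>) powr (-1/3))) ^ 3 \<le> 27 * (?\<gamma> - \<alpha>) ^ 3 / (\<alpha> * (1 - \<alpha>))"
      unfolding power_mult_distrib using ab c[of \<alpha>] c[of "1 - \<alpha>"] by simp
  qed (use ab in auto)
qed

lemma band_weight_disc:
  assumes J: "\<And>s. s \<in> J \<Longrightarrow> \<bar>s\<bar> < 1 \<Longrightarrow> \<bar>s\<bar> \<le> h" and h: "0 < h" "h \<le> 1"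
  shows "band_weight J ^ 3 \<le> ennreal (216 * h\<^sup>2)"
proof -
  have "band_weight J \<le> 2 * (\<integral>\<^sup>+s. ennreal (s powr (-1/3) * (1 - s) powr (-1/3)) * indicator {0<..<1} s * indicator {0..h} s \<partial>lborel)"
    by (rule band_weight_le) (use J in auto)
  also have "\<dots> \<le> 2 * (\<integral>\<^sup>+s. ennreal (s powr (-1/3)) * indicator {0..h} s + ennreal ((1 - s) powr (-1/3)) * indicator {0..h} s \<partial>lborel)"
  proof (intro mult_left_mono nn_integral_mono)
    fix s :: real
    show "ennreal (s powr (-1/3) * (1 - s) powr (-1/3)) * indicator {0<..<1} s * indicator {0..h} s
       \<le> ennreal (s powr (-1/3)) * indicator {0..h} s + ennreal ((1 - s) powr (-1/3)) * indicator {0..h} s"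
    proof (cases "0 < s \<and> s < 1 \<and> s \<le> h")
      case True
      let ?p = "s powr (1/3)" and ?q = "(1 - s) powr (1/3)"
      have p: "0 < ?p" "0 < ?q" using True by auto
      have "1 \<le> ?p + ?q"
      proof -
        have "s powr 1 \<le> ?p" "(1 - s) powr 1 \<le> ?q" using True by (intro powr_mono'; simp)+
        then show ?thesis using True by simp
      qed
      then have "inverse ?p * inverse ?q \<le> inverse ?p + inverse ?q" using p by (simp add: field_simps)
      then have "s powr (-1/3) * (1 - s) powr (-1/3) \<le> s powr (-1/3) + (1 - s) powr (-1/3)"
        using powr_minus[of s "1/3"] powr_minus[of "1 - s" "1/3"] by simp
      then have "ennreal (s powr (-1/3) * (1 - s) powr (-1/3)) \<le> ennreal (s powr (-1/3)) + ennreal ((1 - s) powr (-1/3))"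
        by (simp flip: ennreal_plus add: ennreal_leI)
      then show ?thesis using True by (simp add: indicator_def)
    qed (auto simp: indicator_def)
  qed simp
  also have "\<dots> = 2 * ((\<integral>\<^sup>+s. ennreal (s powr (-1/3)) * indicator {0..h} s \<partial>lborel) + (\<integral>\<^sup>+s. ennreal ((1 - s) powr (-1/3)) * indicator {0..h} s \<partial>lborel))"
    by (subst nn_integral_add) simp_all
  also have "(\<integral>\<^sup>+s. ennreal (s powr (-1/3)) * indicator {0..h} s \<partial>lborel) = ennreal (3/2 * h powr (2/3))"
    using has_integral_powr_from_0[of "-1/3" h] h
    by (intro nn_integral_has_integral_lebesgue') (auto simp: mult.commute)
  also have "(\<integral>\<^sup>+s. ennreal ((1 - s) powr (-1/3)) * indicator {0..h} s \<partial>lborel) \<le> ennreal (3/2 * h powr (2/3))"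
  proof -
    have "h powr 1 \<le> h powr (2/3)" using h by (intro powr_mono') auto
    then have "3/2 * (h - 0) * (1 - 0) powr (-1/3) \<le> 3/2 * h powr (2/3)" using h by simp
    then show ?thesis using nn_integral_powr_one_minus[of 0 h] h by (meson ennreal_leI order_trans order_refl less_imp_le zero_less_one)
  qed
  also have "2 * (ennreal (3/2 * h powr (2/3)) + ennreal (3/2 * h powr (2/3))) = ennreal (6 * h powr (2/3))"
  proof -
    have "ennreal x + ennreal x = ennreal (2 * x)" "2 * ennreal x = ennreal (2 * x)" if "0 \<le> x" for x
      using that by (simp_all flip: ennreal_plus add: ennreal_mult')
    then show ?thesis by simp
  qed
  finally have "band_weight J \<le> ennreal (6 * h powr (2/3))" by (simp add: add_left_mono mult_left_mono)
  then show ?thesis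
  proof (rule ennreal_cube_le)
    show "(6 * h powr (2/3)) ^ 3 \<le> 216 * h\<^sup>2"
      unfolding power_mult_distrib using h powr_power[of h "2/3" 3] by simp
  qed simp
qed

section \<open>Integration over space\<close>

text \<open>
  For a point \<open>x\<close> of norm \<open>r\<close> the band of directions is \<open>{w. r (w \<bullet> x/r) \<in> K}\<close>, so the pointwise
  inequality applies with \<open>J = {s. r s \<in> K}\<close>.  Afterwards the integral over \<open>x\<close> is moved inside the
  integrals over the three directions.
\<close>

lemma nn_integral_radon_dual_pow6:
  fixes H :: "real \<times> (real^3) \<Rightarrow> real"
  assumes H[measurable]: "H \<in> borel_measurable (borel \<Otimes>\<^sub>M borel)" and H0: "\<And>p. 0 \<le> H p"
    and K[measurable]: "K \<in> sets borel" and \<Omega>[measurable]: "\<Omega> \<in> sets borel"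
    and A: "\<And>x. x \<in> \<Omega> \<Longrightarrow> x \<noteq> 0 \<Longrightarrow> band_weight {s. norm x * s \<in> K} ^ 3 \<le> A"
  shows "(\<integral>\<^sup>+x\<in>\<Omega>. (\<integral>\<^sup>+w. ennreal (H (x \<bullet> w, w)) * indicator K (x \<bullet> w) \<partial>sphere_measure) ^ 6 \<partial>lborel)
    \<le> ennreal (1728 * pi) ^ 3 * A * (\<integral>\<^sup>+p. ennreal ((H p)\<^sup>2) \<partial>cyl_measure) ^ 3"
proof -
  let ?\<sigma> = sphere_measure
  interpret sig: finite_measure ?\<sigma> by (rule finite_measure_sphere)
  have sf: "sigma_finite_measure ?\<sigma>" by unfold_locales
  have sl: "sigma_finite_measure (lborel :: (real^3) measure)" by (rule sigma_finite_lborel)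
  let ?c = "ennreal (1728 * pi) ^ 3 * A"
  let ?F = "\<lambda>x u v w. ennreal ((H (x \<bullet> u, u) * H (x \<bullet> v, v) * H (x \<bullet> w, w))\<^sup>2 * vol3 u v w)"
  have m1: "(\<lambda>s. ennreal ((H (s, u))\<^sup>2)) \<in> borel_measurable borel" for u
    by measurable
  have m2: "(\<lambda>x. ennreal ((H (x \<bullet> u, u))\<^sup>2)) \<in> borel_measurable lborel" for u
    by (rule measurable_compose[OF _ m1, of "\<lambda>x. x \<bullet> u"])
       (intro borel_measurable_inner borel_measurable_const, simp)
  have [measurable]: "fst \<in> measurable (?\<sigma> \<Otimes>\<^sub>M N) borel" "snd \<in> measurable (N \<Otimes>\<^sub>M ?\<sigma>) borel" for N :: "'n measure"
    using measurable_compose[OF measurable_fst measurable_sphere_ident] measurable_compose[OF measurable_snd measurable_sphere_ident] by auto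
  have [measurable]: "(\<lambda>p. fst (f p)) \<in> borel_measurable N'" if "f \<in> measurable N' (?\<sigma> \<Otimes>\<^sub>M N)" for f and N :: "'n measure" and N' :: "'m measure"
    using measurable_compose[OF that, of fst borel] by measurable
  have [measurable]: "(\<lambda>p. snd (f p)) \<in> borel_measurable N'" if "f \<in> measurable N' (N \<Otimes>\<^sub>M ?\<sigma>)" for f and N :: "'n measure" and N' :: "'m measure"
    using measurable_compose[OF that, of snd borel] by measurable
  have "(\<integral>\<^sup>+x\<in>\<Omega>. (\<integral>\<^sup>+w. ennreal (H (x \<bullet> w, w)) * indicator K (x \<bullet> w) \<partial>?\<sigma>) ^ 6 \<partial>lborel)
     \<le> (\<integral>\<^sup>+x. ?c * (\<integral>\<^sup>+u. \<integral>\<^sup>+v. \<integral>\<^sup>+w. ?F x u v w \<partial>?\<sigma> \<partial>?\<sigma> \<partial>?\<sigma>) \<partial>lborel)"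
  proof (rule nn_integral_mono_AE, rule eventually_mono[OF AE_lborel_singleton[of "0 :: real^3"]])
    fix x :: "real^3" assume x0: "x \<noteq> 0"
    show "(\<integral>\<^sup>+w. ennreal (H (x \<bullet> w, w)) * indicator K (x \<bullet> w) \<partial>?\<sigma>) ^ 6 * indicator \<Omega> x
       \<le> ?c * (\<integral>\<^sup>+u. \<integral>\<^sup>+v. \<integral>\<^sup>+w. ?F x u v w \<partial>?\<sigma> \<partial>?\<sigma> \<partial>?\<sigma>)"
    proof (cases "x \<in> \<Omega>")
      case True
      define e where "e = x /\<^sub>R norm x"
      define J where "J = {s. norm x * s \<in> K}"
      have e: "norm e = 1" using x0 by (simp add: e_def)
      have J: "J \<in> sets borel" unfolding J_def by measurable
      have xe: "x \<bullet> w = norm x * (w \<bullet> e)" for w using x0 by (simp add: e_def inner_commute)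
      have "(\<integral>\<^sup>+w. ennreal (H (x \<bullet> w, w)) * indicator K (x \<bullet> w) \<partial>?\<sigma>) = (\<integral>\<^sup>+w. ennreal (H (x \<bullet> w, w)) * indicator J (w \<bullet> e) \<partial>?\<sigma>)"
        by (rule nn_integral_cong) (simp add: J_def xe[symmetric] indicator_def)
      also have "\<dots> ^ 6 \<le> (ennreal (1728 * pi) * band_weight J) ^ 3 * (\<integral>\<^sup>+u. \<integral>\<^sup>+v. \<integral>\<^sup>+w. ?F x u v w \<partial>?\<sigma> \<partial>?\<sigma> \<partial>?\<sigma>)"
        by (rule band_integral_pow6_le_axis[OF _ _ J e]) (auto simp: H0)
      also have "(ennreal (1728 * pi) * band_weight J) ^ 3 \<le> ?c"
        unfolding power_mult_distrib using A[OF True x0] by (intro mult_left_mono) (auto simp: J_def)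
      finally show ?thesis using True by (simp add: mult_right_mono)
    qed simp
  qed
  also have "\<dots> = ?c * (\<integral>\<^sup>+x. \<integral>\<^sup>+u. \<integral>\<^sup>+v. \<integral>\<^sup>+w. ?F x u v w \<partial>?\<sigma> \<partial>?\<sigma> \<partial>?\<sigma> \<partial>lborel)"
    by (rule nn_integral_cmult) measurable
  also have "(\<integral>\<^sup>+x. \<integral>\<^sup>+u. \<integral>\<^sup>+v. \<integral>\<^sup>+w. ?F x u v w \<partial>?\<sigma> \<partial>?\<sigma> \<partial>?\<sigma> \<partial>lborel) = (\<integral>\<^sup>+u. \<integral>\<^sup>+x. \<integral>\<^sup>+v. \<integral>\<^sup>+w. ?F x u v w \<partial>?\<sigma> \<partial>?\<sigma> \<partial>lborel \<partial>?\<sigma>)"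
    by (rule nn_integral_swap[OF sl sf]) measurable
  also have "\<dots> = (\<integral>\<^sup>+u. \<integral>\<^sup>+v. \<integral>\<^sup>+x. \<integral>\<^sup>+w. ?F x u v w \<partial>?\<sigma> \<partial>lborel \<partial>?\<sigma> \<partial>?\<sigma>)"
    by (rule nn_integral_cong, rule nn_integral_swap[OF sl sf]) measurable
  also have "\<dots> = (\<integral>\<^sup>+u. \<integral>\<^sup>+v. \<integral>\<^sup>+w. \<integral>\<^sup>+x. ?F x u v w \<partial>lborel \<partial>?\<sigma> \<partial>?\<sigma> \<partial>?\<sigma>)"
    by (rule nn_integral_cong, rule nn_integral_cong, rule nn_integral_swap[OF sl sf]) measurable
  also have "\<dots> \<le> (\<integral>\<^sup>+u. \<integral>\<^sup>+v. \<integral>\<^sup>+w. (\<integral>\<^sup>+s. ennreal ((H (s, u))\<^sup>2) \<partial>lborel) * (\<integral>\<^sup>+s. ennreal ((H (s, v))\<^sup>2) \<partial>lborel) * (\<integral>\<^sup>+s. ennreal ((H (s, w))\<^sup>2) \<partial>lborel) \<partial>?\<sigma> \<partial>?\<sigma> \<partial>?\<sigma>)"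
  proof (intro nn_integral_mono)
    fix u v w :: "real^3"
    have "(\<integral>\<^sup>+x. ?F x u v w \<partial>lborel) = (\<integral>\<^sup>+x. ennreal (vol3 u v w) * (ennreal ((H (x \<bullet> u, u))\<^sup>2) * ennreal ((H (x \<bullet> v, v))\<^sup>2) * ennreal ((H (x \<bullet> w, w))\<^sup>2)) \<partial>lborel)"
      by (rule nn_integral_cong) (simp add: power_mult_distrib ennreal_mult vol3_def mult_ac)
    also have "\<dots> = ennreal (vol3 u v w) * (\<integral>\<^sup>+x. ennreal ((H (x \<bullet> u, u))\<^sup>2) * ennreal ((H (x \<bullet> v, v))\<^sup>2) * ennreal ((H (x \<bullet> w, w))\<^sup>2) \<partial>lborel)"
      by (rule nn_integral_cmult, intro borel_measurable_times_ennreal m2)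
    also have "\<dots> \<le> (\<integral>\<^sup>+s. ennreal ((H (s, u))\<^sup>2) \<partial>lborel) * (\<integral>\<^sup>+s. ennreal ((H (s, v))\<^sup>2) \<partial>lborel) * (\<integral>\<^sup>+s. ennreal ((H (s, w))\<^sup>2) \<partial>lborel)"
      by (intro nn_integral_three_planes m1)
    finally show "(\<integral>\<^sup>+x. ?F x u v w \<partial>lborel) \<le> (\<integral>\<^sup>+s. ennreal ((H (s, u))\<^sup>2) \<partial>lborel) * (\<integral>\<^sup>+s. ennreal ((H (s, v))\<^sup>2) \<partial>lborel) * (\<integral>\<^sup>+s. ennreal ((H (s, w))\<^sup>2) \<partial>lborel)" .
  qed
  also have "\<dots> = (\<integral>\<^sup>+w. \<integral>\<^sup>+s. ennreal ((H (s, w))\<^sup>2) \<partial>lborel \<partial>?\<sigma>) ^ 3"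
    by (simp add: nn_integral_cmult nn_integral_multc power3_eq_cube)
  also have "(\<integral>\<^sup>+w. \<integral>\<^sup>+s. ennreal ((H (s, w))\<^sup>2) \<partial>lborel \<partial>?\<sigma>) = (\<integral>\<^sup>+p. ennreal ((H p)\<^sup>2) \<partial>cyl_measure)"
  proof -
    interpret P: pair_sigma_finite "lborel :: real measure" ?\<sigma> by unfold_locales
    have "(\<lambda>p. ennreal ((H (fst p, snd p))\<^sup>2)) \<in> borel_measurable (lborel \<Otimes>\<^sub>M ?\<sigma>)" by measurable
    then show ?thesis unfolding cyl_measure_def by (subst P.nn_integral_snd) simp_all
  qed
  finally show ?thesis by (simp add: mult_left_mono)
qed

text \<open>
  Composition with this retraction extends functions on the sphere to Borel functions on space.
\<close>

definition sphere_retract :: "real^3 \<Rightarrow> real^3" where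
  "sphere_retract w = (if w = 0 then axis 3 1 else w /\<^sub>R norm w)"

lemma measurable_sphere_retract: "sphere_retract \<in> measurable borel sphere_measure"
proof -
  have "sphere_retract \<in> measurable borel (restrict_space borel (sphere 0 1))"
    by (rule measurable_restrict_space2) (auto simp: sphere_retract_def[abs_def] norm_axis_1)
  then show ?thesis by (simp cong: measurable_cong_sets add: sets_sphere_measure)
qed

text \<open>
  The function \<open>G\<close> vanishes outside \<open>K\<close> only almost everywhere, and its values there might matter for
  individual \<open>x\<close>.  They matter for a null set of \<open>x\<close> only, because the part of \<open>G\<close> outside \<open>K\<close> has norm
  \<open>0\<close> and the previous estimate applies to it with \<open>K\<close> replaced by the whole line.
\<close>

lemma T_op_pow6_bound:
  assumes G: "in_L2 G" and supp: "supported_in G K" and K[measurable]: "K \<in> sets borel" and \<Omega>[measurable]: "\<Omega> \<in> sets borel"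
    and A: "\<And>x. x \<in> \<Omega> \<Longrightarrow> x \<noteq> 0 \<Longrightarrow> band_weight {s. norm x * s \<in> K} ^ 3 \<le> A"
  shows "(\<integral>\<^sup>+x\<in>\<Omega>. ennreal (norm (T_op G x) ^ 6) \<partial>lborel) \<le> ennreal (1728 * pi) ^ 3 * A * ennreal (L2_norm G ^ 6)"
proof -
  let ?\<sigma> = sphere_measure
  interpret sig: finite_measure ?\<sigma> by (rule finite_measure_sphere)
  have mG: "G \<in> borel_measurable cyl_measure" and iG: "integrable cyl_measure (\<lambda>p. (norm (G p))\<^sup>2)"
    using G by (auto simp: in_L2_def)
  define H where "H p = norm (G (fst p, sphere_retract (snd p)))" for p
  have H0: "0 \<le> H p" for p by (simp add: H_def)
  have H[measurable]: "H \<in> borel_measurable (borel \<Otimes>\<^sub>M borel)"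
  proof -
    have "(\<lambda>p. (fst p, sphere_retract (snd p))) \<in> measurable (borel \<Otimes>\<^sub>M borel) (lborel \<Otimes>\<^sub>M ?\<sigma>)"
      by (intro measurable_Pair measurable_compose[OF measurable_snd measurable_sphere_retract]) simp
    from measurable_compose[OF this mG[unfolded cyl_measure_def]] show ?thesis
      unfolding H_def[abs_def] by measurable
  qed
  have retr: "sphere_retract w = w" if "w \<in> space ?\<sigma>" for w
    using that by (auto simp: space_sphere_measure sphere_retract_def)
  have spc: "space cyl_measure = UNIV \<times> space ?\<sigma>" by (simp add: cyl_measure_def space_pair_measure)
  have HG: "H p = norm (G p)" if "p \<in> space cyl_measure" for p
    using that retr by (cases p) (auto simp: H_def spc)
  have L2: "(\<integral>\<^sup>+p. ennreal ((H p)\<^sup>2) \<partial>cyl_measure) = ennreal ((L2_norm G)\<^sup>2)"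
  proof -
    have "(\<integral>\<^sup>+p. ennreal ((H p)\<^sup>2) \<partial>cyl_measure) = (\<integral>\<^sup>+p. ennreal ((norm (G p))\<^sup>2) \<partial>cyl_measure)"
      by (rule nn_integral_cong) (simp add: HG)
    also have "\<dots> = ennreal (LINT p|cyl_measure. (norm (G p))\<^sup>2)"
      by (rule nn_integral_eq_integral[OF iG]) simp
    also have "(LINT p|cyl_measure. (norm (G p))\<^sup>2) = (L2_norm G)\<^sup>2"
      unfolding L2_norm_def by (subst real_sqrt_pow2) (auto intro: integral_nonneg_AE)
    finally show ?thesis .
  qed
  define I where "I x = (\<integral>\<^sup>+w. ennreal (H (x \<bullet> w, w)) * indicator K (x \<bullet> w) \<partial>?\<sigma>)" for x
  define H' where "H' p = H p * indicator (- K) (fst p)" for p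
  define I' where "I' x = (\<integral>\<^sup>+w. ennreal (H' (x \<bullet> w, w)) \<partial>?\<sigma>)" for x
  have H'[measurable]: "H' \<in> borel_measurable (borel \<Otimes>\<^sub>M borel)" unfolding H'_def[abs_def] by measurable
  have snd'[measurable]: "snd \<in> measurable (borel \<Otimes>\<^sub>M ?\<sigma>) (borel :: (real^3) measure)"
    using measurable_compose[OF measurable_snd measurable_sphere_ident] by auto
  have snd''[measurable]: "snd \<in> measurable (lborel \<Otimes>\<^sub>M ?\<sigma>) (borel :: (real^3) measure)"
    using measurable_compose[OF measurable_snd measurable_sphere_ident] by auto
  have mI'[measurable]: "I' \<in> borel_measurable lborel"
    unfolding I'_def[abs_def] by measurable
  \<comment> \<open>The infinite constant is harmless: it is multiplied by zero.\<close>
  have "(\<integral>\<^sup>+x. I' x ^ 6 \<partial>lborel) \<le> ennreal (1728 * pi) ^ 3 * top * (\<integral>\<^sup>+p. ennreal ((H' p)\<^sup>2) \<partial>cyl_measure) ^ 3"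
    using nn_integral_radon_dual_pow6[OF H', of UNIV UNIV top] by (simp add: I'_def H'_def H0)
  also have "(\<integral>\<^sup>+p. ennreal ((H' p)\<^sup>2) \<partial>cyl_measure) = (\<integral>\<^sup>+p. 0 \<partial>cyl_measure)"
  proof (rule nn_integral_cong_AE)
    show "AE p in cyl_measure. ennreal ((H' p)\<^sup>2) = 0"
      using supp[unfolded supported_in_def] AE_space
      by eventually_elim (auto simp: H'_def HG indicator_def)
  qed
  finally have "(\<integral>\<^sup>+x. I' x ^ 6 \<partial>lborel) = 0" by simp
  then have AE0: "AE x in lborel. I' x = 0"
    by (subst (asm) nn_integral_0_iff_AE) (auto elim: eventually_mono)
  have T: "ennreal (norm (T_op G x)) \<le> I x + I' x" for x
  proof -
    have "ennreal (norm (T_op G x)) \<le> (\<integral>\<^sup>+w. ennreal (norm (G (x \<bullet> w, w))) \<partial>?\<sigma>)"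
    proof (cases "integrable ?\<sigma> (\<lambda>w. G (x \<bullet> w, w))")
      case True
      then show ?thesis unfolding T_op_def by (rule integral_norm_bound_ennreal)
    next
      case False
      then show ?thesis unfolding T_op_def by (simp add: not_integrable_integral_eq)
    qed
    also have "\<dots> = (\<integral>\<^sup>+w. ennreal (H (x \<bullet> w, w)) * indicator K (x \<bullet> w) + ennreal (H' (x \<bullet> w, w)) \<partial>?\<sigma>)"
      by (rule nn_integral_cong) (auto simp: H'_def HG spc indicator_def)
    also have "\<dots> = I x + I' x"
    proof -
      have "(\<lambda>w. ennreal (H (x \<bullet> w, w)) * indicator K (x \<bullet> w)) \<in> borel_measurable borel"
        "(\<lambda>w. ennreal (H' (x \<bullet> w, w))) \<in> borel_measurable borel" by measurable
      then have "(\<lambda>w. ennreal (H (x \<bullet> w, w)) * indicator K (x \<bullet> w)) \<in> borel_measurable ?\<sigma>"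
        "(\<lambda>w. ennreal (H' (x \<bullet> w, w))) \<in> borel_measurable ?\<sigma>" by (auto intro: measurable_sphere_borel)
      then show ?thesis unfolding I_def I'_def by (rule nn_integral_add)
    qed
    finally show ?thesis .
  qed
  have "(\<integral>\<^sup>+x\<in>\<Omega>. ennreal (norm (T_op G x) ^ 6) \<partial>lborel) \<le> (\<integral>\<^sup>+x\<in>\<Omega>. I x ^ 6 \<partial>lborel)"
  proof (rule nn_integral_mono_AE, rule eventually_mono[OF AE0])
    fix x assume "I' x = 0"
    then have "ennreal (norm (T_op G x)) \<le> I x" using T[of x] by simp
    then have "ennreal (norm (T_op G x)) ^ 6 \<le> I x ^ 6" by (intro power_mono) auto
    then show "ennreal (norm (T_op G x) ^ 6) * indicator \<Omega> x \<le> I x ^ 6 * indicator \<Omega> x"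
      by (intro mult_right_mono) (auto simp: ennreal_power)
  qed
  also have "\<dots> \<le> ennreal (1728 * pi) ^ 3 * A * (\<integral>\<^sup>+p. ennreal ((H p)\<^sup>2) \<partial>cyl_measure) ^ 3"
    unfolding I_def by (rule nn_integral_radon_dual_pow6[OF H H0 K \<Omega> A])
  also have "(\<integral>\<^sup>+p. ennreal ((H p)\<^sup>2) \<partial>cyl_measure) ^ 3 = ennreal (L2_norm G ^ 6)"
    unfolding L2 by (simp add: ennreal_power flip: power_mult)
  finally show ?thesis .
qed

text \<open>
  For \<open>|x| = r\<close> the heights in the band range from \<open>\<alpha> = a/r\<close> to \<open>min (b/r) 1\<close>, and \<open>b \<le> 2 a\<close> makes its
  width comparable to \<open>\<delta> \<alpha>\<close>.
\<close>

lemma rescaled_annulus_width: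
  fixes a b r :: real
  assumes ab: "0 < a" "a < b" "b / a \<le> 2" and r: "a < r"
  defines "\<alpha> \<equiv> a / r" and "\<delta> \<equiv> 1 - a / b"
  shows "0 \<le> min (b / r) 1 - \<alpha>" "min (b / r) 1 - \<alpha> \<le> 2 * \<delta> * \<alpha>" "min (b / r) 1 - \<alpha> \<le> 1 - \<alpha>" "0 < \<alpha>" "\<alpha> < 1" "0 < \<delta>"
proof -
  have b2: "b \<le> 2 * a" using ab by (simp add: field_simps)
  have "b / r - \<alpha> = \<delta> * (b / a) * \<alpha>" using ab r by (simp add: \<alpha>_def \<delta>_def field_simps)
  moreover have "\<delta> * (b / a) * \<alpha> \<le> \<delta> * 2 * \<alpha>"
    using ab r by (intro mult_right_mono mult_left_mono) (auto simp: \<alpha>_def \<delta>_def)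
  ultimately show "min (b / r) 1 - \<alpha> \<le> 2 * \<delta> * \<alpha>" by simp
  show "0 \<le> min (b / r) 1 - \<alpha>" using ab r by (auto simp: \<alpha>_def divide_right_mono)
  show "0 < \<alpha>" "\<alpha> < 1" "0 < \<delta>" using ab r by (auto simp: \<alpha>_def \<delta>_def)
qed simp

lemma band_weight_annulus_outer:
  assumes ab: "0 < a" "a < b" "b / a \<le> 2" and R: "b \<le> R" and r: "R < r"
  shows "band_weight {s. r * s \<in> {-b..-a} \<union> {a..b}} ^ 3 \<le> ennreal (216 * ((a / R)\<^sup>2 * (1 - a / b) ^ 3 / (1 - a / R)))"
proof -
  let ?\<alpha> = "a / r" and ?\<delta> = "1 - a / b"
  have ar: "a < r" using ab R r by simp
  note B = rescaled_annulus_width[OF ab ar]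
  have den: "0 \<le> ?\<alpha> * (1 - ?\<alpha>)" using B(4,5) by (intro mult_nonneg_nonneg) linarith+
  have "band_weight {s. r * s \<in> {-b..-a} \<union> {a..b}} ^ 3 \<le> ennreal (27 * (min (b / r) 1 - ?\<alpha>) ^ 3 / (?\<alpha> * (1 - ?\<alpha>)))"
  proof (rule band_weight_annulus)
    fix s assume "s \<in> {s. r * s \<in> {-b..-a} \<union> {a..b}}"
    then have "a \<le> \<bar>r * s\<bar>" "\<bar>r * s\<bar> \<le> b" using ab by auto
    then show "?\<alpha> \<le> \<bar>s\<bar> \<and> \<bar>s\<bar> \<le> b / r" using ab R r by (simp add: abs_mult field_simps)
  qed (use B ab R r in \<open>auto simp: divide_right_mono\<close>)
  also have "\<dots> \<le> ennreal (216 * ((a / R)\<^sup>2 * ?\<delta> ^ 3 / (1 - a / R)))"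
  proof (rule ennreal_leI)
    have "(min (b / r) 1 - ?\<alpha>) ^ 3 \<le> (2 * ?\<delta> * ?\<alpha>) ^ 3" using B by (intro power_mono) auto
    then have "27 * (min (b / r) 1 - ?\<alpha>) ^ 3 / (?\<alpha> * (1 - ?\<alpha>)) \<le> 27 * (2 * ?\<delta> * ?\<alpha>) ^ 3 / (?\<alpha> * (1 - ?\<alpha>))"
      by (intro divide_right_mono[OF _ den] mult_left_mono) auto
    also have "\<dots> = 216 * (?\<delta> ^ 3 * ?\<alpha>\<^sup>2) / (1 - ?\<alpha>)"
    proof -
      have alg: "27 * (2 * d * x) ^ 3 / (x * y) = 216 * (d ^ 3 * x\<^sup>2) / y" if "x \<noteq> 0" for x y d :: real
        using that by (simp add: power_mult_distrib power3_eq_cube power2_eq_square)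
      show ?thesis by (rule alg) (use B(4) in linarith)
    qed
    also have "\<dots> \<le> 216 * (?\<delta> ^ 3 * (a / R)\<^sup>2) / (1 - a / R)"
    proof (rule frac_le)
      have le: "?\<alpha> \<le> a / R" using ab R r by (intro divide_left_mono) auto
      then show "216 * (?\<delta> ^ 3 * ?\<alpha>\<^sup>2) \<le> 216 * (?\<delta> ^ 3 * (a / R)\<^sup>2)"
        using B by (intro mult_left_mono power_mono) auto
      show "1 - a / R \<le> 1 - ?\<alpha>" using le by simp
      show "0 < 1 - a / R" using ab R by simp
    qed (use B in auto)
    finally show "27 * (min (b / r) 1 - ?\<alpha>) ^ 3 / (?\<alpha> * (1 - ?\<alpha>)) \<le> 216 * ((a / R)\<^sup>2 * ?\<delta> ^ 3 / (1 - a / R))"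
      by (simp add: mult_ac)
  qed
  finally show ?thesis .
qed

text \<open>
  No direction has height above \<open>1\<close>, so \<open>1 - \<alpha>\<close> is a second bound for the width of the band; it
  absorbs the factor \<open>1 - \<alpha>\<close> in the denominator.
\<close>

lemma band_weight_annulus_global:
  assumes ab: "0 < a" "a < b" "b / a \<le> 2" and r: "0 < r"
  shows "band_weight {s. r * s \<in> {-b..-a} \<union> {a..b}} ^ 3 \<le> ennreal (216 * (1 - a / b)\<^sup>2)"
proof (cases "a < r")
  case True
  let ?\<alpha> = "a / r" and ?\<delta> = "1 - a / b"
  note B = rescaled_annulus_width[OF ab True]
  have den: "0 \<le> ?\<alpha> * (1 - ?\<alpha>)" using B(4,5) by (intro mult_nonneg_nonneg) linarith+
  have "band_weight {s. r * s \<in> {-b..-a} \<union> {a..b}} ^ 3 \<le> ennreal (27 * (min (b / r) 1 - ?\<alpha>) ^ 3 / (?\<alpha> * (1 - ?\<alpha>)))"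
  proof (rule band_weight_annulus)
    fix s assume "s \<in> {s. r * s \<in> {-b..-a} \<union> {a..b}}"
    then have "a \<le> \<bar>r * s\<bar>" "\<bar>r * s\<bar> \<le> b" using ab by auto
    then show "?\<alpha> \<le> \<bar>s\<bar> \<and> \<bar>s\<bar> \<le> b / r" using ab r by (simp add: abs_mult field_simps)
  qed (use B ab r in \<open>auto simp: divide_right_mono\<close>)
  also have "\<dots> \<le> ennreal (216 * ?\<delta>\<^sup>2)"
  proof (rule ennreal_leI)
    let ?m = "min (b / r) 1 - ?\<alpha>"
    have "?m ^ 3 = ?m\<^sup>2 * ?m" by (simp add: power3_eq_cube power2_eq_square)
    also have "\<dots> \<le> (2 * ?\<delta> * ?\<alpha>)\<^sup>2 * (1 - ?\<alpha>)" using B by (intro mult_mono power_mono) auto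
    finally have "27 * ?m ^ 3 / (?\<alpha> * (1 - ?\<alpha>)) \<le> 27 * ((2 * ?\<delta> * ?\<alpha>)\<^sup>2 * (1 - ?\<alpha>)) / (?\<alpha> * (1 - ?\<alpha>))"
      by (intro divide_right_mono[OF _ den] mult_left_mono) auto
    also have "\<dots> = 108 * ?\<delta>\<^sup>2 * ?\<alpha>"
    proof -
      have alg: "27 * ((2 * d * x)\<^sup>2 * y) / (x * y) = 108 * d\<^sup>2 * x" if "x \<noteq> 0" "y \<noteq> 0" for x y d :: real
        using that by (simp add: power_mult_distrib power2_eq_square)
      show ?thesis by (rule alg) (use B(4,5) in linarith)+
    qed
    also have "\<dots> \<le> 108 * ?\<delta>\<^sup>2 * 1" using B by (intro mult_left_mono) auto
    also have "\<dots> \<le> 216 * ?\<delta>\<^sup>2" by simp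
    finally show "27 * ?m ^ 3 / (?\<alpha> * (1 - ?\<alpha>)) \<le> 216 * ?\<delta>\<^sup>2" .
  qed
  finally show ?thesis .
next
  case False
  have out: "\<not> (\<bar>s\<bar> < 1)" if "r * s \<in> {-b..-a} \<union> {a..b}" for s
  proof
    assume "\<bar>s\<bar> < 1"
    then have "r * \<bar>s\<bar> < r * 1" using r by (intro mult_strict_left_mono) auto
    moreover have "a \<le> \<bar>r * s\<bar>" using that ab by auto
    then have "a \<le> r * \<bar>s\<bar>" using r by (simp add: abs_mult)
    ultimately show False using False by simp
  qed
  have "band_weight {s. r * s \<in> {-b..-a} \<union> {a..b}} = (\<integral>\<^sup>+s. 0 \<partial>(lborel :: real measure))"
    unfolding band_weight_def by (rule nn_integral_cong) (use out in \<open>auto simp: indicator_def abs_less_iff\<close>)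
  then show ?thesis by simp
qed

lemma band_weight_disc_outer:
  assumes b: "0 < b" and R: "b \<le> R" and r: "R < r"
  shows "band_weight {s. r * s \<in> {-b..b}} ^ 3 \<le> ennreal (216 * (b / R)\<^sup>2)"
proof -
  have "band_weight {s. r * s \<in> {-b..b}} ^ 3 \<le> ennreal (216 * (b / r)\<^sup>2)"
  proof (rule band_weight_disc)
    fix s assume "s \<in> {s. r * s \<in> {-b..b}}"
    then have "\<bar>r * s\<bar> \<le> b" by auto
    then show "\<bar>s\<bar> \<le> b / r" using b R r by (simp add: abs_mult field_simps)
  qed (use b R r in auto)
  also have "\<dots> \<le> ennreal (216 * (b / R)\<^sup>2)"
    using b R r by (intro ennreal_leI mult_left_mono power_mono divide_left_mono) auto
  finally show ?thesis .
qed

theorem proposition1p3: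
  shows "\<exists>C::real. C > 0 \<and>
    (\<forall>a b :: real. \<forall>G :: real \<times> (real^3) \<Rightarrow> complex.
       b > a \<longrightarrow> a > 0 \<longrightarrow> b / a \<le> 2 \<longrightarrow> in_L2 G \<longrightarrow> supported_in G ({-b..-a} \<union> {a..b}) \<longrightarrow>
         (\<forall>R\<ge>b. (\<integral>\<^sup>+x\<in>{x. norm x > R}. ennreal (norm (T_op G x) ^ 6) \<partial>lborel)
                  \<le> ennreal (C * ((a / R)\<^sup>2 * (1 - a / b) ^ 3 / (1 - a / R)) * L2_norm G ^ 6))
       \<and> (\<integral>\<^sup>+x. ennreal (norm (T_op G x) ^ 6) \<partial>lborel)
           \<le> ennreal (C * (1 - a / b)\<^sup>2 * L2_norm G ^ 6)) \<and>
    (\<forall>R b :: real. \<forall>G :: real \<times> (real^3) \<Rightarrow> complex.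
       R \<ge> b \<longrightarrow> b > 0 \<longrightarrow> in_L2 G \<longrightarrow> supported_in G {-b..b} \<longrightarrow>
         (\<integral>\<^sup>+x\<in>{x. norm x > R}. ennreal (norm (T_op G x) ^ 6) \<partial>lborel)
           \<le> ennreal (C * (b / R)\<^sup>2 * L2_norm G ^ 6))"
proof -
  define C where "C = (1728 * pi) ^ 3 * 216"
  have C0: "C > 0" by (simp add: C_def)
  have L0: "0 \<le> L2_norm G" for G by (simp add: L2_norm_def integral_nonneg_AE)
  have const: "ennreal (1728 * pi) ^ 3 * ennreal (216 * q) * ennreal (L2_norm G ^ 6) = ennreal (C * q * L2_norm G ^ 6)"
    if "0 \<le> q" for q G
    using that L0[of G] by (simp add: C_def ennreal_power ennreal_mult[symmetric] mult_ac)
  have out: "{x::real^3. norm x > R} \<in> sets borel" for R by measurable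
  show ?thesis
  proof (intro exI[of _ C] conjI allI impI C0)
    fix a b :: real and G R
    assume ab: "b > a" "a > 0" "b / a \<le> 2" and G: "in_L2 G" and s: "supported_in G ({-b..-a} \<union> {a..b})" and R: "R \<ge> b"
    let ?q = "(a / R)\<^sup>2 * (1 - a / b) ^ 3 / (1 - a / R)"
    have "0 \<le> ?q" using ab R by (intro divide_nonneg_nonneg mult_nonneg_nonneg) auto
    then show "(\<integral>\<^sup>+x\<in>{x. norm x > R}. ennreal (norm (T_op G x) ^ 6) \<partial>lborel) \<le> ennreal (C * ?q * L2_norm G ^ 6)"
      unfolding const[symmetric, OF \<open>0 \<le> ?q\<close>]
      by (intro T_op_pow6_bound[OF G s] out band_weight_annulus_outer) (use ab R in auto)
  next
    fix a b :: real and G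
    assume ab: "b > a" "a > 0" "b / a \<le> 2" and G: "in_L2 G" and s: "supported_in G ({-b..-a} \<union> {a..b})"
    have "(\<integral>\<^sup>+x\<in>UNIV. ennreal (norm (T_op G x) ^ 6) \<partial>lborel) \<le> ennreal (C * (1 - a / b)\<^sup>2 * L2_norm G ^ 6)"
      unfolding const[symmetric, OF zero_le_power2]
      by (intro T_op_pow6_bound[OF G s] band_weight_annulus_global) (use ab in auto)
    then show "(\<integral>\<^sup>+x. ennreal (norm (T_op G x) ^ 6) \<partial>lborel) \<le> ennreal (C * (1 - a / b)\<^sup>2 * L2_norm G ^ 6)"
      by simp
  next
    fix R b :: real and G
    assume R: "R \<ge> b" and b: "b > 0" and G: "in_L2 G" and s: "supported_in G {-b..b}"
    show "(\<integral>\<^sup>+x\<in>{x. norm x > R}. ennreal (norm (T_op G x) ^ 6) \<partial>lborel) \<le> ennreal (C * (b / R)\<^sup>2 * L2_norm G ^ 6)"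
      unfolding const[symmetric, OF zero_le_power2]
      by (intro T_op_pow6_bound[OF G s] out band_weight_disc_outer) (use b R in auto)
  qed
qed

end
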